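(* Let $d\ge1$ and let $X_t$ be Brownian motion on $\mathbb{T}^d=(\mathbb{R}/2\pi\mathbb{Z})^d$ with drift $v=(v_1,\dots,v_d)\in\mathbb{R}^d$, such that $v_1,\dots,v_d$ are rationally independent (linearly independent over $\mathbb{Q}$). Then the family $$\mathcal{F}_d=\{\mathbf{1}_{\Omega}\mid \Omega\subseteq\mathbb{T}^d \text{ open},\ \mathrm{Lebesgue}_d(\partial\Omega)=0\}$$ is reconstructible by $X_t$.
   Context: Brownian motion on $\mathbb{T}^d$ with drift $v$ is the projection to $\mathbb{T}^d=(\mathbb{R}/2\pi\mathbb{Z})^d$ of $X_0+B_t+vt$, where $B_t$ is standard Brownian motion in $\mathbb{R}^d$. Reconstructibility: a family $\mathcal{F}$ of real functions on $\mathbb{T}^d$ is reconstructible by $X_t$ if there is a function $A:\mathbb{R}^{\mathbb{R}^+}\to\mathbb{R}^{\mathbb{T}^d}$ (with $\mathbb{R}^+=[0,\infty)$) such that for every $f\in\mathcal{F}$, with probability $1$ there exists a (random) shift $\theta\in\mathbb{T}^d$ such that $A\big((f(X_t))_{t\ge0}\big)(x)=f(x+\theta)$ for almost all $x$. *)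

theory Defs
  imports "HOL-Probability.Probability"
begin

section \<open>The torus\<close>

quotient_type circle = real / "\<lambda>x y. \<exists>k::int. x - y = 2 * pi * of_int k"
proof (rule equivpI)
  show "reflp (\<lambda>x y. \<exists>k::int. x - y = 2 * pi * of_int k)"
    by (rule reflpI) (rule exI[of _ 0], simp)
  show "symp (\<lambda>x y. \<exists>k::int. x - y = 2 * pi * of_int k)"
  proof (rule sympI)
    fix x y :: real
    assume "\<exists>k::int. x - y = 2 * pi * of_int k"
    then obtain k :: int where "x - y = 2 * pi * of_int k" by blast
    then have "y - x = 2 * pi * of_int (- k)" by simp
    then show "\<exists>k::int. y - x = 2 * pi * of_int k" by blast
  qed
  show "transp (\<lambda>x y. \<exists>k::int. x - y = 2 * pi * of_int k)"
  proof (rule transpI)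
    fix x y z :: real
    assume "\<exists>k::int. x - y = 2 * pi * of_int k" "\<exists>k::int. y - z = 2 * pi * of_int k"
    then obtain k l :: int where "x - y = 2 * pi * of_int k" "y - z = 2 * pi * of_int l" by blast
    then have "x - z = 2 * pi * of_int (k + l)" by (simp add: distrib_left)
    then show "\<exists>k::int. x - z = 2 * pi * of_int k" by blast
  qed
qed

lift_definition to_circle :: "real \<Rightarrow> circle" is "\<lambda>x. x" .

instantiation circle :: ab_group_add
begin

lift_definition zero_circle :: circle is 0 .

lift_definition plus_circle :: "circle \<Rightarrow> circle \<Rightarrow> circle" is "(+)"
proof -
  fix a b c d :: real
  assume "\<exists>k::int. a - b = 2 * pi * of_int k" "\<exists>k::int. c - d = 2 * pi * of_int k"
  then obtain k l :: int where "a - b = 2 * pi * of_int k" "c - d = 2 * pi * of_int l" by blast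
  then have "(a + c) - (b + d) = 2 * pi * of_int (k + l)" by (simp add: distrib_left)
  then show "\<exists>k::int. (a + c) - (b + d) = 2 * pi * of_int k" by blast
qed

lift_definition uminus_circle :: "circle \<Rightarrow> circle" is uminus
proof -
  fix a b :: real
  assume "\<exists>k::int. a - b = 2 * pi * of_int k"
  then obtain k :: int where "a - b = 2 * pi * of_int k" by blast
  then have "- a - (- b) = 2 * pi * of_int (- k)" by simp
  then show "\<exists>k::int. - a - (- b) = 2 * pi * of_int k" by blast
qed

definition minus_circle :: "circle \<Rightarrow> circle \<Rightarrow> circle" where
  "minus_circle x y = x + (- y)"

instance
  by standard (simp add: minus_circle_def | (transfer, rule exI[of _ 0], simp))+

end

instantiation circle :: topological_space
begin

definition open_circle :: "circle set \<Rightarrow> bool" where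
  "open_circle U \<longleftrightarrow> open (to_circle -` U)"

instance
proof
  show "open (UNIV :: circle set)"
    by (simp add: open_circle_def)
  show "open (S \<inter> T)" if "open S" "open T" for S T :: "circle set"
    using that by (auto simp: open_circle_def vimage_Int)
  show "open (\<Union> K)" if "\<forall>S\<in>K. open S" for K :: "circle set set"
    using that by (auto simp: open_circle_def vimage_Union)
qed

end

type_synonym 'n torus = "circle ^ 'n"

definition to_torus :: "real ^ 'n \<Rightarrow> ('n::finite) torus" where
  "to_torus x = (\<chi> i. to_circle (x $ i))"

lemma continuous_to_circle: "continuous_on UNIV to_circle"
  by (simp add: continuous_on_open_vimage open_circle_def)

lemma continuous_to_torus: "continuous_on UNIV (to_torus :: real ^ 'n::finite \<Rightarrow> 'n torus)"
  unfolding to_torus_def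
  by (intro continuous_on_vec_lambda continuous_on_compose2[OF continuous_to_circle]
      continuous_intros) auto

lemma measurable_to_torus [measurable]: "to_torus \<in> borel \<rightarrow>\<^sub>M borel"
  by (rule borel_measurable_continuous_onI[OF continuous_to_torus])

text \<open>
  Lebesgue measure on the torus (total mass \<open>(2\<pi>)\<^sup>d\<close>), transported from the fundamental
  domain \<open>[0, 2\<pi>)\<^sup>d\<close>.
\<close>

definition torus_lebesgue :: "('n::finite) torus measure" where
  "torus_lebesgue =
     distr (restrict_space lborel {x :: real ^ 'n. \<forall>i. 0 \<le> x $ i \<and> x $ i < 2 * pi}) borel to_torus"

section \<open>Brownian motion\<close>

text \<open>The processes are indexed by \<^typ>\<open>real\<close>, but only times \<open>t \<ge> 0\<close> are constrained.\<close>

definition standard_brownian_motion ::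
    "'w measure \<Rightarrow> (real \<Rightarrow> 'w \<Rightarrow> real ^ 'n::finite) \<Rightarrow> bool" where
  "standard_brownian_motion M B \<longleftrightarrow>
     prob_space M \<and>
     (\<forall>t\<ge>0. B t \<in> M \<rightarrow>\<^sub>M borel) \<and>
     (AE \<omega> in M. B 0 \<omega> = 0) \<and>
     (\<forall>(t :: nat \<Rightarrow> real) n. 0 \<le> t 0 \<longrightarrow> (\<forall>k<n. t k < t (Suc k)) \<longrightarrow>
        prob_space.indep_vars M (\<lambda>_. borel) (\<lambda>k \<omega>. B (t (Suc k)) \<omega> - B (t k) \<omega>) {..<n}) \<and>
     (\<forall>s t. 0 \<le> s \<longrightarrow> s < t \<longrightarrow>
        distributed M lborel (\<lambda>\<omega>. B t \<omega> - B s \<omega>)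
          (\<lambda>x. ennreal (\<Prod>i\<in>UNIV. normal_density 0 (sqrt (t - s)) (x $ i)))) \<and>
     (AE \<omega> in M. continuous_on {0..} (\<lambda>t. B t \<omega>))"

text \<open>
  The initial position has an arbitrary law and is independent of the whole driving process
  \<open>(B\<^sub>t)\<^sub>t\<^sub>\<ge>\<^sub>0\<close>, seen as a random element of the product space.  (The constant \<open>indep_var\<close> needs both variables
  to have the same type, hence the generated \<open>\<sigma>\<close>-algebras.)
\<close>

definition torus_brownian_motion ::
    "'w measure \<Rightarrow> real ^ 'n \<Rightarrow> (real \<Rightarrow> 'w \<Rightarrow> ('n::finite) torus) \<Rightarrow> bool" where
  "torus_brownian_motion M v X \<longleftrightarrow>
     (\<exists>X0 B. standard_brownian_motion M B \<and>
        X0 \<in> M \<rightarrow>\<^sub>M borel \<and>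
        prob_space.indep_set M
          (sets (vimage_algebra (space M) X0 borel))
          (sets (vimage_algebra (space M) (\<lambda>\<omega>. restrict (\<lambda>t. B t \<omega>) {0..})
             (Pi\<^sub>M {0..} (\<lambda>_. borel)))) \<and>
        (\<forall>t\<ge>0. \<forall>\<omega>\<in>space M. X t \<omega> = to_torus (X0 \<omega> + B t \<omega> + t *\<^sub>R v)))"

section \<open>Reconstruction\<close>

definition rationally_independent :: "real ^ 'n::finite \<Rightarrow> bool" where
  "rationally_independent v \<longleftrightarrow>
     (\<forall>q :: 'n \<Rightarrow> rat. (\<Sum>i\<in>UNIV. of_rat (q i) * v $ i) = 0 \<longrightarrow> (\<forall>i. q i = 0))"

text \<open>
  Restricting the path to \<open>{0..}\<close> makes \<open>A\<close> a function of \<open>(f(X\<^sub>t))\<^sub>t\<^sub>\<ge>\<^sub>0\<close> only.  No measurability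
  is required of \<open>A\<close>, and the exceptional sets of both \<open>AE\<close> quantifiers need only be contained in
  null sets.
\<close>

definition reconstructible ::
    "'w measure \<Rightarrow> (real \<Rightarrow> 'w \<Rightarrow> ('n::finite) torus) \<Rightarrow> ('n torus \<Rightarrow> real) set \<Rightarrow> bool" where
  "reconstructible M X F \<longleftrightarrow>
     (\<exists>A :: (real \<Rightarrow> real) \<Rightarrow> ('n torus \<Rightarrow> real). \<forall>f\<in>F.
        AE \<omega> in M. \<exists>\<theta>. AE x in torus_lebesgue.
          A (restrict (\<lambda>t. f (X t \<omega>)) {0..}) x = f (x + \<theta>))"

definition jordan_indicators :: "(('n::finite) torus \<Rightarrow> real) set" where
  "jordan_indicators =
     {indicator \<Omega> | \<Omega>. open \<Omega> \<and> emeasure torus_lebesgue (frontier \<Omega>) = 0}"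

end

theory Submission
  imports Defs
begin

text \<open>
  Write \<open>e\<^sub>n(x) = exp (\<i> n \<bullet> x)\<close> for \<open>n \<in> \<int>\<^sup>d\<close>. The Markov semigroup of the process is diagonal in this basis,
  with eigenvalues \<open>exp (t (- |n|\<^sup>2 / 2 + \<i> n \<bullet> v))\<close>. It mixes exponentially fast, so time averages of
  \<open>f (X(s)) f (X(s + t\<^sub>1)) f (X(s + t\<^sub>1 + t\<^sub>2)) \<dots>\<close> reveal almost surely all stationary correlations of \<open>f\<close> with rational
  time gaps. Expanding a correlation in Fourier modes gives a sum of exponentials in the gaps whose
  exponents are pairwise distinct because \<open>v\<close> is rationally independent; hence the correlations determine
  every product \<open>F(n\<^sub>1) \<dots> F(n\<^sub>k)\<close> of Fourier coefficients of \<open>f\<close> with \<open>n\<^sub>1 + \<dots> + n\<^sub>k = 0\<close>. If \<open>g\<close>, with coefficients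
  \<open>G(n)\<close>, has the same products, then \<open>n \<mapsto> G(n) / F(n)\<close> generates a homomorphism into the unit circle from the subgroup
  of \<open>\<int>\<^sup>d\<close> spanned by the support of \<open>F\<close>. It extends to \<open>\<int>\<^sup>d\<close>, where it has the form \<open>n \<mapsto> e\<^sub>n(\<theta>)\<close>, and so
  \<open>g(x) = f(x + \<theta>)\<close> almost everywhere. Since \<open>A\<close> is an arbitrary function, it
  may simply choose any \<open>f\<close> of the family for which the observed path is typical.
\<close>

text \<open>The law of the starting point is arbitrary, so the process need not be stationary.
  \<open>heat_mixing\<close> is uniform in the starting point, and averages over the times 1, 2, 3,
  ... still converge to the stationary correlations. The gaps are rational because one null set is
  discarded for each list of gaps, so only countably many lists are allowed. Modes with equal |n|
  decay at the same rate and can be told apart only by their phases n . v; this is where rational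
  independence acts. The averages give correlations at frequency 0 only, whereas the expansion in
  the first gap involves all frequencies. For this reason the Fourier factors are split off one at a
  time, each at the cost of one further gap. A translation multiplies F(n) by a character, so single
  phases cannot be recovered, and products with frequencies summing to 0 are the natural invariants.
  As F may vanish at many n, the quotient G(n) / F(n) makes sense only on the support of F, which
  may span a proper subgroup; the extension to the whole lattice rests on the existence of roots in
  the unit circle.\<close>

lemma to_circle_eq_iff: "to_circle x = to_circle y \<longleftrightarrow> (\<exists>k::int. x - y = 2 * pi * of_int k)"
  by transfer simp

lemma to_torus_eq_iff:
  "to_torus x = to_torus y \<longleftrightarrow> (\<forall>i. \<exists>k::int. x $ i - y $ i = 2 * pi * of_int k)"
  by (simp add: to_torus_def vec_eq_iff to_circle_eq_iff)

lemma to_torus_add: "to_torus (x + y) = to_torus x + to_torus y"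
  by (simp add: to_torus_def vec_eq_iff plus_circle.abs_eq to_circle_def)

text \<open>Functions on the torus are handled as functions on Euclidean space that are constant on
  the fibres of \<open>to_torus\<close>, so that integration takes place over
  \<open>real ^ 'n\<close>.\<close>

definition periodic :: "(real ^ 'n::finite \<Rightarrow> 'b) \<Rightarrow> bool" where
  "periodic h \<longleftrightarrow> (\<forall>x y. to_torus x = to_torus y \<longrightarrow> h x = h y)"

lemma periodicD: "periodic h \<Longrightarrow> to_torus x = to_torus y \<Longrightarrow> h x = h y"
  unfolding periodic_def by blast

section \<open>Characters and trigonometric polynomials\<close>

definition character :: "int ^ 'n::finite \<Rightarrow> real ^ 'n \<Rightarrow> complex" where
  "character n x = cis (\<Sum>i\<in>UNIV. of_int (n $ i) * x $ i)"

lemma character_0_left [simp]: "character 0 x = 1"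
  by (simp add: character_def)

lemma norm_character [simp]: "norm (character n x) = 1"
  by (simp add: character_def)

lemma character_add_left: "character (m + n) x = character m x * character n x"
  by (simp add: character_def cis_mult sum.distrib algebra_simps)

lemma character_add_right: "character n (x + y) = character n x * character n y"
  by (simp add: character_def cis_mult sum.distrib algebra_simps)

lemma character_minus_left: "character (- n) x = cnj (character n x)"
  by (simp add: character_def cis_cnj sum_negf)

lemma continuous_on_character [continuous_intros]: "continuous_on S (character n)"
  unfolding character_def cis_conv_exp by (intro continuous_intros)

lemma measurable_character [measurable]: "character n \<in> borel_measurable borel"
  by (intro borel_measurable_continuous_onI continuous_on_character)

lemma character_prod:
  fixes x :: "real ^ 'n::finite"
  shows "character n x = (\<Prod>i\<in>UNIV. cis (of_int (n $ i) * x $ i))"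
proof -
  have "cis (\<Sum>i\<in>A. f i) = (\<Prod>i\<in>A. cis (f i))" if "finite A" for A and f :: "'n \<Rightarrow> real"
    using that by (induction A) (auto simp: cis_mult[symmetric])
  then show ?thesis by (simp add: character_def)
qed

lemma cis_int_mult_period: 
  assumes "x - y = 2 * pi * of_int k"
  shows "cis (of_int n * x) = cis (of_int n * y)"
proof -
  have "of_int n * x = of_int n * y + 2 * pi * of_int (n * k)"
    using assms by (simp add: algebra_simps)
  then show ?thesis
    by (simp add: cis_mult[symmetric] cis_multiple_2pi)
qed

lemma periodic_character: "periodic (character n)"
  unfolding periodic_def character_prod to_torus_eq_iff
  by (intro allI impI prod.cong refl) (metis cis_int_mult_period)

inductive trig_poly :: "(real ^ 'n::finite \<Rightarrow> complex) \<Rightarrow> bool" where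
  character: "trig_poly (character n)"
| add: "trig_poly p \<Longrightarrow> trig_poly q \<Longrightarrow> trig_poly (\<lambda>x. p x + q x)"
| scale: "trig_poly p \<Longrightarrow> trig_poly (\<lambda>x. c * p x)"

lemma trig_poly_const: "trig_poly (\<lambda>x. c)"
  using trig_poly.scale[OF trig_poly.character[of 0], of c] by simp

lemma trig_poly_sum: "finite A \<Longrightarrow> (\<And>i. i \<in> A \<Longrightarrow> trig_poly (p i)) \<Longrightarrow> trig_poly (\<lambda>x. \<Sum>i\<in>A. p i x)"
  by (induction A rule: finite_induct) (auto intro: trig_poly_const trig_poly.add)

lemma trig_poly_mult:
  assumes "trig_poly p" "trig_poly q"
  shows "trig_poly (\<lambda>x. p x * q x)"
  using assms
proof (induction p rule: trig_poly.induct)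
  case (character n)
  from character.prems show ?case
  proof (induction q rule: trig_poly.induct)
    case (character m)
    then show ?case using trig_poly.character[of "n + m"]
      by (simp add: character_add_left[abs_def])
  next
    case (add p q)
    show ?case unfolding ring_distribs by (rule trig_poly.add) fact+
  next
    case (scale p c)
    show ?case unfolding mult.left_commute[of _ c] by (rule trig_poly.scale) fact
  qed
next
  case (add p1 p2)
  show ?case unfolding ring_distribs by (rule trig_poly.add) (use add in simp_all)
next
  case (scale p c)
  show ?case unfolding mult.assoc by (rule trig_poly.scale) (use scale in simp_all)
qed

lemma trig_poly_measurable: "trig_poly p \<Longrightarrow> p \<in> borel_measurable borel"
  by (induction rule: trig_poly.induct) auto

lemma trig_poly_bounded: "trig_poly p \<Longrightarrow> \<exists>B. \<forall>x. norm (p x) \<le> B"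
proof (induction rule: trig_poly.induct)
  case (add p q)
  then obtain A B where "\<forall>x. norm (p x) \<le> A" "\<forall>x. norm (q x) \<le> B" by blast
  then have "\<forall>x. norm (p x + q x) \<le> A + B"
    by (meson add_mono norm_triangle_ineq order_trans)
  then show ?case by blast
next
  case (scale p c)
  then obtain A where "\<forall>x. norm (p x) \<le> A" by blast
  then have "\<forall>x. norm (c * p x) \<le> norm c * A"
    by (simp add: norm_mult mult_left_mono)
  then show ?case by blast
qed (auto intro: exI[of _ 1])

text \<open>The embedding of the torus into the Euclidean space \<open>\<complex>\<^sup>d\<close>, where the library's
  Stone--Weierstrass theorem applies, and a Borel right inverse.\<close>

definition cis_vec :: "real ^ 'n::finite \<Rightarrow> complex ^ 'n" where
  "cis_vec x = (\<chi> i. cis (x $ i))"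

definition arg_vec :: "complex ^ 'n::finite \<Rightarrow> real ^ 'n" where
  "arg_vec z = (\<chi> i. (if Im (z $ i) \<ge> 0 then 1 else - 1) * arccos (max (- 1) (min 1 (Re (z $ i)))))"

lemma continuous_cis_vec: "continuous_on S cis_vec"
  unfolding cis_vec_def cis_conv_exp by (intro continuous_intros)

lemma measurable_cis_vec [measurable]: "cis_vec \<in> borel_measurable borel"
  by (intro borel_measurable_continuous_onI continuous_cis_vec)

lemma measurable_vec_lambda:
  fixes f :: "'a \<Rightarrow> 'n::finite \<Rightarrow> 'b::euclidean_space"
  assumes "\<And>i. (\<lambda>x. f x i) \<in> borel_measurable M"
  shows "(\<lambda>x. \<chi> i. f x i) \<in> borel_measurable M"
proof (subst borel_measurable_euclidean_space, intro ballI)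
  fix b :: "'b ^ 'n" assume "b \<in> Basis"
  then obtain i u where b: "b = axis i u" "u \<in> Basis" by (auto simp: Basis_vec_def)
  have "(\<lambda>x. (\<chi> i. f x i) \<bullet> b) = (\<lambda>x. f x i \<bullet> u)"
    by (simp add: b inner_axis)
  also have "\<dots> \<in> borel_measurable M" using assms[of i] by simp
  finally show "(\<lambda>x. (\<chi> i. f x i) \<bullet> b) \<in> borel_measurable M" .
qed

lemma measurable_arg_vec [measurable]: "arg_vec \<in> borel_measurable borel"
proof -
  have nth: "(\<lambda>z::complex^'n. z $ i) \<in> borel_measurable borel" for i
    by (intro borel_measurable_continuous_onI continuous_intros)
  \<comment> \<open>Clamping to [-1, 1] makes \<open>arccos\<close> continuous on the whole line; on
    the image of \<open>cis_vec\<close> it changes nothing.\<close>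
  have c: "continuous_on UNIV (\<lambda>r. arccos (max (- 1) (min 1 r)))"
    by (intro continuous_on_compose2[OF continuous_on_arccos' ] continuous_intros) auto
  have [measurable]: "(\<lambda>r. arccos (max (- 1) (min 1 r))) \<in> borel_measurable borel"
    by (rule borel_measurable_continuous_onI[OF c])
  have [measurable]: "Re \<in> borel_measurable borel" "Im \<in> borel_measurable borel"
    by (auto intro!: borel_measurable_continuous_onI continuous_intros)
  note [measurable] = nth
  show ?thesis
    unfolding arg_vec_def by (rule measurable_vec_lambda) measurable
qed

text \<open>The sign of the imaginary part selects the branch of \<open>arccos\<close>. A periodic
  \<open>h\<close> thus equals \<open>h o arg_vec\<close> evaluated at \<open>cis_vec x\<close>, and
  only Borel functions of \<open>cis_vec x\<close> have to be approximated.\<close>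

lemma to_torus_arg_vec_cis_vec: "to_torus (arg_vec (cis_vec x)) = to_torus x"
proof -
  have *: "cis ((if Im z \<ge> 0 then 1 else - 1) * arccos (max (- 1) (min 1 (Re z)))) = z"
    if "norm z = 1" for z
  proof -
    have le: "\<bar>Re z\<bar> \<le> 1" using abs_Re_le_cmod[of z] that by simp
    have "(Re z)\<^sup>2 + (Im z)\<^sup>2 = 1" using that by (simp add: cmod_def)
    then have "sqrt (1 - (Re z)\<^sup>2) = \<bar>Im z\<bar>" 
      by (metis add_diff_cancel_left' real_sqrt_abs)
    with le show ?thesis
      by (auto simp: complex_eq_iff sin_arccos cos_arccos max_def min_def abs_le_iff)
  qed
  have "\<exists>k::int. arg_vec (cis_vec x) $ i - x $ i = 2 * pi * of_int k" for i
  proof -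
    have "cis (arg_vec (cis_vec x) $ i) = cis (x $ i)"
      using *[of "cis (x $ i)"] by (simp add: arg_vec_def cis_vec_def)
    then have "sin (arg_vec (cis_vec x) $ i) = sin (x $ i)" "cos (arg_vec (cis_vec x) $ i) = cos (x $ i)"
      by (auto simp: complex_eq_iff)
    from sin_cos_eq_iff[THEN iffD1, OF conjI[OF this]]
    obtain k :: int where "arg_vec (cis_vec x) $ i = x $ i + 2 * pi * of_int k" by auto
    then show ?thesis by (intro exI[of _ k]) simp
  qed
  then show ?thesis by (simp add: to_torus_eq_iff)
qed

text \<open>The real coordinates of \<open>cis_vec x\<close> are cosines and sines of the
  \<open>x $ i\<close>, hence combinations of the characters of frequency \<open>axis i 1\<close>
  and \<open>axis i (- 1)\<close>; sums and products preserve \<open>trig_poly\<close>.\<close>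

lemma real_polynomial_trig_poly:
  assumes "real_polynomial_function g"
  shows "trig_poly (\<lambda>x. complex_of_real (g (cis_vec x)))"
  using assms
proof (induction rule: real_polynomial_function.induct)
  case (linear g)
  interpret bounded_linear g by fact
  have re: "trig_poly (\<lambda>x. complex_of_real (cos (x $ i)))" and im: "trig_poly (\<lambda>x. complex_of_real (sin (x $ i)))"
    for i :: 'a
  proof -
    have 1: "character (axis i k) x = cis (of_int k * x $ i)" for k x
      by (simp add: character_def axis_def if_distrib[where f="\<lambda>x. of_int x * _"] cong: if_cong)
    have "trig_poly (\<lambda>x. 1/2 * character (axis i 1) x + 1/2 * character (axis i (- 1)) x)"
      by (intro trig_poly.intros)
    also have "(\<lambda>x. 1/2 * character (axis i 1) x + 1/2 * character (axis i (- 1)) x) =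
        (\<lambda>x. complex_of_real (cos (x $ i)))"
      by (simp add: fun_eq_iff 1 complex_eq_iff)
    finally show "trig_poly (\<lambda>x. complex_of_real (cos (x $ i)))" .
    have "trig_poly (\<lambda>x. - (\<i>/2) * character (axis i 1) x + \<i>/2 * character (axis i (- 1)) x)"
      by (intro trig_poly.intros)
    also have "(\<lambda>x. - (\<i>/2) * character (axis i 1) x + \<i>/2 * character (axis i (- 1)) x) =
        (\<lambda>x. complex_of_real (sin (x $ i)))"
      by (simp add: fun_eq_iff 1 complex_eq_iff)
    finally show "trig_poly (\<lambda>x. complex_of_real (sin (x $ i)))" .
  qed
  have "g (cis_vec x) = (\<Sum>i\<in>UNIV. cos (x $ i) * g (axis i 1) + sin (x $ i) * g (axis i \<i>))" for x
  proof -
    have "(\<Sum>i\<in>UNIV. cos (x $ i) *\<^sub>R axis i (1::complex) + sin (x $ i) *\<^sub>R axis i \<i>) $ j = cis_vec x $ j" for j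
    proof -
      have "(\<Sum>i\<in>UNIV. cos (x $ i) *\<^sub>R axis i (1::complex) + sin (x $ i) *\<^sub>R axis i \<i>) $ j =
          (\<Sum>i\<in>UNIV. if i = j then cis (x $ j) else 0)"
        unfolding sum_component
        by (intro sum.cong refl) (simp add: axis_def complex_eq_iff)
      then show ?thesis by (simp add: cis_vec_def)
    qed
    then have "cis_vec x = (\<Sum>i\<in>UNIV. cos (x $ i) *\<^sub>R axis i 1 + sin (x $ i) *\<^sub>R axis i \<i>)"
      unfolding vec_eq_iff by metis
    then show ?thesis by (simp only: sum add scale) (simp only: real_scaleR_def)
  qed
  then have "(\<lambda>x. complex_of_real (g (cis_vec x))) = (\<lambda>x. \<Sum>i\<in>UNIV.
      of_real (g (axis i 1)) * of_real (cos (x $ i)) + of_real (g (axis i \<i>)) * of_real (sin (x $ i)))"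
    by (simp add: fun_eq_iff mult.commute)
  then show ?case
    by (simp only:) (rule trig_poly_sum[OF finite], rule trig_poly.add; rule trig_poly.scale, rule re im)
next
  case (const c)
  show ?case by (rule trig_poly_const)
next
  case (add f g)
  then show ?case by (simp only: of_real_add) (rule trig_poly.add)
next
  case (mult f g)
  then show ?case by (simp only: of_real_mult) (rule trig_poly_mult)
qed

text \<open>The test functions on which both sides agree contain the trigonometric polynomials and are
  closed under bounded pointwise limits, so Stone--Weierstrass and a Dynkin argument yield all
  bounded Borel functions on the torus. Complex weights are allowed, hence uniqueness of measures
  does not apply directly.\<close>

context
  fixes m1 m2 :: "(real ^ 'n::finite) measure" and k1 k2 :: "real ^ 'n \<Rightarrow> complex"
  assumes sets1: "sets m1 = sets borel" and sets2: "sets m2 = sets borel"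
    and int1: "integrable m1 k1" and int2: "integrable m2 k2"
    and eq: "\<And>n. (\<integral>x. character n x * k1 x \<partial>m1) = (\<integral>x. character n x * k2 x \<partial>m2)"
begin

private definition agree :: "(real ^ 'n \<Rightarrow> complex) \<Rightarrow> bool" where
  "agree h \<longleftrightarrow> (\<integral>x. h x * k1 x \<partial>m1) = (\<integral>x. h x * k2 x \<partial>m2)"

private lemma measurable_iff:
  "h \<in> borel_measurable m1 \<longleftrightarrow> h \<in> borel_measurable borel"
  "h \<in> borel_measurable m2 \<longleftrightarrow> h \<in> borel_measurable borel"
  using measurable_cong_sets[OF sets1 refl] measurable_cong_sets[OF sets2 refl] by blast+

private lemma measurable_k: "k1 \<in> borel_measurable borel" "k2 \<in> borel_measurable borel"
  using borel_measurable_integrable[OF int1] borel_measurable_integrable[OF int2]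
  by (simp_all add: measurable_iff)

private lemma integrable_mult:
  fixes h :: "real ^ 'n \<Rightarrow> complex"
  assumes h: "h \<in> borel_measurable borel" and bd: "\<And>x. norm (h x) \<le> B"
  shows "integrable m1 (\<lambda>x. h x * k1 x)" "integrable m2 (\<lambda>x. h x * k2 x)"
proof -
  have B: "0 \<le> B" using bd[of 0] norm_ge_zero order_trans by blast
  have *: "norm (h x * k x) \<le> norm (B *\<^sub>R k x)" for k and x
    using mult_right_mono[OF bd[of x], of "norm (k x)"] B by (simp add: norm_mult)
  show "integrable m1 (\<lambda>x. h x * k1 x)"
  proof (rule Bochner_Integration.integrable_bound[where f="\<lambda>x. B *\<^sub>R k1 x"])
    show "(\<lambda>x. h x * k1 x) \<in> borel_measurable m1"
      unfolding measurable_iff using h measurable_k by (auto intro: borel_measurable_times)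
  qed (use int1 * in auto)
  show "integrable m2 (\<lambda>x. h x * k2 x)"
  proof (rule Bochner_Integration.integrable_bound[where f="\<lambda>x. B *\<^sub>R k2 x"])
    show "(\<lambda>x. h x * k2 x) \<in> borel_measurable m2"
      unfolding measurable_iff using h measurable_k by (auto intro: borel_measurable_times)
  qed (use int2 * in auto)
qed

private lemma agree_limit:
  assumes f: "\<And>j. f j \<in> borel_measurable borel" "\<And>j x. norm (f j x) \<le> B" "\<And>j::nat. agree (f j)"
    and lim: "\<And>x. (\<lambda>j. f j x) \<longlonglongrightarrow> h x"
  shows "agree h"
proof -
  have h: "h \<in> borel_measurable borel"
    by (rule borel_measurable_LIMSEQ_metric[OF f(1) lim])
  have B: "0 \<le> B" using f(2)[of 0 0] norm_ge_zero order_trans by blast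
  have *: "norm (f j x * k x) \<le> norm (B *\<^sub>R k x)" for k x j
    using mult_right_mono[OF f(2)[of j x], of "norm (k x)"] B by (simp add: norm_mult)
  have L1: "(\<lambda>j. \<integral>x. f j x * k1 x \<partial>m1) \<longlonglongrightarrow> (\<integral>x. h x * k1 x \<partial>m1)"
  proof (rule integral_dominated_convergence[where w="\<lambda>x. norm (B *\<^sub>R k1 x)"])
    show "(\<lambda>x. h x * k1 x) \<in> borel_measurable m1" "\<And>j. (\<lambda>x. f j x * k1 x) \<in> borel_measurable m1"
      unfolding measurable_iff using h f(1) measurable_k by (auto intro: borel_measurable_times)
    show "AE x in m1. (\<lambda>j. f j x * k1 x) \<longlonglongrightarrow> h x * k1 x"
      by (intro AE_I2 tendsto_mult_right lim)
    show "AE x in m1. norm (f j x * k1 x) \<le> norm (B *\<^sub>R k1 x)" for j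
      by (intro AE_I2 *)
  qed (use int1 in simp)
  have L2: "(\<lambda>j. \<integral>x. f j x * k2 x \<partial>m2) \<longlonglongrightarrow> (\<integral>x. h x * k2 x \<partial>m2)"
  proof (rule integral_dominated_convergence[where w="\<lambda>x. norm (B *\<^sub>R k2 x)"])
    show "(\<lambda>x. h x * k2 x) \<in> borel_measurable m2" "\<And>j. (\<lambda>x. f j x * k2 x) \<in> borel_measurable m2"
      unfolding measurable_iff using h f(1) measurable_k by (auto intro: borel_measurable_times)
    show "AE x in m2. (\<lambda>j. f j x * k2 x) \<longlonglongrightarrow> h x * k2 x"
      by (intro AE_I2 tendsto_mult_right lim)
    show "AE x in m2. norm (f j x * k2 x) \<le> norm (B *\<^sub>R k2 x)" for j
      by (intro AE_I2 *)
  qed (use int2 in simp)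
  show ?thesis
    using LIMSEQ_unique[OF L1] L2 f(3) unfolding agree_def by simp
qed

private lemma agree_add:
  assumes "g \<in> borel_measurable borel" "\<And>x. norm (g x) \<le> A" "agree g"
    and "h \<in> borel_measurable borel" "\<And>x. norm (h x) \<le> B" "agree h"
  shows "agree (\<lambda>x. g x + h x)"
  using assms integrable_mult[of g A] integrable_mult[of h B]
  by (simp add: agree_def ring_distribs)

private lemma agree_scale: "agree h \<Longrightarrow> agree (\<lambda>x. c * h x)"
  by (simp add: agree_def mult.assoc)

private lemma agree_sum:
  assumes "finite I"
    and "\<And>i. i \<in> I \<Longrightarrow> g i \<in> borel_measurable borel \<and> (\<exists>B. \<forall>x. norm (g i x) \<le> B) \<and> agree (g i)"
  shows "agree (\<lambda>x. \<Sum>i\<in>I. g i x)"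
proof -
  have "integrable m1 (\<lambda>x. g i x * k1 x) \<and> integrable m2 (\<lambda>x. g i x * k2 x)" if "i \<in> I" for i
    using assms(2)[OF that] integrable_mult[of "g i"] by blast
  then show ?thesis
    using assms by (simp add: agree_def sum_distrib_right)
qed

private lemma agree_trig_poly: "trig_poly p \<Longrightarrow> agree p"
proof (induction rule: trig_poly.induct)
  case (character n)
  then show ?case using eq by (simp add: agree_def)
next
  case (add p q)
  from trig_poly_bounded[OF add(1)] obtain A where A: "\<And>x. norm (p x) \<le> A" by blast
  from trig_poly_bounded[OF add(2)] obtain B where B: "\<And>x. norm (q x) \<le> B" by blast
  show ?case
    by (rule agree_add[OF trig_poly_measurable[OF add(1)] A _ trig_poly_measurable[OF add(2)] B]) fact+
qed (rule agree_scale)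

private lemma agree_continuous:
  fixes g :: "complex ^ 'n \<Rightarrow> real"
  assumes g: "continuous_on UNIV g"
  shows "agree (\<lambda>x. complex_of_real (g (cis_vec x)))"
proof -
  have compact: "compact {z :: complex ^ 'n. \<forall>i. norm (z $ i) = 1}" (is "compact ?T")
  proof (rule compact_eq_bounded_closed[THEN iffD2, OF conjI])
    have "norm z \<le> real CARD('n)" if "z \<in> ?T" for z
      using norm_le_l1_cart[of "\<chi> i. norm (z $ i)"] that
      by (simp add: norm_vec_def)
    then show "bounded ?T" by (rule boundedI)
    have "?T = (\<Inter>i. {z. norm (z $ i) = 1})" by auto
    also have "closed \<dots>"
      by (intro closed_INT ballI closed_Collect_eq continuous_intros)
    finally show "closed ?T" .
  qed
  have in_T: "cis_vec x \<in> ?T" for x by (simp add: cis_vec_def)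
  have "\<exists>q. real_polynomial_function q \<and> (\<forall>z\<in>?T. \<bar>g z - q z\<bar> < inverse (real (Suc j)))" for j
    by (rule Stone_Weierstrass_real_polynomial_function[OF compact, of g "inverse (real (Suc j))"])
       (use g in \<open>auto intro: continuous_on_subset\<close>)
  then obtain q where q: "\<And>j. real_polynomial_function (q j)"
      "\<And>j z. z \<in> ?T \<Longrightarrow> \<bar>g z - q j z\<bar> < inverse (real (Suc j))"
    by metis
  from compact_continuous_image[OF continuous_on_subset[OF g subset_UNIV] compact]
  obtain B where B: "\<And>z. z \<in> ?T \<Longrightarrow> \<bar>g z\<bar> \<le> B"
    by (force dest!: compact_imp_bounded simp: bounded_iff)
  show ?thesis
  proof (rule agree_limit)
    show "(\<lambda>x. complex_of_real (q j (cis_vec x))) \<in> borel_measurable borel" for j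
      by (intro trig_poly_measurable real_polynomial_trig_poly q)
    show "agree (\<lambda>x. complex_of_real (q j (cis_vec x)))" for j
      by (intro agree_trig_poly real_polynomial_trig_poly q)
    show "norm (complex_of_real (q j (cis_vec x))) \<le> B + 1" for j x
    proof -
      have "inverse (real (Suc j)) \<le> 1" by (simp add: field_simps)
      then show ?thesis
        using q(2)[OF in_T, of x j] B[OF in_T, of x] by simp
    qed
    show "(\<lambda>j. complex_of_real (q j (cis_vec x))) \<longlonglongrightarrow> complex_of_real (g (cis_vec x))" for x
    proof (rule tendsto_of_real, rule LIMSEQ_I)
      fix r :: real assume "0 < r"
      then obtain N where N: "inverse (real (Suc N)) < r" using reals_Archimedean by blast
      have "norm (q j (cis_vec x) - g (cis_vec x)) < r" if "j \<ge> N" for j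
      proof -
        have "inverse (real (Suc j)) \<le> inverse (real (Suc N))" using that by (simp add: field_simps)
        then show ?thesis using q(2)[OF in_T, of x j] N unfolding real_norm_def by linarith
      qed
      then show "\<exists>N. \<forall>j\<ge>N. norm (q j (cis_vec x) - g (cis_vec x)) < r" by blast
    qed
  qed
qed

text \<open>The truncated distance functions \<open>g j\<close> are continuous and decrease to the
  indicator of \<open>C\<close>, since the distance to a closed set is positive off the set.\<close>

private lemma agree_closed:
  assumes "closed C"
  shows "agree (\<lambda>x. indicator C (cis_vec x))"
proof (cases "C = {}")
  case True
  then show ?thesis by (simp add: agree_def)
next
  case False
  define g where "g j z = max 0 (1 - real j * infdist z C)" for j z
  have cont: "continuous_on UNIV (g j)" for j
    unfolding g_def by (intro continuous_intros)
  show ?thesis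
  proof (rule agree_limit)
    show "agree (\<lambda>x. complex_of_real (g j (cis_vec x)))" for j
      by (rule agree_continuous[OF cont])
    have [measurable]: "g j \<in> borel_measurable borel" for j
      by (rule borel_measurable_continuous_onI[OF cont])
    show "(\<lambda>x. complex_of_real (g j (cis_vec x))) \<in> borel_measurable borel" for j
      by measurable
    show "norm (complex_of_real (g j (cis_vec x))) \<le> 1" for j x
      by (simp add: g_def infdist_nonneg)
    show "(\<lambda>j. complex_of_real (g j (cis_vec x))) \<longlonglongrightarrow> indicator C (cis_vec x)" for x
    proof (cases "cis_vec x \<in> C")
      case True
      then show ?thesis by (simp add: g_def)
    next
      case notin: False
      then have pos: "0 < infdist (cis_vec x) C"
        using in_closed_iff_infdist_zero[OF assms False] infdist_nonneg[of "cis_vec x" C] by (metis less_eq_real_def)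
      then obtain N where "1 < real N * infdist (cis_vec x) C"
        using reals_Archimedean3 by blast
      then have "g j (cis_vec x) = 0" if "j \<ge> N" for j
      proof -
        have "real N * infdist (cis_vec x) C \<le> real j * infdist (cis_vec x) C"
          using that pos by (intro mult_right_mono) auto
        then show ?thesis using \<open>1 < _\<close> unfolding g_def by simp
      qed
      then have "\<forall>\<^sub>F j in sequentially. complex_of_real (g j (cis_vec x)) = indicator C (cis_vec x)"
        using notin by (auto simp: eventually_sequentially)
      then show ?thesis by (rule tendsto_eventually)
    qed
  qed
qed

private lemma agree_borel:
  fixes A :: "(complex ^ 'n) set"
  assumes "A \<in> sets borel"
  shows "agree (\<lambda>x. indicator A (cis_vec x))"
proof -
  have sets_borel_closed: "sets (borel :: (complex ^ 'n) measure) = sigma_sets UNIV (Collect closed)"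
    by (simp add: borel_eq_closed)
  have bd: "norm (indicator A y :: complex) \<le> 1" for A and y :: "complex ^ 'n"
    by (simp add: indicator_def)
  have meas: "(\<lambda>x. indicator A (cis_vec x) :: complex) \<in> borel_measurable borel"
    if "A \<in> sets borel" for A using that by measurable
  have "Int_stable (Collect closed :: (complex ^ 'n) set set)"
    by (auto simp: Int_stable_def)
  moreover have "Collect closed \<subseteq> Pow (UNIV :: (complex ^ 'n) set)" by simp
  moreover have "A \<in> sigma_sets UNIV (Collect closed)" using assms sets_borel_closed by simp
  ultimately show ?thesis
  proof (induction rule: sigma_sets_induct_disjoint)
    case (basic A)
    then show ?case by (simp add: agree_closed)
  next
    case empty
    then show ?case by (simp add: agree_def)
  next
    case (compl A)
    then have A: "A \<in> sets borel" using sets_borel_closed by blast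
    have "agree (\<lambda>x. 1 + - 1 * indicator A (cis_vec x))"
    proof (rule agree_add)
      \<comment> \<open>The constant 1 is the character of frequency 0; this makes the class closed
        under complements.\<close>
      show "agree (\<lambda>x. 1)" using eq[of 0] by (simp add: agree_def)
      show "agree (\<lambda>x. - 1 * indicator A (cis_vec x))" by (intro agree_scale compl)
    qed (use meas[OF A] bd in auto)
    also have "(\<lambda>x. 1 + - 1 * indicator A (cis_vec x)) = (\<lambda>x. indicator (UNIV - A) (cis_vec x) :: complex)"
      by (auto simp: indicator_def)
    finally show ?case .
  next
    case (union A)
    then have A: "A j \<in> sets borel" for j using sets_borel_closed by blast
    show ?case
    proof (rule agree_limit[where f="\<lambda>j x. indicator (\<Union>i<j. A i) (cis_vec x)"])
      show "agree (\<lambda>x. indicator (\<Union>i<j. A i) (cis_vec x))" for j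
      proof -
        have "agree (\<lambda>x. \<Sum>i<j. indicator (A i) (cis_vec x))"
          by (rule agree_sum) (use union(3) meas[OF A] bd in \<open>blast+\<close>)
        moreover have "(\<lambda>x. \<Sum>i<j. indicator (A i) (cis_vec x)) =
            (\<lambda>x. indicator (\<Union>i<j. A i) (cis_vec x) :: complex)"
          using union(1) by (intro ext indicator_UN_disjoint[symmetric])
            (auto simp: disjoint_family_on_def)
        ultimately show ?thesis by simp
      qed
      show "(\<lambda>x. indicator (\<Union>i<j. A i) (cis_vec x) :: complex) \<in> borel_measurable borel" for j
        by (rule meas) (use A in auto)
      show "(\<lambda>j. indicator (\<Union>i<j. A i) (cis_vec x) :: complex) \<longlonglongrightarrow> indicator (\<Union>(range A)) (cis_vec x)" for x
        by (rule LIMSEQ_indicator_UN)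
    qed (rule bd)
  qed
qed

text \<open>Serves three purposes: identifying the law of the process at a fixed time with a density
  against \<open>haar\<close>, translation invariance of \<open>haar\<close>, and uniqueness of
  Fourier coefficients. Two measures and two weights are needed to cover all of them.\<close>

lemma character_integrals_determine:
  assumes h: "h \<in> borel_measurable borel" "periodic h" "\<And>x. norm (h x) \<le> B"
  shows "(\<integral>x. h x * k1 x \<partial>m1) = (\<integral>x. h x * k2 x \<partial>m2)"
proof -
  define g where "g = h \<circ> arg_vec"
  have g: "g \<in> borel_measurable borel" using h(1) by (simp add: g_def)
  from borel_measurable_implies_sequence_metric[OF this, of 0]
  obtain s where s: "\<And>i. simple_function borel (s i)" "\<And>z. (\<lambda>i. s i z) \<longlonglongrightarrow> g z"
      "\<And>i z. norm (s i z) \<le> 2 * norm (g z)"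
    by auto
  have s_meas [measurable]: "s i \<in> borel_measurable borel" for i
    by (rule borel_measurable_simple_function[OF s(1)])
  have "agree (\<lambda>x. g (cis_vec x))"
  proof (rule agree_limit)
    show "(\<lambda>i. s i (cis_vec x)) \<longlonglongrightarrow> g (cis_vec x)" for x by (rule s(2))
    show "(\<lambda>x. s i (cis_vec x)) \<in> borel_measurable borel" for i by measurable
    show "norm (s i (cis_vec x)) \<le> 2 * B" for i x
      using s(3)[of i "cis_vec x"] h(3)[of "arg_vec (cis_vec x)"] by (simp add: g_def)
    show "agree (\<lambda>x. s i (cis_vec x))" for i
    proof -
      have "agree (\<lambda>x. \<Sum>y\<in>range (s i). y * indicator (s i -` {y}) (cis_vec x))"
      proof (rule agree_sum)
        show "finite (range (s i))" using simple_functionD(1)[OF s(1)] by simp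
        fix y
        have A: "s i -` {y} \<in> sets borel" using measurable_sets[OF s_meas[of i], of "{y}"] by simp
        show "(\<lambda>x. y * indicator (s i -` {y}) (cis_vec x)) \<in> borel_measurable borel \<and>
          (\<exists>B. \<forall>x. norm (y * indicator (s i -` {y}) (cis_vec x) :: complex) \<le> B) \<and>
          agree (\<lambda>x. y * indicator (s i -` {y}) (cis_vec x))"
        proof (intro conjI)
          show "(\<lambda>x. y * indicator (s i -` {y}) (cis_vec x)) \<in> borel_measurable borel"
            using A by measurable
          show "\<exists>B. \<forall>x. norm (y * indicator (s i -` {y}) (cis_vec x) :: complex) \<le> B"
            by (intro exI[of _ "norm y"]) (simp add: indicator_def)
        qed (intro agree_scale agree_borel A)
      qed
      moreover have "(\<Sum>y\<in>range (s i). y * indicator (s i -` {y}) z) = s i z" for z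
        using simple_functionD(1)[OF s(1)[of i]] by (simp add: indicator_def of_bool_def sum.delta if_distrib cong: if_cong)
      ultimately show ?thesis by simp
    qed
  qed
  moreover have "g (cis_vec x) = h x" for x
    using periodicD[OF h(2) to_torus_arg_vec_cis_vec] by (simp add: g_def)
  ultimately show ?thesis by (simp add: agree_def)
qed

end

section \<open>Product densities\<close>

text \<open>\<open>lborel\<close> on \<open>real ^ 'n\<close> is the image of a product of
  one-dimensional Lebesgue measures indexed by \<open>Basis\<close>; reindexing \<open>Basis\<close>
  by the coordinates through \<open>axis i 1\<close> makes the integral factor.\<close>

lemma integral_lborel_vec_prod:
  fixes g :: "'n::finite \<Rightarrow> real \<Rightarrow> complex"
  assumes g: "\<And>i. integrable lborel (g i)"
  shows "integrable (lborel :: (real ^ 'n) measure) (\<lambda>x. \<Prod>i\<in>UNIV. g i (x $ i))"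
    and "(\<integral>x. (\<Prod>i\<in>UNIV. g i (x $ i)) \<partial>(lborel :: (real ^ 'n) measure)) = (\<Prod>i\<in>UNIV. \<integral>t. g i t \<partial>lborel)"
proof -
  let ?e = "\<lambda>i. axis i 1 :: real ^ 'n"
  let ?S = "\<lambda>f. \<Sum>b\<in>(Basis :: (real ^ 'n) set). f b *\<^sub>R b"
  let ?P = "\<Pi>\<^sub>M b\<in>(Basis :: (real ^ 'n) set). (lborel :: real measure)"
  have inj: "inj ?e" by (auto simp: inj_on_def axis_eq_axis)
  have B: "(Basis :: (real ^ 'n) set) = range ?e" by (auto simp: Basis_vec_def)
  have nth: "?S f $ i = f (?e i)" for f i
  proof -
    have "?S f $ i = ?S f \<bullet> ?e i" by (simp add: inner_axis)
    also have "\<dots> = f (?e i)" by (rule inner_sum_left_Basis) (simp add: B)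
    finally show ?thesis .
  qed
  have pr: "(\<Prod>i\<in>UNIV. g i (?S f $ i)) = (\<Prod>b\<in>Basis. g (inv ?e b) (f b))" for f
  proof -
    have "(\<Prod>i\<in>UNIV. g i (?S f $ i)) = (\<Prod>i\<in>UNIV. g i (f (?e i)))" by (simp only: nth)
    also have "\<dots> = (\<Prod>b\<in>Basis. g (inv ?e b) (f b))"
      unfolding B by (subst prod.reindex[OF inj]) (simp add: inv_f_f[OF inj])
    finally show ?thesis .
  qed
  have S[measurable]: "?S \<in> measurable ?P borel" by measurable
  have [measurable]: "g i \<in> borel_measurable borel" for i
    using borel_measurable_integrable[OF g[of i]] by simp
  have [measurable]: "(\<lambda>x::real^'n. x $ i) \<in> borel_measurable borel" for i
    by (intro borel_measurable_continuous_onI continuous_intros)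
  have meas: "(\<lambda>x::real^'n. \<Prod>i\<in>UNIV. g i (x $ i)) \<in> borel_measurable borel" by measurable
  interpret product_sigma_finite "\<lambda>_::real^'n. lborel :: real measure" ..
  have "integrable ?P (\<lambda>f. \<Prod>b\<in>Basis. g (inv ?e b) (f b))"
    by (rule product_integrable_prod) (use g in auto)
  then have "integrable (distr ?P borel ?S) (\<lambda>x. \<Prod>i\<in>UNIV. g i (x $ i))"
    by (subst integrable_distr_eq[OF S meas]) (simp only: pr)
  then show "integrable (lborel :: (real ^ 'n) measure) (\<lambda>x. \<Prod>i\<in>UNIV. g i (x $ i))"
    by (simp only: lborel_eq[symmetric])
  have "(\<integral>x. (\<Prod>i\<in>UNIV. g i (x $ i)) \<partial>distr ?P borel ?S) = (\<integral>f. (\<Prod>b\<in>Basis. g (inv ?e b) (f b)) \<partial>?P)"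
    by (subst integral_distr[OF S meas]) (simp only: pr)
  also have "\<dots> = (\<Prod>b\<in>Basis. \<integral>t. g (inv ?e b) t \<partial>lborel)"
    by (rule product_integral_prod) (use g in auto)
  also have "\<dots> = (\<Prod>i\<in>UNIV. \<integral>t. g i t \<partial>lborel)"
    unfolding B by (subst prod.reindex[OF inj]) (simp add: inv_f_f[OF inj])
  finally show "(\<integral>x. (\<Prod>i\<in>UNIV. g i (x $ i)) \<partial>(lborel :: (real ^ 'n) measure)) = (\<Prod>i\<in>UNIV. \<integral>t. g i t \<partial>lborel)"
    by (simp only: lborel_eq[symmetric])
qed

text \<open>The Gaussian law and the uniform law on a period cube both have this form, so their
  Fourier coefficients reduce to one-dimensional integrals.\<close>

definition prod_density :: "(real \<Rightarrow> real) \<Rightarrow> (real ^ 'n::finite) measure" where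
  "prod_density f = density lborel (\<lambda>x. ennreal (\<Prod>i\<in>UNIV. f (x $ i)))"

lemma sets_prod_density [simp, measurable_cong]: "sets (prod_density f) = sets borel"
  by (simp add: prod_density_def)

lemma space_prod_density [simp]: "space (prod_density f) = UNIV"
  by (simp add: prod_density_def)

lemma measurable_vec_nth [measurable]: "(\<lambda>x::real^'n::finite. x $ i) \<in> borel_measurable borel"
  by (intro borel_measurable_continuous_onI continuous_intros)

lemma prod_density:
  fixes f :: "real \<Rightarrow> real"
  assumes f: "integrable lborel f" "\<And>t. 0 \<le> f t" "(\<integral>t. f t \<partial>lborel) = 1"
  shows prob_space_prod_density: "prob_space (prod_density f :: (real ^ 'n::finite) measure)"
    and integral_character_prod_density:
      "(\<integral>x. character n x \<partial>(prod_density f :: (real ^ 'n) measure)) =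
        (\<Prod>i\<in>UNIV. \<integral>t. of_real (f t) * cis (of_int (n $ i) * t) \<partial>lborel)"
proof -
  let ?F = "\<lambda>x::real^'n. \<Prod>i\<in>UNIV. f (x $ i)"
  have [measurable]: "f \<in> borel_measurable borel"
    using borel_measurable_integrable[OF f(1)] by simp
  have pos: "0 \<le> ?F x" for x by (intro prod_nonneg) (use f in auto)
  have "integrable lborel (\<lambda>t. complex_of_real (f t))" using f by simp
  note * = integral_lborel_vec_prod[of "\<lambda>_::'n. \<lambda>t. complex_of_real (f t)", OF this]
  have int: "integrable lborel ?F" "(\<integral>x. ?F x \<partial>lborel) = 1"
  proof -
    have "integrable lborel (\<lambda>x. complex_of_real (?F x))" using *(1) by (simp only: of_real_prod)
    then show "integrable lborel ?F" unfolding complex_of_real_integrable_eq .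
    have "complex_of_real (\<integral>x. ?F x \<partial>lborel) = 1"
      using *(2) f(3) by (simp flip: of_real_prod)
    then show "(\<integral>x. ?F x \<partial>lborel) = 1" by simp
  qed
  show "prob_space (prod_density f :: (real ^ 'n::finite) measure)"
  proof
    have "emeasure (prod_density f :: (real ^ 'n) measure) (space (prod_density f)) = (\<integral>\<^sup>+x. ennreal (?F x) \<partial>lborel)"
      by (simp add: prod_density_def emeasure_density)
    also have "\<dots> = ennreal (\<integral>x. ?F x \<partial>lborel)" by (rule nn_integral_eq_integral[OF int(1)]) (use pos in simp)
    also have "\<dots> = 1" by (simp only: int(2) ennreal_1)
    finally show "emeasure (prod_density f :: (real ^ 'n::finite) measure) (space (prod_density f)) = 1" .
  qed
  have "(\<integral>x. character n x \<partial>(prod_density f :: (real ^ 'n) measure)) = (\<integral>x. ?F x *\<^sub>R character n x \<partial>lborel)"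
    unfolding prod_density_def by (rule integral_density) (use pos in auto)
  also have "\<dots> = (\<integral>x. (\<Prod>i\<in>UNIV. of_real (f (x $ i)) * cis (of_int (n $ i) * x $ i)) \<partial>lborel)"
    by (simp add: character_prod scaleR_conv_of_real prod.distrib)
  also have "\<dots> = (\<Prod>i\<in>UNIV. \<integral>t. of_real (f t) * cis (of_int (n $ i) * t) \<partial>lborel)"
  proof (rule integral_lborel_vec_prod(2))
    fix i
    have cis: "(\<lambda>t. cis (of_int (n $ i) * t)) \<in> borel_measurable borel"
      unfolding cis_conv_exp by measurable
    show "integrable lborel (\<lambda>t. complex_of_real (f t) * cis (of_int (n $ i) * t))"
      by (rule Bochner_Integration.integrable_bound[OF f(1)])
         (use cis f(2) in \<open>auto simp: norm_mult\<close>)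
  qed
  finally show "(\<integral>x. character n x \<partial>(prod_density f :: (real ^ 'n) measure)) =
        (\<Prod>i\<in>UNIV. \<integral>t. of_real (f t) * cis (of_int (n $ i) * t) \<partial>lborel)" .
qed

section \<open>Gaussian and uniform laws and their Fourier coefficients\<close>

definition gauss :: "real \<Rightarrow> (real ^ 'n::finite) measure" where
  "gauss t = prod_density (normal_density 0 (sqrt t))"

text \<open>Represents the normalized Haar measure of the torus as a probability measure on
  Euclidean space, to be applied to periodic integrands. Opposite faces of the closed cube are
  identified, but they are null sets.\<close>

definition haar :: "(real ^ 'n::finite) measure" where
  "haar = prod_density (\<lambda>x. indicator {0..2 * pi} x / (2 * pi))"

lemma sets_gauss [simp, measurable_cong]: "sets (gauss t) = sets borel"
  and space_gauss [simp]: "space (gauss t) = UNIV"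
  by (simp_all add: gauss_def)

lemma sets_haar [simp, measurable_cong]: "sets haar = sets borel"
  and space_haar [simp]: "space haar = UNIV"
  by (simp_all add: haar_def)

lemma prob_space_gauss: "0 < t \<Longrightarrow> prob_space (gauss t)"
  unfolding gauss_def by (intro prob_space_prod_density integrable_normal_density) auto

text \<open>Substituting \<open>sqrt t * x\<close> reduces the integral to the characteristic
  function of the standard normal law at \<open>k * sqrt t\<close>.\<close>

lemma integral_normal_density_cis:
  assumes "0 < t"
  shows "(\<integral>x. of_real (normal_density 0 (sqrt t) x) * cis (k * x) \<partial>lborel) = of_real (exp (- t * k\<^sup>2 / 2))"
proof -
  have s: "sqrt t > 0" "sqrt t * sqrt t = t" using assms by auto
  have "(\<integral>x. of_real (normal_density 0 (sqrt t) x) * cis (k * x) \<partial>lborel) =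
      \<bar>sqrt t\<bar> *\<^sub>R (\<integral>x. of_real (normal_density 0 (sqrt t) (0 + sqrt t * x)) * cis (k * (0 + sqrt t * x)) \<partial>lborel)"
    by (rule lborel_integral_real_affine) (use s in simp)
  also have "\<dots> = (\<integral>x. std_normal_density x *\<^sub>R cis (k * sqrt t * x) \<partial>lborel)"
  proof -
    have "complex_of_real (sqrt t) * (of_real (normal_density 0 (sqrt t) (sqrt t * x)) * cis (k * (sqrt t * x))) =
        std_normal_density x *\<^sub>R cis (k * sqrt t * x)" for x
    proof -
      have "sqrt t * normal_density 0 (sqrt t) (sqrt t * x) = std_normal_density x"
        using assms by (simp add: normal_density_def power_mult_distrib real_sqrt_mult field_simps)
      then show ?thesis
        by (simp add: scaleR_conv_of_real mult.assoc[symmetric] flip: of_real_mult)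
    qed
    then show ?thesis
      using s by (simp add: scaleR_conv_of_real flip: integral_mult_right_zero)
  qed
  also have "\<dots> = char std_normal_distribution (k * sqrt t)"
    unfolding char_def cis_conv_exp by (subst integral_density) (auto simp: algebra_simps)
  also have "\<dots> = of_real (exp (- t * k\<^sup>2 / 2))"
    using assms by (simp add: char_std_normal_distribution power_mult_distrib mult.commute)
  finally show ?thesis .
qed

text \<open>The squared Euclidean length, taken in \<open>nat\<close> so that a least level exists
  in \<open>eigen_sum_unique\<close>.\<close>

definition sq :: "int ^ 'n::finite \<Rightarrow> nat" where
  "sq n = (\<Sum>i\<in>UNIV. nat ((n $ i)\<^sup>2))"

lemma real_sq: "real (sq n) = (\<Sum>i\<in>UNIV. (of_int (n $ i))\<^sup>2)"
  by (simp add: sq_def)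

lemma sq_eq_0_iff [simp]: "sq n = 0 \<longleftrightarrow> n = 0"
  by (auto simp: sq_def vec_eq_iff)

lemma integral_character_gauss:
  assumes "0 < t"
  shows "(\<integral>x. character n x \<partial>gauss t) = of_real (exp (- t * real (sq n) / 2))"
proof -
  have "(\<integral>x. character n x \<partial>gauss t) = (\<Prod>i\<in>UNIV. of_real (exp (- t * (of_int (n $ i))\<^sup>2 / 2)))"
    unfolding gauss_def integral_normal_density_cis[OF assms, symmetric]
    by (rule integral_character_prod_density) (use assms in auto)
  also have "\<dots> = of_real (exp (\<Sum>i\<in>UNIV. - t * (of_int (n $ i))\<^sup>2 / 2))"
    by (simp only: exp_sum[OF finite] of_real_prod)
  also have "(\<Sum>i\<in>UNIV. - t * (of_int (n $ i))\<^sup>2 / 2) = - t * real (sq n) / 2"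
    unfolding real_sq by (simp add: sum_distrib_left sum_divide_distrib sum_negf)
  finally show ?thesis .
qed

lemma integrable_uniform_density: "integrable lborel (\<lambda>x::real. indicator {0..2 * pi} x / (2 * pi) :: real)"
  by (intro integrable_divide) (simp add: integrable_real_indicator)

lemma integral_uniform_density: "(\<integral>x. indicator {0..2 * pi} x / (2 * pi) \<partial>lborel) = (1::real)"
  by simp

lemma prob_space_haar: "prob_space (haar :: (real ^ 'n::finite) measure)"
  unfolding haar_def
  by (intro prob_space_prod_density integrable_uniform_density integral_uniform_density) auto

text \<open>A single nonzero coordinate of \<open>n\<close> suffices: its one-dimensional integral
  over a full period vanishes and annihilates the product.\<close>

lemma integral_character_haar:
  "(\<integral>x. character n x \<partial>haar) = (if n = 0 then 1 else 0)"
proof (cases "n = 0")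
  case True
  interpret prob_space "haar :: (real ^ 'a) measure" by (rule prob_space_haar)
  show ?thesis using True prob_space by simp
next
  case False
  then obtain j where j: "n $ j \<noteq> 0" by (auto simp: vec_eq_iff)
  have "(\<integral>t. of_real (indicator {0..2 * pi} t / (2 * pi)) * cis (of_int (n $ j) * t) \<partial>lborel) =
      (\<integral>t. (1 / (2 * pi)) *\<^sub>R (indicator {0..2 * pi} t *\<^sub>R cis (of_int (n $ j) * t)) \<partial>lborel)"
    by (intro Bochner_Integration.integral_cong) (auto simp: indicator_def scaleR_conv_of_real)
  also have "\<dots> = (1 / (2 * pi)) *\<^sub>R (\<integral>t. indicator {0..2 * pi} t *\<^sub>R cis (of_int (n $ j) * t) \<partial>lborel)"
    by (rule integral_scaleR_right)
  also have "(\<integral>t. indicator {0..2 * pi} t *\<^sub>R cis (of_int (n $ j) * t) \<partial>lborel) =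
      cis (of_int (n $ j) * (2 * pi)) / (\<i> * of_int (n $ j)) - cis (of_int (n $ j) * 0) / (\<i> * of_int (n $ j))"
  proof (rule integral_FTC_Icc)
    fix t :: real
    have "((\<lambda>t. exp (\<i> * (of_int (n $ j) * of_real t)) / (\<i> * of_int (n $ j))) has_vector_derivative
        exp (\<i> * (of_int (n $ j) * of_real t))) (at t within {0..2 * pi})"
      using j by (auto intro!: derivative_eq_intros has_vector_derivative_real_field simp: field_simps)
    then show "((\<lambda>t. cis (of_int (n $ j) * t) / (\<i> * of_int (n $ j))) has_vector_derivative
        cis (of_int (n $ j) * t)) (at t within {0..2 * pi})"
      by (simp add: cis_conv_exp)
  next
    show "continuous_on {0..2 * pi} (\<lambda>t. cis (of_int (n $ j) * t))"
      unfolding cis_conv_exp by (intro continuous_intros)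
  qed simp
  also have "\<dots> = 0"
    using cis_multiple_2pi[of "of_int (n $ j)"] by (simp add: mult.commute)
  finally have "(\<Prod>i\<in>UNIV. \<integral>t. of_real (indicator {0..2 * pi} t / (2 * pi)) * cis (of_int (n $ i) * t) \<partial>lborel) = (0::complex)"
    by (auto intro!: prod_zero)
  then show ?thesis
    unfolding haar_def using False
    by (subst integral_character_prod_density[OF integrable_uniform_density]) auto
qed

section \<open>Sums over the dual lattice\<close>

text \<open>Sums over \<open>\<int>\<^sup>d\<close> are integrals with respect to the counting measure, so that exchanging them
  with integrals is Fubini's theorem.\<close>

abbreviation lattice :: "(int ^ 'n::finite) measure" where
  "lattice \<equiv> count_space UNIV"

definition eigen :: "real ^ 'n::finite \<Rightarrow> real \<Rightarrow> int ^ 'n \<Rightarrow> complex" where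
  "eigen v t n = of_real (exp (- t * real (sq n) / 2)) * character n (t *\<^sub>R v)"

lemma norm_eigen: "norm (eigen v t n) = exp (- t * real (sq n) / 2)"
  by (simp add: eigen_def norm_mult)

lemma eigen_0 [simp]: "eigen v t 0 = 1"
  by (simp add: eigen_def sq_def)

lemma abs_summable_exp_square_int:
  fixes c :: real
  assumes "0 < c"
  shows "Infinite_Set_Sum.abs_summable_on (\<lambda>k::int. exp (- c * (of_int k)\<^sup>2)) UNIV"
proof -
  have nat: "Infinite_Set_Sum.abs_summable_on (\<lambda>k::nat. exp (- c * (real k)\<^sup>2)) UNIV"
    unfolding Infinite_Set_Sum.abs_summable_on_nat_iff'
  proof (rule summable_comparison_test[OF _ summable_geometric[of "exp (- c)"]])
    show "\<exists>N. \<forall>n\<ge>N. norm (norm (exp (- c * (real n)\<^sup>2))) \<le> exp (- c) ^ n"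
    proof (intro exI[of _ 0] allI impI)
      fix n :: nat
      have "real n \<le> (real n)\<^sup>2"
        unfolding power2_eq_square by (cases n) auto
      then show "norm (norm (exp (- c * (real n)\<^sup>2))) \<le> exp (- c) ^ n"
        using assms by (simp add: exp_of_nat_mult[symmetric])
    qed
  qed (use assms in simp)
  have "Infinite_Set_Sum.abs_summable_on (\<lambda>k::int. exp (- c * (of_int k)\<^sup>2)) (range int)"
    by (rule Infinite_Set_Sum.abs_summable_on_reindex) (use nat in simp)
  moreover have "Infinite_Set_Sum.abs_summable_on (\<lambda>k::int. exp (- c * (of_int k)\<^sup>2)) (range (\<lambda>k. - int k))"
    by (rule Infinite_Set_Sum.abs_summable_on_reindex) (use nat in simp)
  ultimately have "Infinite_Set_Sum.abs_summable_on (\<lambda>k::int. exp (- c * (of_int k)\<^sup>2)) (range int \<union> range (\<lambda>k. - int k))"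
    by (rule Infinite_Set_Sum.abs_summable_on_union)
  also have "range int \<union> range (\<lambda>k. - int k) = UNIV"
    by (auto simp: image_iff) (metis int_cases2)
  finally show ?thesis .
qed

text \<open>The summand factors over the coordinates, so the one-dimensional bound gives summability
  over all families of integers.\<close>

lemma integrable_exp_sq:
  assumes "0 < t"
  shows "integrable lattice (\<lambda>n. exp (- t * real (sq n) / 2))"
proof -
  have "Infinite_Set_Sum.abs_summable_on (\<lambda>g::'a \<Rightarrow> int. \<Prod>i\<in>UNIV. exp (- (t / 2) * (of_int (g i))\<^sup>2)) (PiE UNIV (\<lambda>_. UNIV))"
    by (rule Infinite_Set_Sum.abs_summable_on_prod_PiE) (use assms in \<open>auto intro!: abs_summable_exp_square_int[of "t / 2", simplified]\<close>)
  then have "Infinite_Set_Sum.abs_summable_on (\<lambda>g::'a \<Rightarrow> int. exp (- t * real (sq (vec_lambda g)) / 2)) UNIV"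
    by (simp add: real_sq exp_sum[symmetric] sum_negf sum_distrib_left sum_divide_distrib PiE_UNIV_domain)
  moreover have "bij_betw (vec_lambda :: ('a \<Rightarrow> int) \<Rightarrow> int ^ 'a) UNIV UNIV"
    by (rule bij_betwI[of _ _ _ vec_nth]) auto
  ultimately have "Infinite_Set_Sum.abs_summable_on (\<lambda>n::int ^ 'a. exp (- t * real (sq n) / 2)) UNIV"
    using Infinite_Set_Sum.abs_summable_on_reindex_bij_betw[of vec_lambda UNIV UNIV "\<lambda>n::int ^ 'a. exp (- t * real (sq n) / 2)"]
    by blast
  then show ?thesis by (simp add: Infinite_Set_Sum.abs_summable_on_def)
qed

lemma integrable_eigen: "0 < t \<Longrightarrow> integrable lattice (eigen v t)"
  by (rule Bochner_Integration.integrable_bound[OF integrable_exp_sq[of t]]) (auto simp: norm_eigen)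

lemma integrable_lattice_mult:
  fixes a b :: "int ^ 'n::finite \<Rightarrow> complex"
  assumes "integrable lattice a" "\<And>n. norm (b n) \<le> B"
  shows "integrable lattice (\<lambda>n. a n * b n)" "integrable lattice (\<lambda>n. b n * a n)"
proof -
  have B: "0 \<le> B" using assms(2)[of 0] norm_ge_zero order_trans by blast
  have *: "norm (a n * b n) \<le> norm (B *\<^sub>R a n)" for n
  proof -
    have "norm (b n) * norm (a n) \<le> B * norm (a n)"
      by (intro mult_right_mono assms) simp
    then show ?thesis using B unfolding norm_mult norm_scaleR by (simp only: mult.commute abs_of_nonneg)
  qed
  show "integrable lattice (\<lambda>n. a n * b n)"
    by (rule Bochner_Integration.integrable_bound[where f="\<lambda>n. B *\<^sub>R a n"])
       (use assms(1) * in \<open>auto simp del: norm_scaleR\<close>)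
  then show "integrable lattice (\<lambda>n. b n * a n)" by (simp add: mult.commute)
qed

lemma lattice_sum_swap:
  fixes a :: "int ^ 'n::finite \<Rightarrow> complex"
  assumes a: "integrable lattice a" and m: "prob_space m"
    and g: "\<And>n. g n \<in> borel_measurable m" and bd: "\<And>n z. norm (g n z) \<le> B"
  shows "integrable m (\<lambda>z. \<integral>n. a n * g n z \<partial>lattice)"
    and "(\<integral>z. (\<integral>n. a n * g n z \<partial>lattice) \<partial>m) = (\<integral>n. a n * (\<integral>z. g n z \<partial>m) \<partial>lattice)"
proof -
  interpret m: prob_space m by fact
  interpret pair_sigma_finite "lattice :: (int ^ 'n) measure" m
    by (intro pair_sigma_finite.intro sigma_finite_measure_count_space) unfold_locales
  have B: "0 \<le> B" using bd[of 0 undefined] norm_ge_zero order_trans by blast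
  have int: "integrable m (\<lambda>z. a n * g n z)" for n
    by (intro integrable_mult_right m.integrable_const_bound[of _ B] g) (use bd in auto)
  have "integrable (lattice \<Otimes>\<^sub>M m) (\<lambda>(n, z). a n * g n z)"
  proof (rule Fubini_integrable)
    show "(\<lambda>(n, z). a n * g n z) \<in> borel_measurable (lattice \<Otimes>\<^sub>M m)"
      by (rule measurable_pair_measure_countable1) (use g in \<open>auto intro!: borel_measurable_times\<close>)
    show "integrable lattice (\<lambda>n. \<integral>z. norm (case (n, z) of (n, z) \<Rightarrow> a n * g n z) \<partial>m)"
    proof (rule Bochner_Integration.integrable_bound[where f="\<lambda>n. B *\<^sub>R a n"])
      have "norm (\<integral>z. norm (a n * g n z) \<partial>m) \<le> norm (B *\<^sub>R a n)" for n
      proof -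
        have "(\<integral>z. norm (a n * g n z) \<partial>m) \<le> (\<integral>z. norm (a n) * B \<partial>m)"
          by (rule Bochner_Integration.integral_mono[OF integrable_norm[OF int]]) (auto simp: norm_mult bd mult_left_mono)
        also have "\<dots> = norm (a n) * B" using m.prob_space by simp
        finally show ?thesis using B by (simp add: mult.commute)
      qed
      then show "AE n in lattice. norm (\<integral>z. norm (case (n, z) of (n, z) \<Rightarrow> a n * g n z) \<partial>m) \<le> norm (B *\<^sub>R a n)"
        by (simp add: AE_count_space)
    qed (use a in auto)
  qed (use int in simp)
  note F = this
  show "integrable m (\<lambda>z. \<integral>n. a n * g n z \<partial>lattice)"
    by (rule integrable_snd[OF F])
  have "(\<integral>z. (\<integral>n. a n * g n z \<partial>lattice) \<partial>m) = (\<integral>n. (\<integral>z. a n * g n z \<partial>m) \<partial>lattice)"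
    by (rule Fubini_integral[OF F])
  then show "(\<integral>z. (\<integral>n. a n * g n z \<partial>lattice) \<partial>m) = (\<integral>n. a n * (\<integral>z. g n z \<partial>m) \<partial>lattice)"
    by simp
qed

lemma lattice_sum_delta:
  fixes a :: "int ^ 'n::finite \<Rightarrow> complex"
  shows "(\<integral>n. a n * (if n = m then 1 else 0) \<partial>lattice) = a m"
proof -
  have "(\<integral>n. a n * (if n = m then 1 else 0) \<partial>lattice) = (\<integral>n. indicator {m} n *\<^sub>R a m \<partial>lattice)"
    by (intro Bochner_Integration.integral_cong) (auto simp: indicator_def)
  also have "\<dots> = a m"
    by simp
  finally show ?thesis .
qed

section \<open>The heat semigroup with drift\<close>

definition bounded_periodic :: "(real ^ 'n::finite \<Rightarrow> complex) \<Rightarrow> bool" where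
  "bounded_periodic h \<longleftrightarrow> h \<in> borel_measurable borel \<and> periodic h \<and> (\<exists>B. \<forall>x. norm (h x) \<le> B)"

definition heat :: "real ^ 'n::finite \<Rightarrow> real \<Rightarrow> (real ^ 'n \<Rightarrow> complex) \<Rightarrow> real ^ 'n \<Rightarrow> complex" where
  "heat v t h x = (\<integral>y. h (x + y + t *\<^sub>R v) \<partial>gauss t)"

definition fourier :: "(real ^ 'n::finite \<Rightarrow> complex) \<Rightarrow> int ^ 'n \<Rightarrow> complex" where
  "fourier h n = (\<integral>x. h x * character (- n) x \<partial>haar)"

lemma bounded_periodicI:
  "h \<in> borel_measurable borel \<Longrightarrow> periodic h \<Longrightarrow> (\<And>x. norm (h x) \<le> B) \<Longrightarrow> bounded_periodic h"
  by (auto simp: bounded_periodic_def)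

lemma norm_fourier_le:
  fixes h :: "real ^ 'n::finite \<Rightarrow> complex"
  assumes "\<And>x. norm (h x) \<le> B" "h \<in> borel_measurable borel"
  shows "norm (fourier h n) \<le> B"
proof -
  interpret prob_space "haar :: (real ^ 'n) measure" by (rule prob_space_haar)
  have int: "integrable haar (\<lambda>x. h x * character (- n) x)"
    by (rule integrable_const_bound[of _ B]) (use assms in \<open>auto simp: norm_mult\<close>)
  have "norm (fourier h n) \<le> (\<integral>x. norm (h x * character (- n) x) \<partial>haar)"
    unfolding fourier_def by (rule integral_norm_bound)
  also have "\<dots> \<le> (\<integral>x. B \<partial>(haar :: (real ^ 'n) measure))"
    by (rule Bochner_Integration.integral_mono[OF integrable_norm[OF int]]) (use assms in \<open>auto simp: norm_mult\<close>)
  also have "\<dots> = B" using prob_space by simp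
  finally show ?thesis .
qed

lemma norm_heat_le:
  fixes h :: "real ^ 'n::finite \<Rightarrow> complex"
  assumes "0 < t" "\<And>x. norm (h x) \<le> B" "h \<in> borel_measurable borel"
  shows "norm (heat v t h x) \<le> B"
proof -
  interpret prob_space "gauss t :: (real ^ 'n) measure" by (rule prob_space_gauss[OF assms(1)])
  have [measurable]: "h \<in> borel_measurable borel" by fact
  have int: "integrable (gauss t) (\<lambda>y. h (x + y + t *\<^sub>R v))"
    by (rule integrable_const_bound[of _ B]) (use assms in auto)
  have "norm (heat v t h x) \<le> (\<integral>y. norm (h (x + y + t *\<^sub>R v)) \<partial>gauss t)"
    unfolding heat_def by (rule integral_norm_bound)
  also have "\<dots> \<le> (\<integral>y. B \<partial>(gauss t :: (real ^ 'n) measure))"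
    by (rule Bochner_Integration.integral_mono[OF integrable_norm[OF int]]) (use assms in auto)
  also have "\<dots> = B" using prob_space by simp
  finally show ?thesis .
qed

text \<open>Holds at every \<open>x\<close>, not merely almost everywhere, because the eigenvalues
  are absolutely summable. The law \<open>?m\<close> of the process at time \<open>t\<close> started
  at \<open>x\<close> and the measure with density \<open>?k\<close> (the heat kernel) against
  \<open>haar\<close> have the same character integrals.\<close>

lemma heat_eq_lattice_sum:
  assumes t: "0 < t" and h: "bounded_periodic h"
  shows "heat v t h x = (\<integral>n. eigen v t n * (character n x * fourier h n) \<partial>lattice)"
proof -
  interpret G: prob_space "gauss t :: (real ^ 'a) measure" by (rule prob_space_gauss[OF t])
  interpret H: prob_space "haar :: (real ^ 'a) measure" by (rule prob_space_haar)
  from h obtain B where h_meas [measurable]: "h \<in> borel_measurable borel"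
    and per: "periodic h" and bd: "\<And>x. norm (h x) \<le> B"
    by (auto simp: bounded_periodic_def)
  let ?m = "distr (gauss t) borel (\<lambda>y. x + y + t *\<^sub>R v)"
  let ?k = "\<lambda>z. \<integral>n. eigen v t n * (character n x * character (- n) z) \<partial>lattice"
  have shift [measurable]: "(\<lambda>y. x + y + t *\<^sub>R v) \<in> measurable (gauss t) borel" by measurable
  interpret D: prob_space ?m by (rule G.prob_space_distr[OF shift])
  have exchange: "(\<integral>z. f z * ?k z \<partial>haar) = (\<integral>n. eigen v t n * (character n x * (\<integral>z. f z * character (- n) z \<partial>haar)) \<partial>lattice)"
    if [measurable]: "f \<in> borel_measurable borel" and "\<And>z. norm (f z) \<le> C" for f C
  proof -
    have "(\<integral>z. f z * ?k z \<partial>haar) = (\<integral>z. (\<integral>n. eigen v t n * (f z * (character n x * character (- n) z)) \<partial>lattice) \<partial>haar)"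
      by (simp only: integral_mult_right_zero[symmetric] mult.left_commute)
    also have "\<dots> = (\<integral>n. eigen v t n * (\<integral>z. f z * (character n x * character (- n) z) \<partial>haar) \<partial>lattice)"
      by (rule lattice_sum_swap(2)[OF integrable_eigen[OF t] prob_space_haar, where B=C]) 
        (use that in \<open>auto simp: norm_mult\<close>)
    finally show ?thesis by (simp only: mult.left_commute[of "f _"] integral_mult_right_zero)
  qed
  have "(\<integral>z. h z * 1 \<partial>?m) = (\<integral>z. h z * ?k z \<partial>haar)"
  proof (rule character_integrals_determine[OF _ _ _ _ _ h_meas per bd])
    show "integrable haar ?k"
      by (rule lattice_sum_swap(1)[OF integrable_eigen[OF t] prob_space_haar, where B=1]) (auto simp: norm_mult)
    fix m :: "int ^ 'a"
    have "(\<integral>z. character m z * 1 \<partial>?m) = (\<integral>y. character m (x + y + t *\<^sub>R v) \<partial>gauss t)"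
      by (simp add: integral_distr[OF shift])
    also have "\<dots> = character m x * (\<integral>y. character m y \<partial>gauss t) * character m (t *\<^sub>R v)"
      by (simp add: character_add_right)
    also have "\<dots> = eigen v t m * character m x"
      by (simp add: integral_character_gauss[OF t] eigen_def)
    finally have 1: "(\<integral>z. character m z * 1 \<partial>?m) = eigen v t m * character m x" .
    \<comment> \<open>Orthogonality of the characters leaves only the term \<open>n = m\<close> of
      the sum.\<close>
    have "(\<integral>z. character m z * character (- n) z \<partial>haar) = (if n = m then 1 else 0)" for n
      by (simp add: character_add_left[symmetric] integral_character_haar)
    then have "(\<integral>z. character m z * ?k z \<partial>haar) =
        (\<integral>n. eigen v t n * character n x * (if n = m then 1 else 0) \<partial>lattice)"
      by (subst exchange[of _ 1]) (simp_all add: mult.assoc)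
    with 1 show "(\<integral>z. character m z * 1 \<partial>?m) = (\<integral>z. character m z * ?k z \<partial>haar)"
      by (simp only: lattice_sum_delta)
  qed simp_all
  moreover have "(\<integral>z. h z * 1 \<partial>?m) = heat v t h x"
    by (simp add: integral_distr[OF shift] heat_def)
  moreover have "(\<integral>z. h z * ?k z \<partial>haar) = (\<integral>n. eigen v t n * (character n x * fourier h n) \<partial>lattice)"
    unfolding fourier_def by (rule exchange[OF h_meas bd])
  ultimately show ?thesis by simp
qed

lemma measurable_heat:
  assumes t: "0 < t" and h: "h \<in> borel_measurable borel"
  shows "heat v t h \<in> borel_measurable borel"
proof -
  interpret prob_space "gauss t :: (real ^ 'a) measure" by (rule prob_space_gauss[OF t])
  have [measurable]: "h \<in> borel_measurable borel" by fact
  show ?thesis unfolding heat_def[abs_def] by measurable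
qed

lemma bounded_periodic_heat:
  assumes t: "0 < t" and h: "bounded_periodic h"
  shows "bounded_periodic (heat v t h)"
proof -
  from h obtain B where "h \<in> borel_measurable borel" "\<And>x. norm (h x) \<le> B" and per: "periodic h"
    by (auto simp: bounded_periodic_def)
  moreover have "periodic (heat v t h)"
    unfolding periodic_def heat_def
  proof (intro allI impI Bochner_Integration.integral_cong refl)
    fix x z y :: "real ^ 'a" assume "to_torus x = to_torus z"
    then show "h (x + y + t *\<^sub>R v) = h (z + y + t *\<^sub>R v)"
      by (intro periodicD[OF per]) (simp add: to_torus_add)
  qed
  ultimately show ?thesis
    using t by (intro bounded_periodicI measurable_heat norm_heat_le)
qed

lemma bounded_periodic_mult:
  assumes "bounded_periodic g" "bounded_periodic h"
  shows "bounded_periodic (\<lambda>x. g x * h x)"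
proof -
  from assms obtain A B where [measurable]: "g \<in> borel_measurable borel" "h \<in> borel_measurable borel"
    and A: "\<And>x. norm (g x) \<le> A" and B: "\<And>x. norm (h x) \<le> B"
    and per: "periodic g" "periodic h"
    by (auto simp: bounded_periodic_def)
  have "0 \<le> A" using A[of 0] norm_ge_zero[of "g 0"] by linarith
  then have "norm (g x * h x) \<le> A * B" for x
    unfolding norm_mult by (intro mult_mono A B) auto
  moreover have "periodic (\<lambda>x. g x * h x)"
    unfolding periodic_def using per periodicD by (intro allI impI arg_cong2[where f="(*)"]) blast+
  ultimately show ?thesis by (intro bounded_periodicI) measurable
qed

text \<open>Multiplication by \<open>f\<close> acts on Fourier coefficients as a convolution;
  expanding \<open>heat v t h\<close> keeps the dependence on \<open>t\<close> in the factor
  \<open>eigen v t n\<close>.\<close>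

lemma fourier_mult_heat:
  assumes t: "0 < t" and h: "bounded_periodic h" and f: "bounded_periodic f"
  shows "fourier (\<lambda>x. f x * heat v t h x) m = (\<integral>n. eigen v t n * (fourier h n * fourier f (m - n)) \<partial>lattice)"
proof -
  from f obtain A where [measurable]: "f \<in> borel_measurable borel" and A: "\<And>x. norm (f x) \<le> A"
    by (auto simp: bounded_periodic_def)
  from h obtain B where [measurable]: "h \<in> borel_measurable borel" and B: "\<And>x. norm (h x) \<le> B"
    by (auto simp: bounded_periodic_def)
  have F: "norm (fourier h n) \<le> B" for n by (rule norm_fourier_le) (use B in auto)
  have "fourier (\<lambda>x. f x * heat v t h x) m =
      (\<integral>x. (\<integral>n. eigen v t n * fourier h n * (f x * character (- (m - n)) x) \<partial>lattice) \<partial>haar)"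
    unfolding fourier_def[of "\<lambda>x. f x * heat v t h x"]
  proof (intro Bochner_Integration.integral_cong refl)
    fix x
    have eq: "character (- (m - n)) x = character n x * character (- m) x" for n
      using character_add_left[of n "- m" x] by simp
    have "f x * heat v t h x * character (- m) x =
        (\<integral>n. f x * character (- m) x * (eigen v t n * (character n x * fourier h n)) \<partial>lattice)"
      by (simp add: heat_eq_lattice_sum[OF t h])
    also have "\<dots> = (\<integral>n. eigen v t n * fourier h n * (f x * character (- (m - n)) x) \<partial>lattice)"
      by (intro Bochner_Integration.integral_cong refl)
         (simp only: eq mult_ac)
    finally show "f x * heat v t h x * character (- m) x = \<dots>" .
  qed
  also have "\<dots> = (\<integral>n. eigen v t n * fourier h n * (\<integral>x. f x * character (- (m - n)) x \<partial>haar) \<partial>lattice)"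
    by (rule lattice_sum_swap(2)[OF integrable_lattice_mult(1)[OF integrable_eigen[OF t] F] prob_space_haar, where B=A])
       (use A in \<open>auto simp: norm_mult\<close>)
  finally show ?thesis by (simp add: fourier_def mult.assoc)
qed

text \<open>A spectral gap estimate: every nonzero frequency has \<open>sq n\<close> at least 1.
  Time 1 is set aside to keep the series summable, whence the assumption \<open>1 \<le> t\<close>
  and the factor \<open>exp (1/2)\<close>. The bound is uniform in \<open>x\<close>, so the law of
  the starting point will not matter.\<close>

lemma heat_mixing:
  fixes h :: "real ^ 'n::finite \<Rightarrow> complex"
  assumes t: "1 \<le> t" and h: "bounded_periodic h" and B: "\<And>x. norm (h x) \<le> B"
  shows "norm (heat v t h x - fourier h 0) \<le> B * exp (1/2) * (\<integral>n. exp (- real (sq (n :: int ^ 'n)) / 2) \<partial>lattice) * exp (- t / 2)"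
proof -
  have t0: "0 < t" using t by simp
  have B0: "0 \<le> B" using B[of 0] norm_ge_zero order_trans by blast
  have F: "norm (fourier h n) \<le> B" for n
    by (rule norm_fourier_le) (use B h in \<open>auto simp: bounded_periodic_def\<close>)
  let ?a = "\<lambda>n. eigen v t n * (character n x * fourier h n)"
  have a: "integrable lattice ?a"
    by (rule integrable_lattice_mult(1)[OF integrable_eigen[OF t0]]) (use F in \<open>auto simp: norm_mult\<close>)
  have d: "integrable lattice (\<lambda>n. ?a n * (if n = 0 then 1 else 0))"
    by (rule integrable_lattice_mult(1)[OF a, of _ 1]) auto
  have e: "integrable lattice (\<lambda>n::int^'n. exp (- real (sq n) / 2))"
    using integrable_exp_sq[of 1] by simp
  have "heat v t h x - fourier h 0 = (\<integral>n. ?a n \<partial>lattice) - (\<integral>n. ?a n * (if n = 0 then 1 else 0) \<partial>lattice)"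
    unfolding lattice_sum_delta by (simp add: heat_eq_lattice_sum[OF t0 h])
  also have "\<dots> = (\<integral>n. ?a n - ?a n * (if n = 0 then 1 else 0) \<partial>lattice)"
    by (rule Bochner_Integration.integral_diff[OF a d, symmetric])
  also have "norm \<dots> \<le> (\<integral>n. norm (?a n - ?a n * (if n = 0 then 1 else 0)) \<partial>lattice)"
    by (intro integral_norm_bound Bochner_Integration.integrable_diff a d)
  also have "\<dots> \<le> (\<integral>n. (B * exp (1/2) * exp (- t / 2)) * exp (- real (sq n) / 2) \<partial>(lattice :: (int ^ 'n) measure))"
  proof (intro Bochner_Integration.integral_mono integrable_norm Bochner_Integration.integrable_diff a d)
    fix n :: "int ^ 'n"
    show "norm (?a n - ?a n * (if n = 0 then 1 else 0)) \<le> B * exp (1/2) * exp (- t / 2) * exp (- real (sq n) / 2)"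
    proof (cases "n = 0")
      case True
      then show ?thesis using B0 by simp
    next
      case False
      then have "1 \<le> real (sq n)" by (metis One_nat_def Suc_leI not_gr_zero of_nat_1 of_nat_mono sq_eq_0_iff)
      \<comment> \<open>Equivalently t |n|^2 is at least (t - 1) + |n|^2.\<close>
      then have "(t - 1) * 1 \<le> (t - 1) * real (sq n)" using t by (intro mult_left_mono) auto
      then have "exp (- t * real (sq n) / 2) \<le> exp (1/2) * exp (- t / 2) * exp (- real (sq n) / 2)"
        by (simp add: exp_add[symmetric] field_simps)
      then have "norm (eigen v t n) * norm (fourier h n) \<le> (exp (1/2) * exp (- t / 2) * exp (- real (sq n) / 2)) * B"
        unfolding norm_eigen by (intro mult_mono F) auto
      then show ?thesis using False by (simp add: norm_mult mult_ac)
    qed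
  qed (use e in auto)
  finally show ?thesis by (simp add: mult_ac)
qed

section \<open>Separating the exponentials\<close>

text \<open>Integers satisfy |k| <= k^2, so every coordinate is at most \<open>r\<close> in absolute
  value. This makes the leading part in \<open>eigen_sum_unique\<close> a finite sum.\<close>

lemma finite_sq_eq: "finite {n :: int ^ 'n::finite. sq n = r}"
proof -
  have "{n :: int ^ 'n. sq n = r} \<subseteq> vec_lambda ` (PiE UNIV (\<lambda>_. {- int r..int r}))"
  proof
    fix n :: "int ^ 'n" assume "n \<in> {n. sq n = r}"
    then have r: "sq n = r" by simp
    have "n $ i \<in> {- int r..int r}" for i
    proof -
      have "nat ((n $ i)\<^sup>2) \<le> sq n"
        unfolding sq_def by (rule member_le_sum) auto
      then have "(n $ i)\<^sup>2 \<le> int r" using r by simp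
      moreover have "\<bar>n $ i\<bar> \<le> (n $ i)\<^sup>2"
        using self_le_power[of "\<bar>n $ i\<bar>" 2] by (cases "n $ i = 0") auto
      ultimately show ?thesis by auto
    qed
    then have "vec_nth n \<in> PiE UNIV (\<lambda>_. {- int r..int r})" by auto
    then show "n \<in> vec_lambda ` (PiE UNIV (\<lambda>_. {- int r..int r}))"
      by (metis image_eqI vec_nth_inverse)
  qed
  then show ?thesis by (rule finite_subset) (intro finite_imageI finite_PiE, auto)
qed

lemma rationally_independent_int:
  assumes "rationally_independent v" "(\<Sum>i\<in>UNIV. of_int (n $ i) * v $ i) = 0"
  shows "n = 0"
proof -
  have "(\<Sum>i\<in>UNIV. of_rat (of_int (n $ i)) * v $ i) = 0" using assms(2) by simp
  then have "\<forall>i. (of_int (n $ i) :: rat) = 0"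
    using assms(1) unfolding rationally_independent_def by (elim allE[of _ "\<lambda>i. of_int (n $ i)"]) blast
  then show ?thesis by (simp add: vec_eq_iff)
qed

text \<open>The bound is independent of \<open>N\<close>, so a frequency with
  \<open>w \<noteq> 1\<close> contributes only O(1/N) to a Cesaro average.\<close>

lemma norm_geometric_sum_le:
  fixes w :: complex
  assumes "norm w = 1" "w \<noteq> 1"
  shows "norm (\<Sum>j<N. w ^ j) \<le> 2 / norm (1 - w)"
proof -
  have "(\<Sum>j<N. w ^ j) = (1 - w ^ N) / (1 - w)"
    using assms(2) by (simp add: sum_gp_strict)
  moreover have "norm (1 - w ^ N) \<le> 2"
    using norm_triangle_ineq4[of 1 "w ^ N"] assms(1) by (simp add: norm_power)
  ultimately show ?thesis
    by (simp add: norm_divide divide_right_mono)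
qed

text \<open>The exponents \<open>- |n|\<^sup>2 / 2 + \<i> n \<bullet> v\<close> are pairwise distinct by rational independence. The
  coefficients with the smallest \<open>|n|\<close> dominate as \<open>t\<close> grows, and among them a Cesaro average
  along an arithmetic progression of times isolates a single frequency.\<close>

lemma eigen_sum_unique:
  fixes c :: "int ^ 'n::finite \<Rightarrow> complex"
  assumes v: "rationally_independent v" and c: "\<And>n. norm (c n) \<le> M"
    and zero: "\<And>t. t \<in> \<rat> \<Longrightarrow> 0 < t \<Longrightarrow> (\<integral>n. eigen v t n * c n \<partial>lattice) = 0"
  shows "c n = 0"
proof (rule ccontr)
  assume "c n \<noteq> 0"
  define r where "r = (LEAST r. \<exists>n. sq n = r \<and> c n \<noteq> 0)"
  have "\<exists>n. sq n = r \<and> c n \<noteq> 0"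
    unfolding r_def by (rule LeastI[of _ "sq n"]) (use \<open>c n \<noteq> 0\<close> in blast)
  then obtain n0 where n0: "sq n0 = r" "c n0 \<noteq> 0" by blast
  have below: "c n = 0" if "sq n < r" for n
    using not_less_Least[OF that[unfolded r_def]] by blast
  define S where "S = {n :: int ^ 'n. sq n = r}"
  have fin: "finite S" unfolding S_def by (rule finite_sq_eq)
  have n0S: "n0 \<in> S" using n0 by (simp add: S_def)
  have M: "0 \<le> M" using c[of 0] norm_ge_zero order_trans by blast
  define L where "L = (\<integral>n. exp (- real (sq n) / 2) \<partial>(lattice :: (int ^ 'n) measure))"
  define K where "K = M * exp (real (r + 1) / 2) * L"
  define T where "T t = (\<Sum>n\<in>S. c n * character n (t *\<^sub>R v))" for t
  have e: "integrable lattice (\<lambda>n::int^'n. exp (- real (sq n) / 2))"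
    using integrable_exp_sq[of 1] by simp
  \<comment> \<open>Coefficients below level \<open>r\<close> vanish. From level r + 1 on, t |n|^2
    is at least (t - 1)(r + 1) + |n|^2, so after multiplication by exp (t r / 2) the tail is of
    order exp (- t / 2).\<close>
  have T_bound: "norm (T t) \<le> K * exp (- t / 2)" if t: "t \<in> \<rat>" "1 \<le> t" for t
  proof -
    let ?g = "\<lambda>n. eigen v t n * c n"
    have g: "integrable lattice ?g"
      by (rule integrable_lattice_mult(1)[OF integrable_eigen c]) (use t in simp)
    have gS: "integrable lattice (\<lambda>n. ?g n * (if n \<in> S then 1 else 0))"
      by (rule integrable_lattice_mult(1)[OF g, of _ 1]) auto
    have "(\<integral>n. ?g n * (if n \<in> S then 1 else 0) \<partial>lattice) = (\<integral>n. (\<Sum>k\<in>S. ?g n * (if n = k then 1 else 0)) \<partial>lattice)"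
      by (intro Bochner_Integration.integral_cong refl) (simp add: sum_distrib_left[symmetric] fin)
    also have "\<dots> = (\<Sum>k\<in>S. \<integral>n. ?g n * (if n = k then 1 else 0) \<partial>lattice)"
      by (intro Bochner_Integration.integral_sum integrable_lattice_mult(1)[OF g, of _ 1]) auto
    also have "\<dots> = (\<Sum>k\<in>S. ?g k)" by (simp only: lattice_sum_delta)
    also have "\<dots> = exp (- t * real r / 2) * T t"
      unfolding T_def sum_distrib_left
      by (intro sum.cong refl) (auto simp: S_def eigen_def exp_of_real)
    finally have main: "(\<integral>n. ?g n * (if n \<in> S then 1 else 0) \<partial>lattice) = exp (- t * real r / 2) * T t" .
    have "norm (\<integral>n. ?g n - ?g n * (if n \<in> S then 1 else 0) \<partial>lattice) \<le>
        (\<integral>n. norm (?g n - ?g n * (if n \<in> S then 1 else 0)) \<partial>lattice)"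
      by (rule integral_norm_bound)
    also have "\<dots> \<le> (\<integral>n. (M * exp (- (t - 1) * real (r + 1) / 2)) * exp (- real (sq n) / 2) \<partial>(lattice :: (int ^ 'n) measure))"
    proof (intro Bochner_Integration.integral_mono integrable_norm Bochner_Integration.integrable_diff g gS)
      fix n :: "int ^ 'n"
      show "norm (?g n - ?g n * (if n \<in> S then 1 else 0)) \<le> M * exp (- (t - 1) * real (r + 1) / 2) * exp (- real (sq n) / 2)"
      proof (cases "sq n \<le> r")
        case True
        then show ?thesis using below[of n] M by (auto simp: S_def)
      next
        case False
        then have "(t - 1) * real (r + 1) \<le> (t - 1) * real (sq n)"
          using t by (intro mult_left_mono) auto
        then have "exp (- t * real (sq n) / 2) \<le> exp (- (t - 1) * real (r + 1) / 2) * exp (- real (sq n) / 2)"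
          by (simp add: exp_add[symmetric] field_simps)
        then have "norm (eigen v t n) * norm (c n) \<le> (exp (- (t - 1) * real (r + 1) / 2) * exp (- real (sq n) / 2)) * M"
          unfolding norm_eigen by (intro mult_mono c) auto
        then show ?thesis using False by (simp add: S_def norm_mult mult_ac)
      qed
    qed (use e in auto)
    also have "\<dots> = M * exp (- (t - 1) * real (r + 1) / 2) * L"
      unfolding L_def by simp
    also have "(\<integral>n. ?g n - ?g n * (if n \<in> S then 1 else 0) \<partial>lattice) = - (exp (- t * real r / 2) * T t)"
      using Bochner_Integration.integral_diff[OF g gS] zero[of t] t main by simp
    finally have "exp (- t * real r / 2) * norm (T t) \<le> M * exp (- (t - 1) * real (r + 1) / 2) * L"
      by (simp add: norm_mult)
    then have "exp (t * real r / 2) * (exp (- t * real r / 2) * norm (T t)) \<le>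
        exp (t * real r / 2) * (M * exp (- (t - 1) * real (r + 1) / 2) * L)"
      by (intro mult_left_mono) auto
    moreover have "exp (t * real r / 2) * (exp (- t * real r / 2) * norm (T t)) = norm (T t)"
      by (simp add: mult.assoc[symmetric] exp_add[symmetric])
    moreover have "exp (t * real r / 2) * (M * exp (- (t - 1) * real (r + 1) / 2) * L) = K * exp (- t / 2)"
    proof -
      have "exp (t * real r / 2) * exp (- (t - 1) * real (r + 1) / 2) = exp (real (r + 1) / 2) * exp (- t / 2)"
        unfolding exp_add[symmetric] by (simp add: field_simps)
      then show ?thesis unfolding K_def by (simp add: mult_ac)
    qed
    ultimately show ?thesis by metis
  qed
  define d where "d n = (\<Sum>i\<in>UNIV. of_int ((n - n0) $ i) * v $ i)" for n
  \<comment> \<open>With \<open>h = 1 / real k\<close> the step is rational and every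
    \<open>\<bar>h * d n\<bar>\<close> is below 1, hence below pi. Sampling with step
    \<open>h\<close> therefore cannot alias: \<open>w n = 1\<close> forces
    \<open>d n = 0\<close>.\<close>
  obtain k :: nat where k: "(\<Sum>n\<in>S. \<bar>d n\<bar>) < real k" using reals_Archimedean2 by blast
  define h where "h = 1 / real k"
  have "0 \<le> (\<Sum>n\<in>S. \<bar>d n\<bar>)" by (simp add: sum_nonneg)
  then have kpos: "0 < real k" using k by linarith
  then have h: "0 < h" "h \<in> \<rat>" by (auto simp: h_def)
  define w where "w n = cis (h * d n)" for n
  have w0: "w n0 = 1" by (simp add: w_def d_def)
  have w1: "w n \<noteq> 1" if "n \<in> S" "n \<noteq> n0" for n
  proof
    assume "w n = 1"
    then have "sin (h * d n) = 0" by (simp add: w_def complex_eq_iff)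
    moreover have "\<bar>h * d n\<bar> < pi"
    proof -
      have "\<bar>d n\<bar> \<le> (\<Sum>n\<in>S. \<bar>d n\<bar>)" using that fin by (intro member_le_sum) auto
      then have "\<bar>d n\<bar> < real k" using k by simp
      then have "\<bar>h * d n\<bar> < 1" using kpos by (simp add: h_def abs_mult)
      then show ?thesis using pi_gt3 by simp
    qed
    ultimately have "h * d n = 0" using sin_eq_0_pi[of "h * d n"] by (auto simp: abs_less_iff)
    then have "d n = 0" using h by simp
    then have "n - n0 = 0" unfolding d_def by (rule rationally_independent_int[OF v])
    then show False using that by simp
  qed
  \<comment> \<open>The conjugate factor removes the oscillation of the term \<open>n0\<close>.
    Sampling starts at time 1, as \<open>T_bound\<close> requires.\<close>
  have term_eq: "T (1 + real j * h) * cnj (character n0 ((1 + real j * h) *\<^sub>R v)) =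
      (\<Sum>n\<in>S. c n * character (n - n0) v * w n ^ j)" for j
  proof -
    have "character n ((1 + real j * h) *\<^sub>R v) * cnj (character n0 ((1 + real j * h) *\<^sub>R v)) =
        character (n - n0) v * w n ^ j" for n
    proof -
      have "character n x * cnj (character n0 x) = character (n - n0) x" for x
        using character_add_left[of n "- n0" x] by (simp add: character_minus_left)
      moreover have "character (n - n0) ((1 + real j * h) *\<^sub>R v) = character (n - n0) v * w n ^ j"
      proof -
        have "character (n - n0) ((real j * h) *\<^sub>R v) = cis (real j * h * d n)"
          unfolding character_def d_def sum_distrib_left
          by (intro arg_cong[where f=cis] sum.cong refl) simp
        then show ?thesis
          by (simp add: scaleR_add_left character_add_right w_def Complex.DeMoivre mult.assoc)
      qed
      ultimately show ?thesis by simp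
    qed
    then show ?thesis
      by (simp add: T_def sum_distrib_right mult.assoc)
  qed
  \<comment> \<open>\<open>C\<close> bounds the geometric sums of the other frequencies and
    \<open>E\<close> the summed errors of \<open>T_bound\<close>; neither depends on
    \<open>N\<close>.\<close>
  define C where "C = (\<Sum>n\<in>S - {n0}. norm (c n) * (2 / norm (1 - w n)))"
  define E where "E = \<bar>K\<bar> / (1 - exp (- h / 2))"
  have bound: "real N * norm (c n0) \<le> C + E" for N
  proof -
    have "(\<Sum>j<N. T (1 + real j * h) * cnj (character n0 ((1 + real j * h) *\<^sub>R v))) =
        (\<Sum>n\<in>S. c n * character (n - n0) v * (\<Sum>j<N. w n ^ j))"
      unfolding term_eq by (subst sum.swap) (simp add: sum_distrib_left)
    also have "\<dots> = c n0 * of_nat N + (\<Sum>n\<in>S - {n0}. c n * character (n - n0) v * (\<Sum>j<N. w n ^ j))"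
      by (subst sum.remove[OF fin n0S]) (simp add: w0)
    finally have eq: "c n0 * of_nat N = (\<Sum>j<N. T (1 + real j * h) * cnj (character n0 ((1 + real j * h) *\<^sub>R v))) -
        (\<Sum>n\<in>S - {n0}. c n * character (n - n0) v * (\<Sum>j<N. w n ^ j))" by simp
    have "norm (\<Sum>n\<in>S - {n0}. c n * character (n - n0) v * (\<Sum>j<N. w n ^ j)) \<le> C"
      unfolding C_def
    proof (rule sum_norm_le)
      fix n assume n: "n \<in> S - {n0}"
      have "norm (\<Sum>j<N. w n ^ j) \<le> 2 / norm (1 - w n)"
        by (rule norm_geometric_sum_le) (use n w1 in \<open>auto simp: w_def\<close>)
      then show "norm (c n * character (n - n0) v * (\<Sum>j<N. w n ^ j)) \<le> norm (c n) * (2 / norm (1 - w n))"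
        unfolding norm_mult norm_character mult_1_right by (rule mult_left_mono) simp
    qed
    moreover have "norm (\<Sum>j<N. T (1 + real j * h) * cnj (character n0 ((1 + real j * h) *\<^sub>R v))) \<le> E"
    proof -
      have "norm (T (1 + real j * h) * cnj (character n0 ((1 + real j * h) *\<^sub>R v))) \<le> \<bar>K\<bar> * exp (- h / 2) ^ j" for j
      proof -
        have "norm (T (1 + real j * h)) \<le> K * exp (- (1 + real j * h) / 2)"
          by (rule T_bound) (use h in auto)
        also have "\<dots> \<le> \<bar>K\<bar> * exp (- h / 2) ^ j"
          by (intro mult_mono) (auto simp: exp_of_nat_mult[symmetric])
        finally show ?thesis by (simp add: norm_mult)
      qed
      then have "norm (\<Sum>j<N. T (1 + real j * h) * cnj (character n0 ((1 + real j * h) *\<^sub>R v))) \<le> (\<Sum>j<N. \<bar>K\<bar> * exp (- h / 2) ^ j)"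
        by (intro sum_norm_le) auto
      also have "\<dots> = \<bar>K\<bar> * ((1 - exp (- h / 2) ^ N) / (1 - exp (- h / 2)))"
        using h by (simp add: sum_distrib_left[symmetric] sum_gp_strict)
      also have "\<dots> \<le> \<bar>K\<bar> * (1 / (1 - exp (- h / 2)))"
        using h by (intro mult_left_mono divide_right_mono) auto
      finally show ?thesis by (simp add: E_def)
    qed
    ultimately have "norm (c n0 * of_nat N) \<le> E + C"
      unfolding eq by (intro order_trans[OF norm_triangle_ineq4] add_mono)
    then show ?thesis by (simp add: norm_mult mult.commute)
  qed
  have "0 < norm (c n0)" using n0 by simp
  then obtain N :: nat where "C + E < real N * norm (c n0)" using reals_Archimedean3 by blast
  with bound[of N] show False by simp
qed

section \<open>Extending a circle-valued homomorphism to the lattice\<close>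

text \<open>A partial homomorphism from a subgroup of \<open>\<int>\<^sup>d\<close> to the unit circle, represented by its graph.\<close>

definition partial_hom :: "((int ^ 'n::finite) \<times> complex) set \<Rightarrow> bool" where
  "partial_hom R \<longleftrightarrow> (0, 1) \<in> R \<and>
     (\<forall>a x b y. (a, x) \<in> R \<longrightarrow> (b, y) \<in> R \<longrightarrow> (a + b, x * y) \<in> R) \<and>
     (\<forall>a x. (a, x) \<in> R \<longrightarrow> (- a, inverse x) \<in> R) \<and>
     (\<forall>a x. (a, x) \<in> R \<longrightarrow> norm x = 1) \<and>
     (\<forall>x. (0, x) \<in> R \<longrightarrow> x = 1)"

lemma partial_homD:
  assumes "partial_hom R"
  shows "(0, 1) \<in> R"
    and "(a, x) \<in> R \<Longrightarrow> (b, y) \<in> R \<Longrightarrow> (a + b, x * y) \<in> R"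
    and "(a, x) \<in> R \<Longrightarrow> (- a, inverse x) \<in> R"
    and "(a, x) \<in> R \<Longrightarrow> norm x = 1"
    and "(0, x) \<in> R \<Longrightarrow> x = 1"
  using assms unfolding partial_hom_def by blast+

lemma partial_hom_power_int:
  assumes R: "partial_hom R" and a: "(a, x) \<in> R"
  shows "(k *s a, x powi k) \<in> R"
proof -
  have nat: "(int j *s a, x ^ j) \<in> R" for j
  proof (induction j)
    case 0
    then show ?case using partial_homD(1)[OF R] by simp
  next
    case (Suc j)
    have "(a + int j *s a, x * x ^ j) \<in> R" by (rule partial_homD(2)[OF R a Suc])
    also have "a + int j *s a = int (Suc j) *s a"
      by (simp add: vec_eq_iff algebra_simps)
    finally show ?case by simp
  qed
  show ?thesis
  proof (cases "k \<ge> 0")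
    case True
    then show ?thesis using nat[of "nat k"] by (simp add: power_int_def)
  next
    case False
    then show ?thesis using partial_homD(3)[OF R nat[of "nat (- k)"]]
      by (simp add: power_int_def vector_smult_lneg power_inverse)
  qed
qed

lemma complex_unit_root:
  assumes "norm x = 1" "0 < k"
  shows "\<exists>z. norm z = 1 \<and> z ^ k = (x :: complex)"
proof (intro exI conjI)
  show "cis (Arg x / real k) ^ k = x"
  proof -
    have "x \<noteq> 0" using assms by auto
    then show ?thesis using assms cis_Arg[of x] by (simp add: Complex.DeMoivre sgn_div_norm)
  qed
qed simp

text \<open>The multiples of \<open>e\<close> in the domain of \<open>R\<close> are the multiples of
  some \<open>j * e\<close>. A \<open>j\<close>-th root of the value there is a consistent value at
  \<open>e\<close>; if only the zero multiple occurs, the value 1 will do.\<close>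

lemma partial_hom_extend:
  fixes e :: "int ^ 'n::finite"
  assumes R: "partial_hom R"
  shows "\<exists>R' z. partial_hom R' \<and> R \<subseteq> R' \<and> (e, z) \<in> R'"
proof -
  let ?K = "{k::int. \<exists>x. (k *s e, x) \<in> R}"
  have "\<exists>z. norm z = 1 \<and> (\<forall>k x. (k *s e, x) \<in> R \<longrightarrow> x = z powi k)"
  proof (cases "\<exists>k\<in>?K. k \<noteq> 0")
    case False
    then have "x = 1 powi k" if "(k *s e, x) \<in> R" for k x
      using partial_homD(5)[OF R, of x] that by auto
    then show ?thesis by (intro exI[of _ 1]) auto
  next
    case True
    then obtain k x where k: "(k *s e, x) \<in> R" "k \<noteq> 0" by auto
    have ex: "\<exists>j>0. \<exists>x. (int j *s e, x) \<in> R"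
    proof (cases "k > 0")
      case True
      then show ?thesis using k by (intro exI[of _ "nat k"]) auto
    next
      case False
      then show ?thesis using k partial_homD(3)[OF R k(1)]
        by (intro exI[of _ "nat (- k)"]) (auto simp: vector_smult_lneg)
    qed
    \<comment> \<open>The positive generator of the group \<open>?K\<close>.\<close>
    define j where "j = (LEAST j. j > 0 \<and> (\<exists>x. (int j *s e, x) \<in> R))"
    have "j > 0 \<and> (\<exists>x. (int j *s e, x) \<in> R)"
      unfolding j_def by (rule LeastI_ex) (use ex in blast)
    then obtain x0 where j: "0 < j" and x0: "(int j *s e, x0) \<in> R" by blast
    have least: "\<not> (\<exists>x. (int i *s e, x) \<in> R)" if "0 < i" "i < j" for i
      using not_less_Least[of i "\<lambda>j. j > 0 \<and> (\<exists>x. (int j *s e, x) \<in> R)"] that unfolding j_def by blast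
    obtain z where z: "norm z = 1" "z ^ j = x0"
      using complex_unit_root[OF partial_homD(4)[OF R x0] j] by blast
    have z0: "z \<noteq> 0" using z(1) by auto
    have "x = z powi k" if kx: "(k *s e, x) \<in> R" for k x
    proof -
      define q r where "q = k div int j" and "r = k mod int j"
      have kqr: "k = q * int j + r" by (simp add: q_def r_def)
      have r: "0 \<le> r" "r < int j" using j by (simp_all add: r_def)
      \<comment> \<open>Division with remainder: subtracting \<open>q\<close> copies of
        \<open>j\<close> leaves a multiple \<open>r < j\<close> in the domain, and minimality forces
        \<open>r = 0\<close>.\<close>
      have "(k *s e + (- q) *s (int j *s e), x * x0 powi (- q)) \<in> R"
        by (intro partial_homD(2)[OF R] kx partial_hom_power_int[OF R] x0)
      also have "k *s e + (- q) *s (int j *s e) = r *s e"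
        by (simp add: kqr vec_eq_iff algebra_simps)
      finally have rR: "(r *s e, x * x0 powi (- q)) \<in> R" .
      have "r = 0"
        using least[of "nat r"] r rR by (cases "r = 0") auto
      with rR have "x * x0 powi (- q) = 1"
        using partial_homD(5)[OF R] by simp
      then have "x = x0 powi q"
        using z z0 by (simp add: power_int_minus field_simps)
      also have "\<dots> = z powi (int j * q)"
        by (simp add: power_int_mult z(2))
      also have "int j * q = k" by (simp add: kqr \<open>r = 0\<close>)
      finally show ?thesis .
    qed
    then show ?thesis using z(1) by blast
  qed
  then obtain z where z: "norm z = 1" and ze: "\<And>k x. (k *s e, x) \<in> R \<Longrightarrow> x = z powi k" by blast
  have z0: "z \<noteq> 0" using z by auto
  let ?R = "{(a + k *s e, x * z powi k) | a x k. (a, x) \<in> R}"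
  have "partial_hom ?R"
    unfolding partial_hom_def
  proof (intro conjI allI impI)
    show "(0, 1) \<in> ?R"
      using partial_homD(1)[OF R] by (intro CollectI exI[of _ 0] exI[of _ 1] exI[of _ "0::int"]) auto
  next
    fix a x b y assume "(a, x) \<in> ?R" "(b, y) \<in> ?R"
    from \<open>(a, x) \<in> ?R\<close> obtain a' x' k where "a = a' + k *s e" "x = x' * z powi k" "(a', x') \<in> R" by blast
    moreover from \<open>(b, y) \<in> ?R\<close> obtain b' y' l where "b = b' + l *s e" "y = y' * z powi l" "(b', y') \<in> R" by blast
    ultimately show "(a + b, x * y) \<in> ?R"
      using partial_homD(2)[OF R, of a' x' b' y'] z0
      by (intro CollectI exI[of _ "a' + b'"] exI[of _ "x' * y'"] exI[of _ "k + l"])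
         (auto simp: power_int_add vec_eq_iff algebra_simps)
  next
    fix a x assume "(a, x) \<in> ?R"
    then obtain a' x' k where "a = a' + k *s e" "x = x' * z powi k" "(a', x') \<in> R" by blast
    then show "(- a, inverse x) \<in> ?R"
      using partial_homD(3)[OF R, of a' x'] z0
      by (intro CollectI exI[of _ "- a'"] exI[of _ "inverse x'"] exI[of _ "- k"])
         (auto simp: power_int_minus vec_eq_iff)
  next
    fix a x assume "(a, x) \<in> ?R"
    then show "norm x = 1"
      using partial_homD(4)[OF R] z by (auto simp: norm_mult norm_power_int)
  next
    fix x assume "(0, x) \<in> ?R"
    then obtain a' x' k where *: "a' + k *s e = 0" "x = x' * z powi k" "(a', x') \<in> R" by (smt (verit) mem_Collect_eq prod.inject)
    \<comment> \<open>Single-valuedness of the extension: \<open>a'\<close> is a multiple of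
      \<open>e\<close> already in the domain of \<open>R\<close>, where the choice of
      \<open>z\<close> prescribes the value.\<close>
    then have "a' = (- k) *s e" by (simp add: vec_eq_iff algebra_simps add_eq_0_iff)
    then have "x' = z powi (- k)" using ze[of "- k" x'] * by simp
    then show "x = 1" using * z0 by (simp add: power_int_minus)
  qed
  moreover have "R \<subseteq> ?R"
  proof
    fix p assume "p \<in> R"
    then show "p \<in> ?R"
      by (cases p) (auto intro!: exI[of _ "0::int"] exI[of _ "fst p"] exI[of _ "snd p"])
  qed
  moreover have "(e, z) \<in> ?R"
    using partial_homD(1)[OF R] by (intro CollectI exI[of _ 0] exI[of _ 1] exI[of _ "1::int"]) auto
  ultimately show ?thesis by blast
qed

text \<open>The lattice is finitely generated, so adjoining the basis vectors one after another
  reaches all of it; the arguments of the values there are the coordinates of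
  \<open>\<theta>\<close>.\<close>

lemma partial_hom_character:
  fixes R :: "((int ^ 'n::finite) \<times> complex) set"
  assumes R: "partial_hom R"
  shows "\<exists>\<theta>. \<forall>a x. (a, x) \<in> R \<longrightarrow> x = character a \<theta>"
proof -
  have "\<exists>R'. partial_hom R' \<and> R \<subseteq> R' \<and> (\<forall>i\<in>I. \<exists>z. (axis i 1, z) \<in> R')" for I :: "'n set"
    using finite[of I]
  proof (induction I rule: finite_induct)
    case empty
    then show ?case using R by blast
  next
    case (insert j I)
    then obtain R' where R': "partial_hom R'" "R \<subseteq> R'" "\<forall>i\<in>I. \<exists>z. (axis i 1, z) \<in> R'" by blast
    from partial_hom_extend[OF R'(1), of "axis j 1"]
    obtain R'' z where R'': "partial_hom R''" "R' \<subseteq> R''" "(axis j 1, z) \<in> R''" by blast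
    show ?case
      using R' R'' by (intro exI[of _ R'']) blast
  qed
  from this[of UNIV] obtain R' where R': "partial_hom R'" "R \<subseteq> R'" "\<forall>i. \<exists>z. (axis i 1, z) \<in> R'" by blast
  then obtain z where z: "\<And>i. (axis i 1, z i) \<in> R'" by metis
  have nz: "norm (z i) = 1" for i by (rule partial_homD(4)[OF R'(1) z])
  define \<theta> :: "real ^ 'n" where "\<theta> = (\<chi> i. Arg (z i))"
  have z_cis: "z i = cis (\<theta> $ i)" for i
  proof -
    have "z i \<noteq> 0" using nz[of i] by auto
    then show ?thesis using nz[of i] cis_Arg[of "z i"] by (simp add: \<theta>_def sgn_div_norm)
  qed
  have "x = character a \<theta>" if ax: "(a, x) \<in> R" for a x
  proof -
    have "((\<Sum>i\<in>I. (a $ i) *s axis i 1), (\<Prod>i\<in>I. z i powi (a $ i))) \<in> R'" for I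
      using finite[of I]
    proof (induction I rule: finite_induct)
      case (insert j I)
      then show ?case
        using partial_homD(2)[OF R'(1) partial_hom_power_int[OF R'(1) z[of j], of "a $ j"] insert.IH] by simp
    qed (use partial_homD(1)[OF R'(1)] in simp)
    from this[of UNIV] have "(a, character a \<theta>) \<in> R'"
    proof -
      have "(\<Sum>i\<in>UNIV. (a $ i) *s axis i 1) = a" by (rule basis_expansion)
      moreover have "(\<Prod>i\<in>UNIV. z i powi (a $ i)) = character a \<theta>"
        by (simp add: z_cis cis_power_int character_prod)
      ultimately show ?thesis using \<open>((\<Sum>i\<in>UNIV. _ i), _) \<in> R'\<close> by simp
    qed
    moreover have "(a, x) \<in> R'" using ax R' by blast
    \<comment> \<open>The quotient of two values at \<open>a\<close> is a value at 0, hence equal to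
      1.\<close>
    ultimately have "(a + - a, x * inverse (character a \<theta>)) \<in> R'"
      by (intro partial_homD(2)[OF R'(1)] partial_homD(3)[OF R'(1)])
    then have "x * inverse (character a \<theta>) = 1"
      using partial_homD(5)[OF R'(1)] by simp
    then show ?thesis by (simp add: field_simps)
  qed
  then show ?thesis by blast
qed

section \<open>Correlations determine the function up to translation\<close>

text \<open>\<open>cyl v [(s\<^sub>1, h\<^sub>1), \<dots>, (s\<^sub>k, h\<^sub>k)] x\<close> is the expectation of \<open>\<Prod>\<^sub>j h\<^sub>j (X (s\<^sub>1 + \<dots> + s\<^sub>j))\<close> for the
  process started at \<open>x\<close>: the lists record time gaps, not times.\<close>

fun cyl :: "real ^ 'n::finite \<Rightarrow> (real \<times> (real ^ 'n \<Rightarrow> complex)) list \<Rightarrow> real ^ 'n \<Rightarrow> complex" where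
  "cyl v [] x = 1"
| "cyl v ((s, h) # l) x = heat v s (\<lambda>y. h y * cyl v l y) x"

lemma bounded_periodic_1: "bounded_periodic (\<lambda>_. 1)"
  by (rule bounded_periodicI[of _ 1]) (auto simp: periodic_def)

lemma bounded_periodic_cyl:
  assumes "\<And>s h. (s, h) \<in> set l \<Longrightarrow> 0 < s \<and> bounded_periodic h"
  shows "bounded_periodic (cyl v l)"
  using assms
proof (induction l)
  case Nil
  have "cyl v [] = (\<lambda>_. 1)" by (simp add: fun_eq_iff)
  then show ?case by (simp add: bounded_periodic_1)
next
  case (Cons p l)
  obtain s h where p: "p = (s, h)" by (cases p)
  have "cyl v (p # l) = heat v s (\<lambda>y. h y * cyl v l y)" by (simp add: fun_eq_iff p)
  moreover have "bounded_periodic (heat v s (\<lambda>y. h y * cyl v l y))"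
    using Cons p by (intro bounded_periodic_heat bounded_periodic_mult) auto
  ultimately show ?case by simp
qed

text \<open>At frequency 0 this is the correlation of \<open>f\<close> over the gaps
  \<open>ts\<close> for the process started from \<open>haar\<close>. The other frequencies are kept
  because the recursion in the first gap couples all of them.\<close>

definition correlation :: "real ^ 'n::finite \<Rightarrow> (real ^ 'n \<Rightarrow> complex) \<Rightarrow> real list \<Rightarrow> int ^ 'n \<Rightarrow> complex" where
  "correlation v f ts = fourier (\<lambda>x. f x * cyl v (map (\<lambda>t. (t, f)) ts) x)"

lemma correlation_Nil: "correlation v f [] = fourier f"
  by (simp add: correlation_def)

lemma fourier_bounded:
  assumes "bounded_periodic h"
  shows "\<exists>B. \<forall>n. norm (fourier h n) \<le> B"
proof -
  from assms obtain B where "h \<in> borel_measurable borel" "\<And>x. norm (h x) \<le> B"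
    by (auto simp: bounded_periodic_def)
  then show ?thesis using norm_fourier_le by blast
qed

context
  fixes v :: "real ^ 'n::finite" and f :: "real ^ 'n \<Rightarrow> complex"
  assumes f: "bounded_periodic f"
begin

lemma bounded_periodic_correlation:
  assumes "\<forall>t\<in>set ts. 0 < t"
  shows "bounded_periodic (\<lambda>x. f x * cyl v (map (\<lambda>t. (t, f)) ts) x)"
  using assms by (intro bounded_periodic_mult f bounded_periodic_cyl) (auto simp: f)

text \<open>The first gap enters only through \<open>eigen v t n\<close>, so varying it exposes the
  individual terms to \<open>eigen_sum_unique\<close>.\<close>

lemma correlation_Cons:
  assumes "0 < t" "\<forall>t\<in>set ts. 0 < t"
  shows "correlation v f (t # ts) m = (\<integral>n. eigen v t n * (correlation v f ts n * fourier f (m - n)) \<partial>lattice)"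
  unfolding correlation_def
  using fourier_mult_heat[OF assms(1) bounded_periodic_correlation[OF assms(2)] f, of v m] by simp

lemma correlation_bounded:
  assumes "\<forall>t\<in>set ts. 0 < t"
  shows "\<exists>B. \<forall>n. norm (correlation v f ts n) \<le> B"
  unfolding correlation_def by (intro fourier_bounded bounded_periodic_correlation assms)

end

text \<open>One gap is traded for one Fourier factor: prepending a gap \<open>t\<close> to
  \<open>ts\<close> and varying \<open>t\<close> equates the coefficients of the individual
  exponentials. For empty \<open>ts\<close> a pure product of Fourier coefficients remains.\<close>

lemma fourier_products_eq:
  fixes f g :: "real ^ 'n::finite \<Rightarrow> complex"
  assumes v: "rationally_independent v" and f: "bounded_periodic f" and g: "bounded_periodic g"
    and eq: "\<And>ts. \<forall>t\<in>set ts. t \<in> \<rat> \<and> 0 < t \<Longrightarrow> correlation v f ts 0 = correlation v g ts 0"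
    and ts: "\<forall>t\<in>set ts. t \<in> \<rat> \<and> 0 < t"
  shows "prod_list (map (fourier f) ns) * correlation v f ts (- sum_list ns) =
         prod_list (map (fourier g) ns) * correlation v g ts (- sum_list ns)"
  using ts
proof (induction ns arbitrary: ts)
  case Nil
  then show ?case using eq by simp
next
  case (Cons k ns)
  let ?m = "- sum_list ns"
  let ?a = "prod_list (map (fourier f) ns)" and ?b = "prod_list (map (fourier g) ns)"
  define c where "c n = ?a * (correlation v f ts n * fourier f (?m - n)) - ?b * (correlation v g ts n * fourier g (?m - n))" for n
  have pos: "\<forall>t\<in>set ts. 0 < t" using Cons.prems by blast
  obtain A where A: "\<And>n. norm (correlation v f ts n) \<le> A" using correlation_bounded[OF f pos] by blast
  obtain B where B: "\<And>n. norm (correlation v g ts n) \<le> B" using correlation_bounded[OF g pos] by blast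
  obtain F where F: "\<And>n. norm (fourier f n) \<le> F"
    using fourier_bounded[OF f] by blast
  obtain G where G: "\<And>n. norm (fourier g n) \<le> G"
    using fourier_bounded[OF g] by blast
  have A0: "0 \<le> A" and B0: "0 \<le> B" using A[of 0] B[of 0] norm_ge_zero order_trans by blast+
  have bf: "norm (correlation v f ts n * fourier f (?m - n)) \<le> A * F" for n
    unfolding norm_mult by (intro mult_mono A F A0) auto
  have bg: "norm (correlation v g ts n * fourier g (?m - n)) \<le> B * G" for n
    unfolding norm_mult by (intro mult_mono B G B0) auto
  have "c n = 0" for n
  proof (rule eigen_sum_unique[OF v])
    show "norm (c n) \<le> norm ?a * (A * F) + norm ?b * (B * G)" for n
    proof -
      have "norm (c n) \<le> norm (?a * (correlation v f ts n * fourier f (?m - n))) +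
          norm (?b * (correlation v g ts n * fourier g (?m - n)))"
        unfolding c_def by (rule norm_triangle_ineq4)
      also have "\<dots> \<le> norm ?a * (A * F) + norm ?b * (B * G)"
        unfolding norm_mult[of ?a] norm_mult[of ?b] by (intro add_mono mult_left_mono bf bg norm_ge_zero)
      finally show ?thesis .
    qed
    fix t :: real assume t: "t \<in> \<rat>" "0 < t"
    have If: "integrable lattice (\<lambda>n. eigen v t n * (correlation v f ts n * fourier f (?m - n)))"
      by (rule integrable_lattice_mult(1)[OF integrable_eigen[OF t(2)] bf])
    have Ig: "integrable lattice (\<lambda>n. eigen v t n * (correlation v g ts n * fourier g (?m - n)))"
      by (rule integrable_lattice_mult(1)[OF integrable_eigen[OF t(2)] bg])
    have "(\<integral>n. eigen v t n * c n \<partial>lattice) =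
        (\<integral>n. ?a * (eigen v t n * (correlation v f ts n * fourier f (?m - n))) -
             ?b * (eigen v t n * (correlation v g ts n * fourier g (?m - n))) \<partial>lattice)"
      unfolding c_def by (intro Bochner_Integration.integral_cong refl) (simp only: right_diff_distrib mult.left_commute)
    also have "\<dots> = ?a * correlation v f (t # ts) ?m - ?b * correlation v g (t # ts) ?m"
      unfolding correlation_Cons[OF f t(2) pos] correlation_Cons[OF g t(2) pos]
      by (subst Bochner_Integration.integral_diff) (use If Ig in simp_all)
    \<comment> \<open>The list of frequencies shrinks while the list of gaps grows, hence the
      induction with arbitrary \<open>ts\<close>.\<close>
    also have "\<dots> = 0" using Cons.IH[of "t # ts"] Cons.prems t by simp
    finally show "(\<integral>n. eigen v t n * c n \<partial>lattice) = 0" .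
  qed
  \<comment> \<open>At this frequency \<open>?m - n\<close> equals \<open>k\<close>, so the new
    factor is the coefficient at \<open>k\<close>.\<close>
  from this[of "- k + ?m"] show ?case
    by (simp add: c_def algebra_simps)
qed

section \<open>Translations and uniqueness of Fourier coefficients\<close>

text \<open>The cube is moved by a translation, so invariance concerns periodic integrands only. On
  characters it is immediate: a nonzero frequency integrates to 0 before and after the
  shift.\<close>

lemma integral_haar_shift:
  fixes h :: "real ^ 'n::finite \<Rightarrow> complex"
  assumes h: "bounded_periodic h"
  shows "(\<integral>x. h (x + a) \<partial>haar) = (\<integral>x. h x \<partial>haar)"
proof -
  from h obtain B where hm [measurable]: "h \<in> borel_measurable borel"
    and per: "periodic h" and bd: "\<And>x. norm (h x) \<le> B"
    by (auto simp: bounded_periodic_def)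
  interpret H: prob_space "haar :: (real ^ 'n) measure" by (rule prob_space_haar)
  have sh [measurable]: "(\<lambda>x. x + a) \<in> measurable haar borel" by measurable
  interpret D: prob_space "distr haar borel (\<lambda>x. x + a)" by (rule H.prob_space_distr[OF sh])
  have "(\<integral>x. h x * 1 \<partial>distr haar borel (\<lambda>x. x + a)) = (\<integral>x. h x * 1 \<partial>haar)"
  proof (rule character_integrals_determine[OF _ _ _ _ _ hm per bd])
    show "(\<integral>x. character n x * 1 \<partial>distr haar borel (\<lambda>x. x + a)) = (\<integral>x. character n x * 1 \<partial>haar)" for n
      by (simp add: integral_distr[OF sh] character_add_right integral_character_haar)
  qed simp_all
  then show ?thesis by (simp add: integral_distr[OF sh])
qed

lemma bounded_periodic_shift:
  assumes "bounded_periodic h"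
  shows "bounded_periodic (\<lambda>x. h (x + a))"
proof -
  from assms obtain B where [measurable]: "h \<in> borel_measurable borel"
    and per: "periodic h" and bd: "\<And>x. norm (h x) \<le> B"
    by (auto simp: bounded_periodic_def)
  have "periodic (\<lambda>x. h (x + a))"
    unfolding periodic_def by (intro allI impI periodicD[OF per]) (simp add: to_torus_add)
  then show ?thesis by (intro bounded_periodicI[of _ B]) (auto intro: bd)
qed

lemma bounded_periodic_character: "bounded_periodic (character n)"
  by (rule bounded_periodicI[of _ 1]) (auto simp: periodic_character)

lemma fourier_shift:
  assumes "bounded_periodic h"
  shows "fourier (\<lambda>x. h (x + a)) n = character n a * fourier h n"
proof -
  have "fourier (\<lambda>x. h (x + a)) n = (\<integral>x. character n a * (h (x + a) * character (- n) (x + a)) \<partial>haar)"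
    unfolding fourier_def
  proof (intro Bochner_Integration.integral_cong refl)
    fix x
    have "character n a * character (- n) a = 1" by (simp flip: character_add_left)
    then show "h (x + a) * character (- n) x = character n a * (h (x + a) * character (- n) (x + a))"
      by (simp add: character_add_right)
  qed
  also have "\<dots> = character n a * (\<integral>x. h x * character (- n) x \<partial>haar)"
    using integral_haar_shift[OF bounded_periodic_mult[OF assms bounded_periodic_character[of "- n"]], of a] by simp
  finally show ?thesis by (simp add: fourier_def)
qed

text \<open>Equal coefficients give equal integrals against every bounded periodic test function;
  testing with the conjugate of \<open>f - g\<close> makes the integral of its squared modulus
  vanish.\<close>

lemma fourier_unique:
  fixes f g :: "real ^ 'n::finite \<Rightarrow> complex"
  assumes f: "bounded_periodic f" and g: "bounded_periodic g" and eq: "\<And>n. fourier f n = fourier g n"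
  shows "AE x in haar. f x = g x"
proof -
  interpret H: prob_space "haar :: (real ^ 'n) measure" by (rule prob_space_haar)
  from f obtain A where fm [measurable]: "f \<in> borel_measurable borel"
    and pf: "periodic f" and A: "\<And>x. norm (f x) \<le> A"
    by (auto simp: bounded_periodic_def)
  from g obtain B where gm [measurable]: "g \<in> borel_measurable borel"
    and pg: "periodic g" and B: "\<And>x. norm (g x) \<le> B"
    by (auto simp: bounded_periodic_def)
  let ?h = "\<lambda>x. cnj (f x - g x)"
  have cnj_m [measurable]: "cnj \<in> borel_measurable borel"
    by (intro borel_measurable_continuous_onI continuous_intros)
  have hm: "?h \<in> borel_measurable borel" by measurable
  have hb: "norm (?h x) \<le> A + B" for x
    using norm_triangle_ineq4[of "f x" "g x"] A[of x] B[of x] unfolding complex_mod_cnj by linarith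
  have hp: "periodic ?h"
    unfolding periodic_def
  proof (intro allI impI)
    fix x y :: "real ^ 'n" assume t: "to_torus x = to_torus y"
    show "?h x = ?h y" by (simp only: periodicD[OF pf t] periodicD[OF pg t])
  qed
  have int_f: "integrable haar f" by (rule H.integrable_const_bound[of _ A]) (use A in auto)
  have int_g: "integrable haar g" by (rule H.integrable_const_bound[of _ B]) (use B in auto)
  have "(\<integral>x. ?h x * f x \<partial>haar) = (\<integral>x. ?h x * g x \<partial>haar)"
  proof (rule character_integrals_determine[OF _ _ int_f int_g _ hm hp hb])
    show "(\<integral>x. character n x * f x \<partial>haar) = (\<integral>x. character n x * g x \<partial>haar)" for n
      using eq[of "- n"] by (simp add: fourier_def mult.commute)
  qed simp_all
  moreover have AB: "0 \<le> A + B" by (rule order_trans[OF norm_ge_zero hb[of 0]])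
  moreover have "integrable haar (\<lambda>x. ?h x * f x)"
  proof (rule H.integrable_const_bound[of _ "(A + B) * A", OF AE_I2])
    show "norm (?h x * f x) \<le> (A + B) * A" for x
      unfolding norm_mult by (intro mult_mono hb A AB norm_ge_zero)
  qed measurable
  moreover have "integrable haar (\<lambda>x. ?h x * g x)"
  proof (rule H.integrable_const_bound[of _ "(A + B) * B", OF AE_I2])
    show "norm (?h x * g x) \<le> (A + B) * B" for x
      unfolding norm_mult by (intro mult_mono hb B AB norm_ge_zero)
  qed measurable
  ultimately have "(\<integral>x. ?h x * f x - ?h x * g x \<partial>haar) = 0" by simp
  also have "(\<lambda>x. ?h x * f x - ?h x * g x) = (\<lambda>x. complex_of_real ((norm (f x - g x))\<^sup>2))"
    by (simp only: complex_norm_square left_diff_distrib mult.commute[of "cnj _"])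
  finally have "(\<integral>x. (norm (f x - g x))\<^sup>2 \<partial>haar) = 0"
    by (simp del: of_real_power)
  moreover have "integrable haar (\<lambda>x. (norm (f x - g x))\<^sup>2)"
  proof (rule H.integrable_const_bound[of _ "(A + B)\<^sup>2", OF AE_I2])
    show "norm ((norm (f x - g x))\<^sup>2) \<le> (A + B)\<^sup>2" for x
      using power_mono[OF hb[of x] norm_ge_zero, of 2] unfolding complex_mod_cnj by simp
  qed measurable
  ultimately have "AE x in haar. (norm (f x - g x))\<^sup>2 = 0"
    by (subst (asm) integral_nonneg_eq_0_iff_AE) auto
  then show ?thesis by simp
qed

theorem correlations_determine:
  fixes f g :: "real ^ 'n::finite \<Rightarrow> complex"
  assumes v: "rationally_independent v" and f: "bounded_periodic f" and g: "bounded_periodic g"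
    and real: "\<And>x. cnj (f x) = f x" "\<And>x. cnj (g x) = g x"
    and eq: "\<And>ts. \<forall>t\<in>set ts. t \<in> \<rat> \<and> 0 < t \<Longrightarrow> correlation v f ts 0 = correlation v g ts 0"
  shows "\<exists>\<theta>. AE x in haar. g x = f (x + \<theta>)"
proof -
  let ?F = "fourier f" and ?G = "fourier g"
  have prods: "prod_list (map ?F ns) * ?F (- sum_list ns) = prod_list (map ?G ns) * ?G (- sum_list ns)" for ns
    using fourier_products_eq[OF v f g eq, of "[]" ns] by (simp add: correlation_Nil)
  \<comment> \<open>Because \<open>f\<close> and \<open>g\<close> are real, the product for the
    frequencies n and -n is a squared modulus, which gives |F| = |G|, and the support of F is
    symmetric.\<close>
  have cnj_fourier: "fourier h (- n) = cnj (fourier h n)" if "\<And>x. cnj (h x) = h x" for h :: "real ^ 'n \<Rightarrow> complex" and n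
  proof -
    have "cnj (fourier h n) = (\<integral>x. cnj (h x * character (- n) x) \<partial>haar)"
      unfolding fourier_def by (rule Bochner_Integration.integral_cnj[symmetric])
    also have "\<dots> = fourier h (- n)"
      unfolding fourier_def by (simp add: that character_minus_left)
    finally show ?thesis by simp
  qed
  have norm_eq: "norm (?F n) = norm (?G n)" for n
  proof -
    have "(norm (?F n))\<^sup>2 = (norm (?G n))\<^sup>2"
      using prods[of "[n]"] cnj_fourier[of f n, OF real(1)] cnj_fourier[of g n, OF real(2)]
      by (simp flip: complex_norm_square of_real_power)
    then show ?thesis by simp
  qed
  define S where "S = {n. ?F n \<noteq> 0}"
  define \<rho> where "\<rho> n = ?G n / ?F n" for n
  have S_minus: "- n \<in> S \<longleftrightarrow> n \<in> S" for n
    by (simp add: S_def cnj_fourier[of f, OF real(1)])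
  have norm_chi: "norm (\<rho> n) = 1" if "n \<in> S" for n
    using that norm_eq[of n] by (auto simp: \<rho>_def S_def norm_divide)
  have chi_minus: "\<rho> (- n) = inverse (\<rho> n)" if "n \<in> S" for n
  proof -
    have "\<rho> n * \<rho> (- n) = 1"
      using prods[of "[n]"] that S_minus[of n] by (auto simp: \<rho>_def S_def)
    then show ?thesis by (metis inverse_unique)
  qed
  have prod_chi: "prod_list (map \<rho> ns) = prod_list (map ?G ns) / prod_list (map ?F ns)" for ns
    by (induction ns) (auto simp: \<rho>_def)
  have prod_F: "prod_list (map ?F ns) \<noteq> 0" if "set ns \<subseteq> S" for ns
    using that by (auto simp: prod_list_zero_iff S_def)
  \<comment> \<open>A lattice point may be a sum of support elements in several ways, so the
    homomorphism is first a relation; its single-valuedness is the last axiom of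
    \<open>partial_hom\<close>.\<close>
  let ?R = "{(sum_list ns, prod_list (map \<rho> ns)) | ns. set ns \<subseteq> S}"
  have "partial_hom ?R"
    unfolding partial_hom_def
  proof (intro conjI allI impI)
    show "(0, 1) \<in> ?R" by (intro CollectI exI[of _ "[]"]) simp
  next
    fix a x b y assume "(a, x) \<in> ?R" "(b, y) \<in> ?R"
    from \<open>(a, x) \<in> ?R\<close> obtain ms where "a = sum_list ms" "x = prod_list (map \<rho> ms)" "set ms \<subseteq> S" by blast
    moreover from \<open>(b, y) \<in> ?R\<close> obtain ns where "b = sum_list ns" "y = prod_list (map \<rho> ns)" "set ns \<subseteq> S" by blast
    ultimately show "(a + b, x * y) \<in> ?R" by (intro CollectI exI[of _ "ms @ ns"]) simp
  next
    fix a x assume "(a, x) \<in> ?R"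
    then obtain ns where ns: "a = sum_list ns" "x = prod_list (map \<rho> ns)" "set ns \<subseteq> S" by auto
    have "sum_list (map uminus ns) = - sum_list ns" by (induction ns) auto
    moreover have "prod_list (map \<rho> (map uminus ns)) = inverse (prod_list (map \<rho> ns))"
      using ns(3) by (induction ns) (auto simp: chi_minus)
    ultimately show "(- a, inverse x) \<in> ?R"
      using ns S_minus by (intro CollectI exI[of _ "map uminus ns"]) auto
  next
    fix a x assume "(a, x) \<in> ?R"
    then obtain ns where ns: "x = prod_list (map \<rho> ns)" "set ns \<subseteq> S" by auto
    then show "norm x = 1"
      by (induction ns arbitrary: x) (auto simp: norm_mult norm_chi)
  next
    fix x assume "(0, x) \<in> ?R"
    then obtain ns where ns: "sum_list ns = 0" "x = prod_list (map \<rho> ns)" "set ns \<subseteq> S" by auto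
    show "x = 1"
    proof (cases ns)
      case Nil
      then show ?thesis using ns by simp
    next
      case (Cons k ks)
      \<comment> \<open>A word with sum 0 ends up in the form covered by \<open>prods\<close>, its
        head being minus the sum of the rest.\<close>
      then have "k = - sum_list ks" using ns(1) by (simp add: add_eq_0_iff)
      then have "prod_list (map ?F ns) = prod_list (map ?G ns)"
        using prods[of ks] Cons by (simp add: mult.commute)
      then show ?thesis using prod_F[OF ns(3)] ns(2) by (simp add: prod_chi)
    qed
  qed
  then obtain \<theta> where \<theta>: "\<And>a x. (a, x) \<in> ?R \<Longrightarrow> x = character a \<theta>"
    using partial_hom_character by blast
  have "fourier g n = fourier (\<lambda>x. f (x + \<theta>)) n" for n
  proof (cases "n \<in> S")
    case True
    then have "(n, \<rho> n) \<in> ?R" by (intro CollectI exI[of _ "[n]"]) simp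
    from \<theta>[OF this] show ?thesis using True by (simp add: fourier_shift[OF f] \<rho>_def S_def field_simps)
  next
    case False
    \<comment> \<open>Off the support both coefficients vanish, as their moduli agree.\<close>
    then show ?thesis using norm_eq[of n] by (simp add: fourier_shift[OF f] S_def)
  qed
  then show ?thesis
    using fourier_unique[OF g bounded_periodic_shift[OF f, of \<theta>]] by blast
qed

section \<open>A law of large numbers along the squares\<close>

text \<open>Geometrically decaying covariances make the second moment of the first N terms O(N).
  Along N = (k + 1)^2 the averages have summable second moments, so the series of their squares is
  almost surely finite. A single subsequence is enough to identify the limit.\<close>

lemma (in prob_space) lln_square_subsequence:
  fixes W :: "nat \<Rightarrow> 'a \<Rightarrow> real"
  assumes [measurable]: "\<And>n. W n \<in> borel_measurable M"
    and bd: "\<And>n \<omega>. \<bar>W n \<omega>\<bar> \<le> b"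
    and cov: "\<And>n m. n \<le> m \<Longrightarrow> \<bar>expectation (\<lambda>\<omega>. W n \<omega> * W m \<omega>)\<bar> \<le> K * \<rho> ^ (m - n)"
    and \<rho>: "0 \<le> \<rho>" "\<rho> < 1"
  shows "AE \<omega> in M. (\<lambda>k. (\<Sum>n<(Suc k)\<^sup>2. W n \<omega>) / real ((Suc k)\<^sup>2)) \<longlonglongrightarrow> 0"
proof -
  \<comment> \<open>Bounds the growth of the second moment per added term: twice the cross terms,
    summed geometrically, plus the diagonal term.\<close>
  define c where "c = 2 * (K / (1 - \<rho>)) + K"
  have K: "0 \<le> K" using order_trans[OF abs_ge_zero cov[of 0 0]] by simp
  have b: "0 \<le> b" using bd[of 0 undefined] by linarith
  have intW: "integrable M (\<lambda>\<omega>. W n \<omega> * W m \<omega>)" for n m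
  proof (rule integrable_const_bound[of _ "b * b", OF AE_I2])
    show "norm (W n \<omega> * W m \<omega>) \<le> b * b" for \<omega>
      unfolding real_norm_def abs_mult by (intro mult_mono bd b) auto
  qed measurable
  have intSW: "integrable M (\<lambda>\<omega>. (\<Sum>n<N. W n \<omega>) * W m \<omega>)" for N m
    unfolding sum_distrib_right by (intro Bochner_Integration.integrable_sum intW)
  have intS: "integrable M (\<lambda>\<omega>. (\<Sum>n<N. W n \<omega>)\<^sup>2)" for N
    unfolding power2_eq_square sum_distrib_left[of "sum _ _"] by (intro Bochner_Integration.integrable_sum intSW)
  have second_moment: "expectation (\<lambda>\<omega>. (\<Sum>n<N. W n \<omega>)\<^sup>2) \<le> c * real N" for N
  proof (induction N)
    case (Suc N)
    have geo: "(\<Sum>n<N. \<rho> ^ (N - n)) \<le> 1 / (1 - \<rho>)"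
    proof -
      have "(\<Sum>n<N. \<rho> ^ (N - n)) = (\<Sum>j<N. \<rho> ^ (N - (N - Suc j)))"
        by (rule sum.nat_diff_reindex[symmetric])
      also have "\<dots> = (\<Sum>j<N. \<rho> ^ Suc j)" by (intro sum.cong) auto
      also have "\<dots> \<le> (\<Sum>j<N. \<rho> ^ j)"
        using \<rho> by (intro sum_mono) (auto intro: mult_left_le_one_le)
      also have "\<dots> = (1 - \<rho> ^ N) / (1 - \<rho>)" using \<rho> by (simp add: sum_gp_strict)
      also have "\<dots> \<le> 1 / (1 - \<rho>)" using \<rho> by (intro divide_right_mono) auto
      finally show ?thesis .
    qed
    have "expectation (\<lambda>\<omega>. (\<Sum>n<Suc N. W n \<omega>)\<^sup>2) =
        expectation (\<lambda>\<omega>. (\<Sum>n<N. W n \<omega>)\<^sup>2 + (2 * ((\<Sum>n<N. W n \<omega>) * W N \<omega>) + W N \<omega> * W N \<omega>))"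
      by (simp add: power2_eq_square algebra_simps)
    also have "\<dots> = expectation (\<lambda>\<omega>. (\<Sum>n<N. W n \<omega>)\<^sup>2) +
        (2 * expectation (\<lambda>\<omega>. (\<Sum>n<N. W n \<omega>) * W N \<omega>) + expectation (\<lambda>\<omega>. W N \<omega> * W N \<omega>))"
      using intS intSW intW by simp
    finally have expand: "expectation (\<lambda>\<omega>. (\<Sum>n<Suc N. W n \<omega>)\<^sup>2) = expectation (\<lambda>\<omega>. (\<Sum>n<N. W n \<omega>)\<^sup>2) +
        (2 * expectation (\<lambda>\<omega>. (\<Sum>n<N. W n \<omega>) * W N \<omega>) + expectation (\<lambda>\<omega>. W N \<omega> * W N \<omega>))" .
    have "expectation (\<lambda>\<omega>. (\<Sum>n<N. W n \<omega>) * W N \<omega>) = (\<Sum>n<N. expectation (\<lambda>\<omega>. W n \<omega> * W N \<omega>))"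
      unfolding sum_distrib_right by (intro Bochner_Integration.integral_sum intW)
    also have "\<dots> \<le> (\<Sum>n<N. K * \<rho> ^ (N - n))"
    proof (rule sum_mono)
      fix n assume "n \<in> {..<N}"
      then show "expectation (\<lambda>\<omega>. W n \<omega> * W N \<omega>) \<le> K * \<rho> ^ (N - n)"
        using cov[of n N] by (auto dest: abs_le_D1)
    qed
    also have "\<dots> \<le> K * (1 / (1 - \<rho>))"
      unfolding sum_distrib_left[symmetric] by (intro mult_left_mono geo K)
    finally have cross: "expectation (\<lambda>\<omega>. (\<Sum>n<N. W n \<omega>) * W N \<omega>) \<le> K * (1 / (1 - \<rho>))" .
    have "expectation (\<lambda>\<omega>. W N \<omega> * W N \<omega>) \<le> K" using cov[of N N] abs_le_D1 by simp
    moreover have "c * real (Suc N) = c * real N + c" by (simp add: algebra_simps)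
    moreover have "c = 2 * (K * (1 / (1 - \<rho>))) + K" by (simp add: c_def)
    ultimately show ?case using Suc.IH cross expand by linarith
  qed simp
  define a where "a k \<omega> = (\<Sum>n<(Suc k)\<^sup>2. W n \<omega>) / real ((Suc k)\<^sup>2)" for k \<omega>
  have [measurable]: "a k \<in> borel_measurable M" for k unfolding a_def by measurable
  have int_a: "integrable M (\<lambda>\<omega>. (a k \<omega>)\<^sup>2)" for k
    unfolding a_def power_divide by (intro integrable_divide intS)
  have mean_a: "expectation (\<lambda>\<omega>. (a k \<omega>)\<^sup>2) \<le> c * (1 / real (Suc k) ^ 2)" for k
  proof -
    have "expectation (\<lambda>\<omega>. (a k \<omega>)\<^sup>2) = expectation (\<lambda>\<omega>. (\<Sum>n<(Suc k)\<^sup>2. W n \<omega>)\<^sup>2) / (real ((Suc k)\<^sup>2))\<^sup>2"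
      unfolding a_def power_divide by simp
    also have "\<dots> \<le> c * real ((Suc k)\<^sup>2) / (real ((Suc k)\<^sup>2))\<^sup>2"
      by (intro divide_right_mono second_moment) simp
    also have "\<dots> = c * (1 / real (Suc k) ^ 2)"
    proof -
      have "c * x / x\<^sup>2 = c * (1 / x)" if "x \<noteq> 0" for x :: real
        using that by (simp add: power2_eq_square)
      from this[of "real ((Suc k)\<^sup>2)"] show ?thesis by (simp del: of_nat_Suc)
    qed
    finally show ?thesis .
  qed
  have c: "0 \<le> c" using K \<rho> by (auto simp: c_def)
  have summ: "summable (\<lambda>k. c * (1 / real (Suc k) ^ 2))"
  proof (rule summable_mult)
    have "summable (\<lambda>k. 1 / real k ^ 2)"
      using inverse_power_summable[of 2, where 'a=real] by (simp add: divide_inverse)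
    then show "summable (\<lambda>k. 1 / real (Suc k) ^ 2)" by (rule summable_Suc_iff[THEN iffD2])
  qed
  have "(\<integral>\<^sup>+\<omega>. (\<Sum>k. ennreal ((a k \<omega>)\<^sup>2)) \<partial>M) = (\<Sum>k. \<integral>\<^sup>+\<omega>. ennreal ((a k \<omega>)\<^sup>2) \<partial>M)"
    by (rule nn_integral_suminf) measurable
  also have "\<dots> = (\<Sum>k. ennreal (expectation (\<lambda>\<omega>. (a k \<omega>)\<^sup>2)))"
    by (intro suminf_cong nn_integral_eq_integral int_a) auto
  also have "\<dots> \<le> (\<Sum>k. ennreal (c * (1 / real (Suc k) ^ 2)))"
    by (intro suminf_le ennreal_leI mean_a) auto
  also have "\<dots> = ennreal (\<Sum>k. c * (1 / real (Suc k) ^ 2))"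
    by (rule suminf_ennreal2[OF _ summ]) (use c in auto)
  also have "\<dots> < \<infinity>" by simp
  finally have "(\<integral>\<^sup>+\<omega>. (\<Sum>k. ennreal ((a k \<omega>)\<^sup>2)) \<partial>M) \<noteq> \<infinity>" by simp
  then have "AE \<omega> in M. (\<Sum>k. ennreal ((a k \<omega>)\<^sup>2)) \<noteq> \<infinity>"
    by (intro nn_integral_PInf_AE) measurable
  then show ?thesis
  proof eventually_elim
    case (elim \<omega>)
    then have "summable (\<lambda>k. (a k \<omega>)\<^sup>2)"
      by (intro summable_suminf_not_top) auto
    then have "(\<lambda>k. (a k \<omega>)\<^sup>2) \<longlonglongrightarrow> 0" by (rule summable_LIMSEQ_zero)
    then have "(\<lambda>k. sqrt ((a k \<omega>)\<^sup>2)) \<longlonglongrightarrow> sqrt 0" by (rule tendsto_real_sqrt)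
    then have "(\<lambda>k. \<bar>a k \<omega>\<bar>) \<longlonglongrightarrow> 0" by simp
    then show ?case unfolding a_def by (rule tendsto_rabs_zero_cancel)
  qed
qed

section \<open>Drifted Brownian motion as a Markov process\<close>

text \<open>The bound 1 is preserved by products and by \<open>heat\<close>, so no constants
  accumulate along a list of observations.\<close>

definition test_function :: "(real ^ 'n::finite \<Rightarrow> complex) \<Rightarrow> bool" where
  "test_function h \<longleftrightarrow> bounded_periodic h \<and> (\<forall>x. norm (h x) \<le> 1)"

lemma test_functionD:
  assumes "test_function h"
  shows "bounded_periodic h" "h \<in> borel_measurable borel" "norm (h x) \<le> 1"
  using assms by (auto simp: test_function_def bounded_periodic_def)

lemma test_function_mult:
  assumes "test_function g" "test_function h"
  shows "test_function (\<lambda>x. g x * h x)"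
proof -
  have "norm (g x * h x) \<le> 1" for x
    using mult_mono[OF test_functionD(3)[OF assms(1), of x] test_functionD(3)[OF assms(2), of x]]
    by (simp add: norm_mult)
  then show ?thesis
    using assms by (simp add: test_function_def bounded_periodic_mult)
qed

lemma test_function_heat: "0 < t \<Longrightarrow> test_function h \<Longrightarrow> test_function (heat v t h)"
  unfolding test_function_def
  by (intro conjI allI bounded_periodic_heat norm_heat_le) (auto simp: bounded_periodic_def)

definition admissible :: "(real \<times> (real ^ 'n::finite \<Rightarrow> complex)) list \<Rightarrow> bool" where
  "admissible l \<longleftrightarrow> (\<forall>(s, h)\<in>set l. 0 < s \<and> test_function h)"

lemma admissible_simps [simp]:
  "admissible []"
  "admissible ((s, h) # l) \<longleftrightarrow> 0 < s \<and> test_function h \<and> admissible l"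
  "admissible (l @ l') \<longleftrightarrow> admissible l \<and> admissible l'"
  by (auto simp: admissible_def)

lemma test_function_cyl: "admissible l \<Longrightarrow> test_function (cyl v l)"
proof (induction l)
  case Nil
  have "cyl v [] = (\<lambda>_. 1)" by (simp add: fun_eq_iff)
  then show ?case by (simp add: test_function_def bounded_periodic_1)
next
  case (Cons p l)
  obtain s h where p: "p = (s, h)" by (cases p)
  have "cyl v (p # l) = heat v s (\<lambda>y. h y * cyl v l y)" by (simp add: fun_eq_iff p)
  then show ?case
    using Cons p by (simp add: test_function_heat test_function_mult)
qed

definition total :: "(real \<times> 'b) list \<Rightarrow> real" where
  "total l = sum_list (map fst l)"

lemma total_simps [simp]: "total [] = 0" "total (p # l) = fst p + total l" "total (l @ l') = total l + total l'"
  by (auto simp: total_def)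

lemma total_nonneg: "admissible l \<Longrightarrow> 0 \<le> total l"
  by (induction l) (auto simp: admissible_def)

section \<open>Joint independence of the starting point and the increments\<close>

locale drifted_brownian_motion =
  fixes M :: "'w measure" and B :: "real \<Rightarrow> 'w \<Rightarrow> real ^ 'n::finite" and X0 :: "'w \<Rightarrow> real ^ 'n" and v :: "real ^ 'n"
  assumes bm: "standard_brownian_motion M B"
    and X0_measurable: "X0 \<in> M \<rightarrow>\<^sub>M borel"
    and X0_indep: "prob_space.indep_set M
          (sets (vimage_algebra (space M) X0 borel))
          (sets (vimage_algebra (space M) (\<lambda>\<omega>. restrict (\<lambda>t. B t \<omega>) {0..}) (Pi\<^sub>M {0..} (\<lambda>_. borel))))"
begin

sublocale prob_space M
  using bm by (simp add: standard_brownian_motion_def)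

lemma B_measurable [measurable]: "0 \<le> t \<Longrightarrow> B t \<in> borel_measurable M"
  using bm by (simp add: standard_brownian_motion_def)

lemma B_0: "AE \<omega> in M. B 0 \<omega> = 0"
  using bm by (simp add: standard_brownian_motion_def)

lemma B_indep_increments:
  fixes t :: "nat \<Rightarrow> real"
  assumes "0 \<le> t 0" "\<And>k. k < n \<Longrightarrow> t k < t (Suc k)"
  shows "indep_vars (\<lambda>_. borel) (\<lambda>k \<omega>. B (t (Suc k)) \<omega> - B (t k) \<omega>) {..<n}"
  using bm assms unfolding standard_brownian_motion_def by blast

lemma distr_increment:
  assumes "0 \<le> s" "s < t"
  shows "distr M borel (\<lambda>\<omega>. B t \<omega> - B s \<omega>) = gauss (t - s)"
proof -
  have "distributed M lborel (\<lambda>\<omega>. B t \<omega> - B s \<omega>)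
          (\<lambda>x. ennreal (\<Prod>i\<in>UNIV. normal_density 0 (sqrt (t - s)) (x $ i)))"
    using bm assms unfolding standard_brownian_motion_def by blast
  then have "distr M lborel (\<lambda>\<omega>. B t \<omega> - B s \<omega>) = gauss (t - s)"
    unfolding gauss_def prod_density_def by (rule distributed_distr_eq_density)
  then show ?thesis by (simp cong: distr_cong)
qed

text \<open>Starting point and increments form one sequence, so that past and next increment can be
  separated by grouping a single independent family.\<close>

definition innovation :: "(nat \<Rightarrow> real) \<Rightarrow> nat \<Rightarrow> 'w \<Rightarrow> real ^ 'n" where
  "innovation t k \<omega> = (case k of 0 \<Rightarrow> X0 \<omega> | Suc j \<Rightarrow> B (t (Suc j)) \<omega> - B (t j) \<omega>)"

lemma innovation_simps:
  "innovation t 0 = X0"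
  "innovation t (Suc j) = (\<lambda>\<omega>. B (t (Suc j)) \<omega> - B (t j) \<omega>)"
  by (simp_all add: fun_eq_iff innovation_def)

text \<open>Combines two hypotheses: \<open>X0\<close> is independent of the whole path of
  \<open>B\<close>, and the increments are independent of each other. The first splits off index 0,
  the second factors the rest.\<close>

lemma indep_innovations:
  assumes t: "0 \<le> t 0" "\<And>k. k < n \<Longrightarrow> t k < t (Suc k)"
  shows "indep_vars (\<lambda>_. borel) (innovation t) {..n}"
proof -
  have t_nonneg: "0 \<le> t k" if "k \<le> n" for k
    using that
  proof (induction k)
    case (Suc k)
    then show ?case using t(2)[of k] by simp
  qed (use t in simp)
  let ?D = "\<lambda>k \<omega>. B (t (Suc k)) \<omega> - B (t k) \<omega>"
  let ?path = "\<lambda>\<omega>. restrict (\<lambda>t. B t \<omega>) {0..}"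
  let ?\<A> = "sets (vimage_algebra (space M) X0 borel)"
  let ?\<B> = "sets (vimage_algebra (space M) ?path (Pi\<^sub>M {0..} (\<lambda>_. borel)))"
  have meas: "innovation t k \<in> borel_measurable M" if "k \<le> n" for k
  proof (cases k)
    case 0
    then show ?thesis using X0_measurable by (simp add: innovation_simps)
  next
    case (Suc j)
    then show ?thesis using that t_nonneg[of j] t_nonneg[of "Suc j"] by (simp add: innovation_simps)
  qed
  have D_in: "?D k -` A \<inter> space M \<in> ?\<B>" if "k < n" and A: "A \<in> sets borel" for k A
  proof -
    \<comment> \<open>An increment is a measurable function of two coordinates of the path, so its
      events belong to the path \<open>\<sigma>\<close>-algebra.\<close>
    have "(\<lambda>p. p (t (Suc k)) - p (t k)) \<in> borel_measurable (Pi\<^sub>M {0..} (\<lambda>_. borel :: (real ^ 'n) measure))"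
      using t_nonneg[of k] t_nonneg[of "Suc k"] that
      by (intro borel_measurable_diff measurable_component_singleton) auto
    from measurable_sets[OF this A]
    have "?path -` ((\<lambda>p. p (t (Suc k)) - p (t k)) -` A \<inter> space (Pi\<^sub>M {0..} (\<lambda>_. borel))) \<inter> space M \<in> ?\<B>"
      by (rule in_vimage_algebra)
    also have "?path -` ((\<lambda>p. p (t (Suc k)) - p (t k)) -` A \<inter> space (Pi\<^sub>M {0..} (\<lambda>_. borel))) \<inter> space M = ?D k -` A \<inter> space M"
      using t_nonneg[of k] t_nonneg[of "Suc k"] that by (auto simp: space_PiM)
    finally show ?thesis .
  qed
  show ?thesis
    unfolding indep_vars_def2
  proof (intro conjI ballI indep_setsI)
    show "random_variable borel (innovation t k)" if "k \<in> {..n}" for k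
      using meas that by simp
    show "{innovation t i -` A \<inter> space M |A. A \<in> sets borel} \<subseteq> events" if "i \<in> {..n}" for i
      using measurable_sets[OF meas] that by auto
    fix A J assume J: "J \<noteq> {}" "J \<subseteq> {..n}" "finite J"
      and "\<forall>j\<in>J. A j \<in> {innovation t j -` A \<inter> space M |A. A \<in> sets borel}"
    then have "\<forall>j\<in>J. \<exists>C. C \<in> sets borel \<and> A j = innovation t j -` C \<inter> space M" by blast
    from bchoice[OF this] obtain C where C: "\<And>j. j \<in> J \<Longrightarrow> C j \<in> sets borel \<and> A j = innovation t j -` C j \<inter> space M"
      by blast
    \<comment> \<open>Indices outside \<open>J\<close> are padded with the whole space:
      probabilities do not change, and the full index set splits into 0 and the successors.\<close>
    define C' where "C' j = (if j \<in> J then C j else UNIV)" for j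
    have C': "C' j \<in> sets borel" for j using C by (simp add: C'_def)
    define E where "E = (\<Inter>k\<in>{..<n}. ?D k -` C' (Suc k) \<inter> space M)"
    have inc: "prob (\<Inter>k\<in>K. ?D k -` C' (Suc k) \<inter> space M) = (\<Prod>k\<in>K. prob (?D k -` C' (Suc k) \<inter> space M))"
      if "K \<noteq> {}" "K \<subseteq> {..<n}" for K
      by (rule indep_varsD[OF B_indep_increments[OF t], of n K])
         (use that C' finite_subset in auto)
    have full: "prob (innovation t j -` C' j \<inter> space M) = 1" if "j \<notin> J" for j
      using that prob_space by (simp add: C'_def)
    have "prob (\<Inter>j\<in>J. A j) = prob (\<Inter>j\<in>{..n}. innovation t j -` C' j \<inter> space M)"
    proof (intro arg_cong[where f=prob] equalityI subsetI)
      fix \<omega> assume "\<omega> \<in> (\<Inter>j\<in>J. A j)"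
      then have "\<omega> \<in> A j" if "j \<in> J" for j using that by blast
      moreover have "\<omega> \<in> space M" using \<open>\<omega> \<in> (\<Inter>j\<in>J. A j)\<close> J(1) C by blast
      ultimately show "\<omega> \<in> (\<Inter>j\<in>{..n}. innovation t j -` C' j \<inter> space M)"
        using C by (auto simp: C'_def)
    next
      fix \<omega> assume "\<omega> \<in> (\<Inter>j\<in>{..n}. innovation t j -` C' j \<inter> space M)"
      then have *: "\<omega> \<in> innovation t j -` C' j \<inter> space M" if "j \<in> J" for j using J(2) that by blast
      then show "\<omega> \<in> (\<Inter>j\<in>J. A j)" using C by (auto simp: C'_def)
    qed
    also have "\<dots> = (\<Prod>j\<in>{..n}. prob (innovation t j -` C' j \<inter> space M))"
    proof -
      have split: "{..n} = insert 0 (Suc ` {..<n})"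
        by (auto simp: image_iff) (metis Suc_le_eq not0_implies_Suc lessThan_iff)
      have X: "X0 -` C' 0 \<inter> space M \<in> ?\<A>" by (rule in_vimage_algebra[OF C'])
      have "prob (\<Inter>j\<in>{..n}. innovation t j -` C' j \<inter> space M) =
          prob (X0 -` C' 0 \<inter> space M) * (\<Prod>k\<in>{..<n}. prob (?D k -` C' (Suc k) \<inter> space M))"
      \<comment> \<open>For \<open>n = 0\<close> the intersection \<open>E\<close> runs over no
        index and equals \<open>UNIV\<close>, so this case is kept apart.\<close>
      proof (cases "n = 0")
        case True
        then show ?thesis by (simp add: innovation_simps)
      next
        case False
        have "E \<in> ?\<B>"
          unfolding E_def using False D_in C' by (intro sets.finite_INT) auto
        have "(\<Inter>j\<in>{..n}. innovation t j -` C' j \<inter> space M) = (X0 -` C' 0 \<inter> space M) \<inter> E"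
          unfolding E_def split using False by (auto simp: innovation_simps)
        also have "prob \<dots> = prob (X0 -` C' 0 \<inter> space M) * prob E"
          by (rule indep_setD[OF X0_indep X \<open>E \<in> ?\<B>\<close>])
        also have "prob E = (\<Prod>k\<in>{..<n}. prob (?D k -` C' (Suc k) \<inter> space M))"
          unfolding E_def by (rule inc) (use False in auto)
        finally show ?thesis .
      qed
      also have "\<dots> = (\<Prod>j\<in>{..n}. prob (innovation t j -` C' j \<inter> space M))"
        unfolding split by (subst prod.insert) (auto simp: prod.reindex innovation_simps)
      finally show ?thesis .
    qed
    also have "\<dots> = (\<Prod>j\<in>J. prob (innovation t j -` C' j \<inter> space M))"
      by (rule prod.mono_neutral_right) (use J full in auto)
    also have "\<dots> = (\<Prod>j\<in>J. prob (A j))"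
      using C by (intro prod.cong) (auto simp: C'_def)
    finally show "prob (\<Inter>j\<in>J. A j) = (\<Prod>j\<in>J. prob (A j))" .
  qed
qed

end

section \<open>Path functionals and the Markov property\<close>

lemma admissible_nth:
  assumes "admissible l" "k < length l"
  shows "0 < fst (l ! k) \<and> test_function (snd (l ! k))"
  using assms nth_mem[OF assms(2)] by (cases "l ! k") (auto simp: admissible_def)

context drifted_brownian_motion
begin

definition pos :: "real \<Rightarrow> 'w \<Rightarrow> real ^ 'n" where
  "pos t \<omega> = X0 \<omega> + B t \<omega> + t *\<^sub>R v"

fun path_prod :: "(real \<times> (real ^ 'n \<Rightarrow> complex)) list \<Rightarrow> real \<Rightarrow> 'w \<Rightarrow> complex" where
  "path_prod [] t \<omega> = 1"
| "path_prod ((s, h) # l) t \<omega> = h (pos (t + s) \<omega>) * path_prod l (t + s) \<omega>"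

lemma path_prod_append: "path_prod (l @ l') t \<omega> = path_prod l t \<omega> * path_prod l' (t + total l) \<omega>"
  by (induction l t \<omega> rule: path_prod.induct) (auto simp: add.assoc)

lemma path_prod_eq_prod:
  "path_prod l t \<omega> = (\<Prod>j<length l. snd (l ! j) (pos (t + total (take (Suc j) l)) \<omega>))"
  by (induction l t \<omega> rule: path_prod.induct)
     (simp_all add: prod.lessThan_Suc_shift add.assoc del: prod.lessThan_Suc)

lemma measurable_pos [measurable]: "0 \<le> t \<Longrightarrow> pos t \<in> borel_measurable M"
  unfolding pos_def[abs_def] using X0_measurable by measurable

lemma measurable_path_prod:
  "admissible l \<Longrightarrow> 0 \<le> t \<Longrightarrow> path_prod l t \<in> borel_measurable M"
proof (induction l arbitrary: t)
  case Nil
  then show ?case by (simp cong: measurable_cong)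
next
  case (Cons p l)
  obtain s h where p: "p = (s, h)" by (cases p)
  have [measurable]: "h \<in> borel_measurable borel" "pos (t + s) \<in> borel_measurable M"
      "path_prod l (t + s) \<in> borel_measurable M"
    using Cons p test_functionD(2)[of h] by auto
  have "(\<lambda>\<omega>. h (pos (t + s) \<omega>) * path_prod l (t + s) \<omega>) \<in> borel_measurable M" by measurable
  then show ?case by (simp add: p cong: measurable_cong)
qed

lemma norm_path_prod_le: "admissible l \<Longrightarrow> norm (path_prod l t \<omega>) \<le> 1"
proof (induction l t \<omega> rule: path_prod.induct)
  case (2 s h l t \<omega>)
  then show ?case
    using mult_mono[OF test_functionD(3)[of h "pos (t + s) \<omega>"], of "norm (path_prod l (t + s) \<omega>)" 1]
    by (simp add: norm_mult)
qed simp

text \<open>The term \<open>B (t 0) \<omega>\<close> stays because \<open>B 0\<close> vanishes only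
  almost surely; with \<open>t 0 = 0\<close> it disappears in \<open>markov_step\<close>.\<close>

lemma innovation_sum: "(\<Sum>i\<le>j. innovation t i \<omega>) = X0 \<omega> + B (t j) \<omega> - B (t 0) \<omega>"
  by (induction j) (simp_all add: innovation_simps)

text \<open>The past and the current position are functions of the innovations up to
  \<open>n\<close>, and the next increment is independent of them with law \<open>gauss s\<close>.
  Integrating it out by Fubini's theorem produces \<open>heat v s h\<close>.\<close>

lemma markov_step:
  assumes l: "admissible l" and s: "0 < s" and h: "test_function h"
  shows "expectation (\<lambda>\<omega>. path_prod l 0 \<omega> * h (pos (total l + s) \<omega>)) =
         expectation (\<lambda>\<omega>. path_prod l 0 \<omega> * heat v s h (pos (total l) \<omega>))"
proof -
  define n where "n = length l"
  \<comment> \<open>Observation times of \<open>l\<close>, starting from 0, with the new time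
    appended at index \<open>Suc n\<close>.\<close>
  define t where "t j = (if j \<le> n then total (take j l) else total l + s)" for j
  have t0: "t 0 = 0" and tn: "t n = total l" and tSn: "t (Suc n) = total l + s"
    by (simp_all add: t_def n_def)
  have t_less: "t k < t (Suc k)" if "k < Suc n" for k
  proof (cases "k = n")
    case True
    then show ?thesis using s by (simp add: tn tSn)
  next
    case False
    then have k: "k < length l" using that by (simp add: n_def)
    then have "0 < fst (l ! k)" using admissible_nth[OF l] by blast
    then show ?thesis using k by (simp add: t_def n_def take_Suc_conv_app_nth)
  qed
  let ?P = "Pi\<^sub>M {..n} (\<lambda>_. borel :: (real ^ 'n) measure)"
  define U where "U \<omega> = restrict (\<lambda>i. innovation t i \<omega>) {..n}" for \<omega>
  let ?P' = "Pi\<^sub>M {Suc n} (\<lambda>_. borel :: (real ^ 'n) measure)"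
  \<comment> \<open>The last increment is kept as a function on a one-point index set, the form in
    which grouped independent variables arise.\<close>
  define D where "D \<omega> = restrict (\<lambda>i. innovation t i \<omega>) {Suc n}" for \<omega>
  have "indep_vars (\<lambda>_. borel) (innovation t) {..Suc n}"
    by (rule indep_innovations) (use t0 t_less in auto)
  from indep_var_restrict[OF this, of "{..n}" "{Suc n}"]
  have "indep_var ?P U ?P' D"
    by (simp add: U_def[abs_def] D_def[abs_def])
  then have joint: "distr M ?P U \<Otimes>\<^sub>M distr M ?P' D = distr M (?P \<Otimes>\<^sub>M ?P') (\<lambda>\<omega>. (U \<omega>, D \<omega>))"
    and [measurable]: "U \<in> measurable M ?P" "D \<in> measurable M ?P'"
    unfolding indep_var_distribution_eq by auto
  have last [measurable]: "(\<lambda>d. d (Suc n)) \<in> measurable ?P' borel"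
    by (rule measurable_component_singleton) simp
  have distr_D: "distr M borel (\<lambda>\<omega>. D \<omega> (Suc n)) = gauss s"
    using distr_increment[of "total l" "total l + s"] total_nonneg[OF l] s
    by (simp add: D_def innovation_simps tn tSn)
  have heat_eq: "(\<integral>d. g (d (Suc n)) \<partial>distr M ?P' D) = (\<integral>y. g y \<partial>gauss s)"
    if [measurable]: "g \<in> borel_measurable borel" for g :: "real ^ 'n \<Rightarrow> complex"
  proof -
    have "(\<integral>d. g (d (Suc n)) \<partial>distr M ?P' D) = expectation (\<lambda>\<omega>. g (D \<omega> (Suc n)))"
      by (rule integral_distr) measurable
    also have "\<dots> = (\<integral>y. g y \<partial>distr M borel (\<lambda>\<omega>. D \<omega> (Suc n)))"
      by (rule integral_distr[symmetric]) measurable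
    finally show ?thesis by (simp only: distr_D)
  qed
  \<comment> \<open>\<open>G\<close> and \<open>Y\<close> express the past product and the current
    position through the innovations.\<close>
  define G where "G u = (\<Prod>j<n. snd (l ! j) ((\<Sum>i\<le>Suc j. u i) + t (Suc j) *\<^sub>R v))" for u :: "nat \<Rightarrow> real ^ 'n"
  define Y where "Y u = (\<Sum>i\<le>n. u i) + t n *\<^sub>R v" for u :: "nat \<Rightarrow> real ^ 'n"
  have test: "test_function (snd (l ! j))" if "j < n" for j
    using admissible_nth[OF l, of j] that by (simp add: n_def)
  have hm [measurable]: "h \<in> borel_measurable borel" by (rule test_functionD(2)[OF h])
  have hh: "test_function (heat v s h)" by (rule test_function_heat[OF s h])
  have hhm [measurable]: "heat v s h \<in> borel_measurable borel" by (rule test_functionD(2)[OF hh])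
  have G_meas [measurable]: "G \<in> borel_measurable ?P"
    unfolding G_def
  proof (rule borel_measurable_prod)
    fix j assume j: "j \<in> {..<n}"
    have "(\<lambda>u. (\<Sum>i\<le>Suc j. u i) + t (Suc j) *\<^sub>R v) \<in> borel_measurable ?P"
      using j by (intro borel_measurable_add borel_measurable_sum measurable_component_singleton) auto
    then show "(\<lambda>u. snd (l ! j) ((\<Sum>i\<le>Suc j. u i) + t (Suc j) *\<^sub>R v)) \<in> borel_measurable ?P"
      by (rule measurable_compose) (use test j in \<open>auto intro: test_functionD\<close>)
  qed
  have Y_meas [measurable]: "Y \<in> borel_measurable ?P"
    unfolding Y_def by (intro borel_measurable_add borel_measurable_sum measurable_component_singleton) auto
  have G_le: "norm (G u) \<le> 1" for u
    unfolding G_def prod_norm[symmetric] by (rule prod_le_1) (use test test_functionD(3) in auto)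
  have AE_pos: "AE \<omega> in M. \<forall>j\<le>Suc n. pos (t j) \<omega> = (\<Sum>i\<le>j. innovation t i \<omega>) + t j *\<^sub>R v"
    using B_0 by eventually_elim (simp add: pos_def innovation_sum t0)
  have AE_eq: "AE \<omega> in M. path_prod l 0 \<omega> = G (U \<omega>) \<and> pos (total l) \<omega> = Y (U \<omega>) \<and>
      pos (total l + s) \<omega> = Y (U \<omega>) + D \<omega> (Suc n) + s *\<^sub>R v"
    using AE_pos
  proof eventually_elim
    case (elim \<omega>)
    have U: "(\<Sum>i\<le>j. U \<omega> i) = (\<Sum>i\<le>j. innovation t i \<omega>)" if "j \<le> n" for j
      using that by (intro sum.cong) (auto simp: U_def)
    have "path_prod l 0 \<omega> = (\<Prod>j<n. snd (l ! j) (pos (t (Suc j)) \<omega>))"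
      unfolding path_prod_eq_prod by (intro prod.cong) (auto simp: n_def t_def)
    also have "\<dots> = G (U \<omega>)"
      unfolding G_def using elim U by (intro prod.cong) (auto simp del: sum.atMost_Suc)
    finally have 1: "path_prod l 0 \<omega> = G (U \<omega>)" .
    have 2: "pos (total l) \<omega> = Y (U \<omega>)"
      using elim[rule_format, of n] U[of n] by (simp add: Y_def tn)
    have "pos (total l + s) \<omega> = Y (U \<omega>) + D \<omega> (Suc n) + s *\<^sub>R v"
      using elim[rule_format, of "Suc n"] U[of n] by (simp add: Y_def tn tSn D_def scaleR_add_left algebra_simps)
    with 1 2 show ?case by blast
  qed
  have S: "0 \<le> total l" by (rule total_nonneg[OF l])
  have [measurable]: "path_prod l 0 \<in> borel_measurable M" by (rule measurable_path_prod[OF l]) simp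
  have [measurable]: "pos (total l) \<in> borel_measurable M" "pos (total l + s) \<in> borel_measurable M"
    using S s by auto
  let ?\<psi> = "\<lambda>(u, d). G u * h (Y u + d (Suc n) + s *\<^sub>R v)"
  have psi_meas [measurable]: "?\<psi> \<in> borel_measurable (?P \<Otimes>\<^sub>M ?P')" by measurable
  interpret U: prob_space "distr M ?P U" by (rule prob_space_distr) measurable
  interpret D: prob_space "distr M ?P' D" by (rule prob_space_distr) measurable
  interpret UD: pair_prob_space "distr M ?P U" "distr M ?P' D" ..
  have psi_int: "integrable (distr M ?P U \<Otimes>\<^sub>M distr M ?P' D) ?\<psi>"
  proof (rule UD.P.integrable_const_bound[of _ 1, OF AE_I2])
    fix p :: "(nat \<Rightarrow> real ^ 'n) \<times> (nat \<Rightarrow> real ^ 'n)"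
    show "norm (?\<psi> p) \<le> 1"
      using mult_mono[OF G_le[of "fst p"] test_functionD(3)[OF h, of "Y (fst p) + snd p (Suc n) + s *\<^sub>R v"]]
      by (simp add: case_prod_beta norm_mult)
  qed (use psi_meas in \<open>simp cong: measurable_cong_sets\<close>)
  have "expectation (\<lambda>\<omega>. path_prod l 0 \<omega> * h (pos (total l + s) \<omega>)) =
      expectation (\<lambda>\<omega>. ?\<psi> (U \<omega>, D \<omega>))"
  proof (rule integral_cong_AE)
    show "AE \<omega> in M. path_prod l 0 \<omega> * h (pos (total l + s) \<omega>) = ?\<psi> (U \<omega>, D \<omega>)"
      using AE_eq by eventually_elim simp
  qed measurable
  also have "\<dots> = (\<integral>p. ?\<psi> p \<partial>distr M (?P \<Otimes>\<^sub>M ?P') (\<lambda>\<omega>. (U \<omega>, D \<omega>)))"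
    by (rule integral_distr[symmetric]) measurable
  also have "\<dots> = (\<integral>p. ?\<psi> p \<partial>(distr M ?P U \<Otimes>\<^sub>M distr M ?P' D))"
    by (simp only: joint)
  also have "\<dots> = (\<integral>u. \<integral>d. ?\<psi> (u, d) \<partial>distr M ?P' D \<partial>distr M ?P U)"
    by (rule UD.integral_fst'[OF psi_int, symmetric])
  also have "\<dots> = (\<integral>u. G u * heat v s h (Y u) \<partial>distr M ?P U)"
  proof -
    have "(\<integral>d. h (Y u + d (Suc n) + s *\<^sub>R v) \<partial>distr M ?P' D) = heat v s h (Y u)" for u
      unfolding heat_def by (rule heat_eq) measurable
    then show ?thesis by simp
  qed
  also have "\<dots> = expectation (\<lambda>\<omega>. G (U \<omega>) * heat v s h (Y (U \<omega>)))"
    by (rule integral_distr) measurable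
  also have "\<dots> = expectation (\<lambda>\<omega>. path_prod l 0 \<omega> * heat v s h (pos (total l) \<omega>))"
  proof (rule integral_cong_AE)
    show "AE \<omega> in M. G (U \<omega>) * heat v s h (Y (U \<omega>)) = path_prod l 0 \<omega> * heat v s h (pos (total l) \<omega>)"
      using AE_eq by eventually_elim simp
  qed measurable
  finally show ?thesis .
qed

text \<open>Induction on the future \<open>l'\<close>: its first observation is moved to the end of
  the past, and \<open>markov_step\<close> then absorbs it into \<open>heat\<close>, matching the
  recursion of \<open>cyl\<close>.\<close>

lemma expectation_path_prod_append:
  assumes "admissible l" "admissible l'"
  shows "expectation (path_prod (l @ l') 0) = expectation (\<lambda>\<omega>. path_prod l 0 \<omega> * cyl v l' (pos (total l) \<omega>))"
  using assms
proof (induction l' arbitrary: l)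
  case Nil
  then show ?case by simp
next
  case (Cons p l')
  obtain s h where p: "p = (s, h)" by (cases p)
  have adm: "0 < s" "test_function h" "admissible l'" using Cons.prems p by auto
  have "expectation (path_prod (l @ p # l') 0) = expectation (path_prod ((l @ [p]) @ l') 0)" by simp
  also have "\<dots> = expectation (\<lambda>\<omega>. path_prod (l @ [p]) 0 \<omega> * cyl v l' (pos (total (l @ [p])) \<omega>))"
    by (rule Cons.IH) (use Cons.prems p in auto)
  also have "\<dots> = expectation (\<lambda>\<omega>. path_prod l 0 \<omega> * (h (pos (total l + s) \<omega>) * cyl v l' (pos (total l + s) \<omega>)))"
    by (simp add: p path_prod_append mult.assoc)
  also have "\<dots> = expectation (\<lambda>\<omega>. path_prod l 0 \<omega> * heat v s (\<lambda>y. h y * cyl v l' y) (pos (total l) \<omega>))"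
    by (rule markov_step) (use Cons.prems adm test_function_mult test_function_cyl in auto)
  finally show ?case by (simp add: p)
qed

text \<open>The \<open>n\<close>-th block of observations starts at time n + 1, so the process has
  already run for time at least 1 and \<open>heat_mixing\<close> applies whatever the law of
  \<open>X0\<close>. Blocks far apart are nearly uncorrelated for the same reason.\<close>

lemma correlation_lln:
  assumes F: "test_function F" and real: "\<And>x. cnj (F x) = F x" and ts: "\<forall>t\<in>set ts. 0 < t"
  shows "AE \<omega> in M. (\<lambda>k. (\<Sum>n<(Suc k)\<^sup>2. path_prod (map (\<lambda>t. (t, F)) (real (Suc n) # ts)) 0 \<omega>) / of_nat ((Suc k)\<^sup>2))
           \<longlonglongrightarrow> correlation v F ts 0"
proof -
  define l where "l = map (\<lambda>t. (t, F)) ts"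
  define L where "L n = (real (Suc n), F) # l" for n
  define Z where "Z n = path_prod (L n) 0" for n
  define C where "C = correlation v F ts 0"
  define Q where "Q = total l"
  define K where "K = exp (1/2) * (\<integral>n. exp (- real (sq (n :: int ^ 'n)) / 2) \<partial>lattice)"
  have l: "admissible l" using ts F by (auto simp: l_def admissible_def)
  have L: "admissible (L n)" for n using l F by (simp add: L_def)
  have Q: "0 \<le> Q" unfolding Q_def by (rule total_nonneg[OF l])
  have K: "0 \<le> K" unfolding K_def by simp
  have Z_meas [measurable]: "Z n \<in> borel_measurable M" for n
    unfolding Z_def by (rule measurable_path_prod[OF L]) simp
  have Z_le: "norm (Z n \<omega>) \<le> 1" for n \<omega> unfolding Z_def by (rule norm_path_prod_le[OF L])
  have Fl: "test_function (\<lambda>x. F x * cyl v l x)" by (intro test_function_mult F test_function_cyl l)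
  have C_eq: "C = fourier (\<lambda>x. F x * cyl v l x) 0" by (simp add: C_def correlation_def l_def)
  have C_le: "norm C \<le> 1"
    unfolding C_eq by (rule norm_fourier_le) (use test_functionD[OF Fl] in auto)
  have mix: "norm (cyl v ((s, F) # l) x - C) \<le> K * exp (- s / 2)" if "1 \<le> s" for s x
    using heat_mixing[OF that test_functionD(1)[OF Fl] test_functionD(3)[OF Fl], of v x]
    by (simp add: C_eq K_def)
  \<comment> \<open>A block starting time \<open>s\<close> after the past may be replaced by the
    constant \<open>C\<close>, up to an exponentially small error.\<close>
  have close: "norm (expectation (\<lambda>\<omega>. path_prod l1 0 \<omega> * cyl v ((s, F) # l) (pos (total l1) \<omega>)) -
      C * expectation (path_prod l1 0)) \<le> K * exp (- s / 2)"
    if l1: "admissible l1" and s: "1 \<le> s" for l1 s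
  proof -
    have m1 [measurable]: "path_prod l1 0 \<in> borel_measurable M" by (rule measurable_path_prod[OF l1]) simp
    have m2 [measurable]: "pos (total l1) \<in> borel_measurable M" using total_nonneg[OF l1] by simp
    have tc: "test_function (cyl v ((s, F) # l))" by (rule test_function_cyl) (use l F s in simp)
    have m3 [measurable]: "cyl v ((s, F) # l) \<in> borel_measurable borel" by (rule test_functionD(2)[OF tc])
    have i1: "integrable M (\<lambda>\<omega>. path_prod l1 0 \<omega> * cyl v ((s, F) # l) (pos (total l1) \<omega>))"
    proof (rule integrable_const_bound[of _ 1, OF AE_I2])
      show "norm (path_prod l1 0 \<omega> * cyl v ((s, F) # l) (pos (total l1) \<omega>)) \<le> 1" for \<omega>
        using mult_mono[OF norm_path_prod_le[OF l1, of 0 \<omega>] test_functionD(3)[OF tc, of "pos (total l1) \<omega>"]]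
        by (simp only: norm_mult mult_1 norm_ge_zero simp_thms)
    qed measurable
    have i2: "integrable M (path_prod l1 0)"
      by (rule integrable_const_bound[of _ 1, OF AE_I2]) (use norm_path_prod_le[OF l1] in auto)
    have "expectation (\<lambda>\<omega>. path_prod l1 0 \<omega> * cyl v ((s, F) # l) (pos (total l1) \<omega>)) - C * expectation (path_prod l1 0) =
        expectation (\<lambda>\<omega>. path_prod l1 0 \<omega> * (cyl v ((s, F) # l) (pos (total l1) \<omega>) - C))"
      using i1 i2 by (simp only: right_diff_distrib Bochner_Integration.integral_diff integrable_mult_left mult.commute[of C] integral_mult_left_zero)
    also have "norm \<dots> \<le> expectation (\<lambda>\<omega>. norm (path_prod l1 0 \<omega> * (cyl v ((s, F) # l) (pos (total l1) \<omega>) - C)))"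
      by (rule integral_norm_bound)
    also have "\<dots> \<le> expectation (\<lambda>\<omega>. K * exp (- s / 2))"
    proof (rule Bochner_Integration.integral_mono)
      show "integrable M (\<lambda>\<omega>. norm (path_prod l1 0 \<omega> * (cyl v ((s, F) # l) (pos (total l1) \<omega>) - C)))"
        unfolding right_diff_distrib
        by (intro integrable_norm Bochner_Integration.integrable_diff i1 integrable_mult_left i2)
      show "norm (path_prod l1 0 \<omega> * (cyl v ((s, F) # l) (pos (total l1) \<omega>) - C)) \<le> K * exp (- s / 2)" for \<omega>
        using mult_mono[OF norm_path_prod_le[OF l1, of 0 \<omega>] mix[OF s, of "pos (total l1) \<omega>"]]
        unfolding norm_mult mult_1 by simp
    qed simp
    also have "\<dots> = K * exp (- s / 2)" using prob_space by simp
    finally show ?thesis .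
  qed
  have mean: "norm (expectation (Z n) - C) \<le> K * exp (- real (Suc n) / 2)" for n
  proof -
    have "expectation (Z n) = expectation (\<lambda>\<omega>. path_prod [] 0 \<omega> * cyl v ((real (Suc n), F) # l) (pos (total []) \<omega>))"
      using expectation_path_prod_append[of "[]" "L n"] L[of n] by (simp add: Z_def L_def)
    moreover have "path_prod [] 0 = (\<lambda>_. 1)" by (simp add: fun_eq_iff)
    then have "expectation (path_prod [] 0) = 1" using prob_space by simp
    ultimately show ?thesis using close[of "[]" "real (Suc n)"] by simp
  qed
  have prod_mean: "norm (expectation (\<lambda>\<omega>. Z n \<omega> * Z m \<omega>) - C * expectation (Z n)) \<le> K * exp (- (real m - real n - Q) / 2)"
    if gap: "1 \<le> real m - real n - Q" for n m
  proof -
    \<comment> \<open>Block \<open>n\<close> ends at time n + 1 + Q and block \<open>m\<close>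
      starts at m + 1.\<close>
    let ?s = "real m - real n - Q"
    have "Z n \<omega> * Z m \<omega> = path_prod (L n @ (?s, F) # l) 0 \<omega>" for \<omega>
      by (simp add: path_prod_append Z_def L_def Q_def)
    then have "expectation (\<lambda>\<omega>. Z n \<omega> * Z m \<omega>) = expectation (path_prod (L n @ (?s, F) # l) 0)" by simp
    also have "\<dots> = expectation (\<lambda>\<omega>. path_prod (L n) 0 \<omega> * cyl v ((?s, F) # l) (pos (total (L n)) \<omega>))"
      by (rule expectation_path_prod_append[OF L]) (use gap F l in simp)
    finally show ?thesis using close[OF L gap, of n] by (simp only: Z_def)
  qed
  have Z_real: "Z n \<omega> = of_real (Re (Z n \<omega>))" for n \<omega>
  proof -
    have "cnj (path_prod (map (\<lambda>t. (t, F)) us) t \<omega>) = path_prod (map (\<lambda>t. (t, F)) us) t \<omega>" for us t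
      by (induction us arbitrary: t) (auto simp: real)
    from this[of "real (Suc n) # ts" 0] have "cnj (Z n \<omega>) = Z n \<omega>" by (simp only: Z_def L_def l_def list.map)
    then show ?thesis by (simp add: complex_eq_iff)
  qed
  have int_Z: "integrable M (Z n)" and int_ZZ: "integrable M (\<lambda>\<omega>. Z n \<omega> * Z m \<omega>)" for n m
  proof -
    show "integrable M (Z n)"
      by (rule integrable_const_bound[of _ 1, OF AE_I2]) (use Z_le in auto)
    show "integrable M (\<lambda>\<omega>. Z n \<omega> * Z m \<omega>)"
    proof (rule integrable_const_bound[of _ 1, OF AE_I2])
      show "norm (Z n \<omega> * Z m \<omega>) \<le> 1" for \<omega>
        using mult_mono[OF Z_le[of n \<omega>] Z_le[of m \<omega>]] by (simp add: norm_mult)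
    qed measurable
  qed
  \<comment> \<open>\<open>C\<close> is a limit of expectations of the real variables
    \<open>Z n\<close>.\<close>
  have C_real: "C = of_real (Re C)"
  proof -
    have "(\<lambda>n. norm (expectation (Z n) - C)) \<longlonglongrightarrow> 0"
    proof (rule tendsto_sandwich[OF _ _ tendsto_const])
      have "(\<lambda>n. K * exp (- 1 / 2) ^ Suc n) \<longlonglongrightarrow> 0"
        by (intro tendsto_mult_right_zero LIMSEQ_Suc LIMSEQ_power_zero) simp
      then show "(\<lambda>n. K * exp (- real (Suc n) / 2)) \<longlonglongrightarrow> 0"
        unfolding exp_of_nat_mult[symmetric] by (simp only: mult_minus_right times_divide_eq_right mult_1_right minus_divide_left)
    qed (use mean in auto)
    then have lim: "(\<lambda>n. expectation (Z n)) \<longlonglongrightarrow> C"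
      by (simp add: tendsto_norm_zero_iff LIM_zero_iff)
    have "Im (expectation (Z n)) = 0" for n
    proof -
      have "expectation (Z n) = expectation (\<lambda>\<omega>. complex_of_real (Re (Z n \<omega>)))" using Z_real by simp
      then show ?thesis by simp
    qed
    then have "(\<lambda>n. 0) \<longlonglongrightarrow> Im C" using tendsto_Im[OF lim] by simp
    then have "Im C = 0" by (simp add: LIMSEQ_const_iff)
    then show ?thesis by (simp add: complex_eq_iff)
  qed
  define W where "W n \<omega> = Re (Z n \<omega>) - Re C" for n \<omega>
  \<comment> \<open>The first term serves blocks with m - n < Q + 1, where only the bound 4 on the
    product is used. The second serves separated blocks, with \<open>exp (Q / 2)\<close> accounting
    for the block length.\<close>
  define K' where "K' = 4 * exp ((Q + 1) / 2) + 2 * K * exp (Q / 2)"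
  have W_le: "\<bar>W n \<omega>\<bar> \<le> 2" for n \<omega>
    using Z_le[of n \<omega>] C_le abs_Re_le_cmod[of "Z n \<omega>"] abs_Re_le_cmod[of C] unfolding W_def by linarith
  have [measurable]: "W n \<in> borel_measurable M" for n
  proof -
    have "Re \<in> borel_measurable borel" by (intro borel_measurable_continuous_onI continuous_intros)
    then show ?thesis unfolding W_def[abs_def] by measurable
  qed
  have cov: "\<bar>expectation (\<lambda>\<omega>. W n \<omega> * W m \<omega>)\<bar> \<le> K' * exp (- 1 / 2) ^ (m - n)" if nm: "n \<le> m" for n m
  proof -
    have pw: "exp (- 1 / 2) ^ (m - n) = exp (- (real m - real n) / 2)"
      unfolding exp_of_nat_mult[symmetric] using nm by (simp add: of_nat_diff field_simps)
    show ?thesis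
    proof (cases "1 \<le> real m - real n - Q")
      case False
      have "\<bar>expectation (\<lambda>\<omega>. W n \<omega> * W m \<omega>)\<bar> \<le> expectation (\<lambda>\<omega>. \<bar>W n \<omega> * W m \<omega>\<bar>)"
        using integral_norm_bound[of M "\<lambda>\<omega>. W n \<omega> * W m \<omega>"] by simp
      also have "\<dots> \<le> expectation (\<lambda>\<omega>. 4)"
      proof (rule Bochner_Integration.integral_mono)
        have le: "\<bar>W n \<omega> * W m \<omega>\<bar> \<le> 4" for \<omega>
          using mult_mono[OF W_le[of n \<omega>] W_le[of m \<omega>]] by (simp add: abs_mult)
        then show "\<bar>W n \<omega> * W m \<omega>\<bar> \<le> 4" for \<omega> .
        show "integrable M (\<lambda>\<omega>. \<bar>W n \<omega> * W m \<omega>\<bar>)"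
          by (rule integrable_const_bound[of _ 4, OF AE_I2]) (use le in auto)
      qed simp
      also have "\<dots> = 4" using prob_space by simp
      also have "4 \<le> 4 * exp ((Q + 1) / 2) * exp (- (real m - real n) / 2)"
      proof -
        have "0 \<le> (Q + 1) / 2 + - (real m - real n) / 2" using False by argo
        then have "1 \<le> exp ((Q + 1) / 2 + - (real m - real n) / 2)" by simp
        then show ?thesis unfolding exp_add by simp
      qed
      also have "\<dots> \<le> K' * exp (- (real m - real n) / 2)"
        using K by (intro mult_right_mono) (auto simp: K'_def)
      finally show ?thesis by (simp only: pw)
    next
      case True
      have "complex_of_real (expectation (\<lambda>\<omega>. W n \<omega> * W m \<omega>)) = expectation (\<lambda>\<omega>. (Z n \<omega> - C) * (Z m \<omega> - C))"
      proof -
        have "(Z n \<omega> - C) * (Z m \<omega> - C) = complex_of_real (W n \<omega> * W m \<omega>)" for \<omega>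
          by (subst Z_real, subst (2) Z_real, subst C_real, subst (2) C_real) (simp add: W_def)
        then show ?thesis by (simp del: of_real_mult)
      qed
      also have "\<dots> = expectation (\<lambda>\<omega>. Z n \<omega> * Z m \<omega> - C * Z n \<omega> - (C * Z m \<omega> - C * C))"
        by (simp add: algebra_simps)
      also have "\<dots> = (expectation (\<lambda>\<omega>. Z n \<omega> * Z m \<omega>) - C * expectation (Z n)) - C * (expectation (Z m) - C)"
        using int_Z int_ZZ prob_space by (simp add: right_diff_distrib)
      also have "norm \<dots> \<le> K * exp (- (real m - real n - Q) / 2) + 1 * (K * exp (- real (Suc m) / 2))"
        by (intro order_trans[OF norm_triangle_ineq4] add_mono prod_mean[OF True])
           (unfold norm_mult, intro mult_mono C_le mean, auto)
      also have "\<dots> \<le> K * exp (- (real m - real n - Q) / 2) + K * exp (- (real m - real n - Q) / 2)"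
        using K Q by (intro add_left_mono) (auto intro!: mult_left_mono)
      also have "\<dots> = 2 * K * exp (Q / 2) * exp (- (real m - real n) / 2)"
        by (simp add: mult.assoc exp_add[symmetric] diff_divide_distrib)
      also have "\<dots> \<le> K' * exp (- (real m - real n) / 2)"
        by (intro mult_right_mono) (auto simp: K'_def)
      finally show ?thesis by (simp only: pw norm_of_real)
    qed
  qed
  have "AE \<omega> in M. (\<lambda>k. (\<Sum>n<(Suc k)\<^sup>2. W n \<omega>) / real ((Suc k)\<^sup>2)) \<longlonglongrightarrow> 0"
    by (rule lln_square_subsequence[where \<rho>="exp (- 1 / 2)"]) (use W_le cov in auto)
  then show ?thesis
  proof eventually_elim
    case (elim \<omega>)
    have "complex_of_real ((\<Sum>n<(Suc k)\<^sup>2. W n \<omega>) / real ((Suc k)\<^sup>2) + Re C) =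
        (\<Sum>n<(Suc k)\<^sup>2. Z n \<omega>) / of_nat ((Suc k)\<^sup>2)" for k
    proof -
      have "(\<Sum>n<(Suc k)\<^sup>2. W n \<omega>) = (\<Sum>n<(Suc k)\<^sup>2. Re (Z n \<omega>)) - real ((Suc k)\<^sup>2) * Re C"
        by (simp add: W_def sum_subtractf)
      then have "(\<Sum>n<(Suc k)\<^sup>2. W n \<omega>) / real ((Suc k)\<^sup>2) + Re C =
          (\<Sum>n<(Suc k)\<^sup>2. Re (Z n \<omega>)) / real ((Suc k)\<^sup>2)"
        by (simp add: diff_divide_distrib)
      then show ?thesis
        by (simp only: of_real_divide of_real_sum Z_real[symmetric] of_real_of_nat_eq)
    qed
    with tendsto_of_real[OF tendsto_add[OF elim tendsto_const[of "Re C"]], where 'a=complex]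
    show ?case by (simp only: Z_def L_def l_def C_def[symmetric] list.map add_0 C_real[symmetric])
  qed
qed

end

section \<open>Reconstruction\<close>

text \<open>Open sets of the circle are defined by their preimages in the line, so continuity of a
  rotation reduces to continuity of a translation of the reals.\<close>

lemma measurable_torus_shift:
  "(\<lambda>x :: 'n::finite torus. x + to_torus a) \<in> borel_measurable borel"
proof -
  have circle: "continuous_on UNIV (\<lambda>x. x + to_circle r)" for r
    unfolding continuous_on_open_vimage[OF open_UNIV]
  proof (intro allI impI)
    fix U :: "circle set" assume "open U"
    then have "open (to_circle -` U)" by (simp only: open_circle_def)
    then have "open ((\<lambda>s. s + r) -` (to_circle -` U))"
      by (rule open_vimage) (intro continuous_intros)
    also have "(\<lambda>s. s + r) -` (to_circle -` U) = to_circle -` ((\<lambda>x. x + to_circle r) -` U)"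
      by (auto simp: plus_circle.abs_eq to_circle_def)
    finally show "open ((\<lambda>x. x + to_circle r) -` U \<inter> UNIV)"
      by (simp only: open_circle_def Int_UNIV_right)
  qed
  have "continuous_on UNIV (\<lambda>x :: 'n torus. \<chi> i. x $ i + to_circle (a $ i))"
    by (intro continuous_on_vec_lambda continuous_on_compose2[OF circle] continuous_intros) auto
  also have "(\<lambda>x :: 'n torus. \<chi> i. x $ i + to_circle (a $ i)) = (\<lambda>x. x + to_torus a)"
    by (simp add: fun_eq_iff vec_eq_iff to_torus_def)
  finally show ?thesis by (rule borel_measurable_continuous_onI)
qed

text \<open>The density of \<open>haar\<close> is positive on the half-open cube from which
  \<open>torus_lebesgue\<close> is transported, so almost-everywhere statements carry over.\<close>

lemma AE_torus_lebesgueI: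
  fixes P :: "'n::finite torus \<Rightarrow> bool"
  assumes P: "{x. P x} \<in> sets borel" and AE: "AE x in haar. P (to_torus x)"
  shows "AE x in torus_lebesgue. P x"
proof -
  let ?Q = "{x :: real ^ 'n. \<forall>i. 0 \<le> x $ i \<and> x $ i < 2 * pi}"
  have Q: "?Q \<in> sets borel" by measurable
  have "AE x in lborel. 0 < ennreal (\<Prod>i\<in>UNIV. indicator {0..2 * pi} (x $ i :: real) / (2 * pi)) \<longrightarrow> P (to_torus x)"
    using AE unfolding haar_def prod_density_def by (subst (asm) AE_density) auto
  then have "AE x in lborel. x \<in> ?Q \<longrightarrow> P (to_torus x)"
  proof eventually_elim
    case (elim x)
    show ?case
    proof
      assume "x \<in> ?Q"
      then have "0 < (\<Prod>i\<in>UNIV. indicator {0..2 * pi} (x $ i) / (2 * pi) :: real)"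
        by (intro prod_pos) (auto simp: less_imp_le)
      then show "P (to_torus x)" using elim by simp
    qed
  qed
  then have "AE x in restrict_space lborel ?Q. P (to_torus x)"
    using Q by (subst AE_restrict_space_iff) auto
  moreover have "to_torus \<in> restrict_space lborel ?Q \<rightarrow>\<^sub>M borel"
    by (rule measurable_restrict_space1) measurable
  ultimately show ?thesis
    unfolding torus_lebesgue_def using P by (subst AE_distr_iff) auto
qed

definition lift_torus :: "('n::finite torus \<Rightarrow> real) \<Rightarrow> real ^ 'n \<Rightarrow> complex" where
  "lift_torus f x = of_real (f (to_torus x))"

lemma jordan_indicator_measurable:
  "f \<in> jordan_indicators \<Longrightarrow> f \<in> borel_measurable borel"
  by (auto simp: jordan_indicators_def)

lemma test_function_lift_torus:
  fixes f :: "'n::finite torus \<Rightarrow> real"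
  assumes "f \<in> jordan_indicators"
  shows "test_function (lift_torus f)"
proof -
  have [measurable]: "f \<in> borel_measurable borel" by (rule jordan_indicator_measurable[OF assms])
  have "lift_torus f \<in> borel_measurable borel" unfolding lift_torus_def[abs_def] by measurable
  moreover have "periodic (lift_torus f)" by (simp add: periodic_def lift_torus_def)
  moreover have "norm (lift_torus f x) \<le> 1" for x
    using assms by (auto simp: lift_torus_def jordan_indicators_def indicator_def)
  ultimately show ?thesis by (auto simp: test_function_def intro: bounded_periodicI)
qed

text \<open>Counterpart of \<open>path_prod\<close> that is computed from the observed real path
  alone.\<close>

fun observed_prod :: "(real \<Rightarrow> real) \<Rightarrow> real list \<Rightarrow> real \<Rightarrow> real" where
  "observed_prod y [] t = 1"
| "observed_prod y (s # ts) t = y (t + s) * observed_prod y ts (t + s)"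

text \<open>Relates a path and a candidate \<open>f\<close> without reference to the probability
  space, so it can be used to define the reconstruction map.\<close>

definition typical :: "real ^ 'n::finite \<Rightarrow> ('n torus \<Rightarrow> real) \<Rightarrow> (real \<Rightarrow> real) \<Rightarrow> bool" where
  "typical v f y \<longleftrightarrow> (\<forall>ts. (\<forall>t\<in>set ts. t \<in> \<rat> \<and> 0 < t) \<longrightarrow>
     (\<lambda>k. (\<Sum>n<(Suc k)\<^sup>2. complex_of_real (observed_prod y (real (Suc n) # ts) 0)) / of_nat ((Suc k)\<^sup>2))
       \<longlonglongrightarrow> correlation v (lift_torus f) ts 0)"

text \<open>Limits are unique, so two functions for which one path is typical share all correlations
  with rational gaps.\<close>

lemma typical_determines:
  fixes f g :: "'n::finite torus \<Rightarrow> real"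
  assumes v: "rationally_independent v" and f: "f \<in> jordan_indicators" and g: "g \<in> jordan_indicators"
    and y: "typical v f y" "typical v g y"
  shows "\<exists>\<theta>. AE x in torus_lebesgue. g x = f (x + \<theta>)"
proof -
  have "\<exists>\<theta>. AE x in haar. lift_torus g x = lift_torus f (x + \<theta>)"
  proof (rule correlations_determine[OF v])
    show "bounded_periodic (lift_torus f)" "bounded_periodic (lift_torus g)"
      using test_function_lift_torus[OF f] test_function_lift_torus[OF g] by (auto simp: test_function_def)
    show "cnj (lift_torus f x) = lift_torus f x" "cnj (lift_torus g x) = lift_torus g x" for x
      by (simp_all add: lift_torus_def)
    show "correlation v (lift_torus f) ts 0 = correlation v (lift_torus g) ts 0"
      if "\<forall>t\<in>set ts. t \<in> \<rat> \<and> 0 < t" for ts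
      using y that unfolding typical_def by (blast intro: LIMSEQ_unique)
  qed
  then obtain \<theta> where \<theta>: "AE x in haar. lift_torus g x = lift_torus f (x + \<theta>)" by blast
  have [measurable]: "f \<in> borel_measurable borel" "g \<in> borel_measurable borel"
    by (intro jordan_indicator_measurable f g)+
  note [measurable] = measurable_torus_shift[of \<theta>]
  have "AE x in torus_lebesgue. g x = f (x + to_torus \<theta>)"
  proof (rule AE_torus_lebesgueI)
    have "(\<lambda>x. f (x + to_torus \<theta>)) \<in> borel_measurable borel" by measurable
    from borel_measurable_eq[OF _ this, of g]
    show "{x. g x = f (x + to_torus \<theta>)} \<in> sets borel" by simp
    show "AE x in haar. g (to_torus x) = f (to_torus x + to_torus \<theta>)"
      using \<theta> by eventually_elim (simp add: lift_torus_def to_torus_add)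
  qed
  then show ?thesis by blast
qed

lemma (in drifted_brownian_motion) typical_observations:
  fixes f :: "'n torus \<Rightarrow> real"
  assumes f: "f \<in> jordan_indicators"
    and X: "\<And>t \<omega>. 0 \<le> t \<Longrightarrow> \<omega> \<in> space M \<Longrightarrow> X t \<omega> = to_torus (pos t \<omega>)"
  shows "AE \<omega> in M. typical v f (restrict (\<lambda>t. f (X t \<omega>)) {0..})"
proof -
  let ?F = "lift_torus f" and ?I = "{ts. \<forall>t\<in>set ts. t \<in> \<rat> \<and> 0 < t} :: real list set"
  \<comment> \<open>Lists of rationals are countable, so the exceptional null sets can be
    united.\<close>
  have I: "countable ?I"
    by (rule countable_subset[OF _ countable_lists[OF countable_rat]]) auto
  have lln: "AE \<omega> in M. (\<lambda>k. (\<Sum>n<(Suc k)\<^sup>2. path_prod (map (\<lambda>t. (t, ?F)) (real (Suc n) # ts)) 0 \<omega>) / of_nat ((Suc k)\<^sup>2))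
           \<longlonglongrightarrow> correlation v ?F ts 0" if "ts \<in> ?I" for ts
    by (rule correlation_lln[OF test_function_lift_torus[OF f]]) (use that in \<open>auto simp: lift_torus_def\<close>)
  have "AE \<omega> in M. \<forall>ts\<in>?I. (\<lambda>k. (\<Sum>n<(Suc k)\<^sup>2. path_prod (map (\<lambda>t. (t, ?F)) (real (Suc n) # ts)) 0 \<omega>) / of_nat ((Suc k)\<^sup>2))
           \<longlonglongrightarrow> correlation v ?F ts 0"
    by (rule AE_ball_countable'[OF lln I])
  then show ?thesis
    using AE_space
  proof eventually_elim
    case (elim \<omega>)
    \<comment> \<open>All observation times are nonnegative, hence unaffected by the restriction of
      the path to \<open>{0..}\<close>.\<close>
    have obs: "complex_of_real (observed_prod (restrict (\<lambda>t. f (X t \<omega>)) {0..}) us t) = path_prod (map (\<lambda>t. (t, ?F)) us) t \<omega>"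
      if "\<forall>u\<in>set us. 0 < u" "0 \<le> t" for us t
      using that
      by (induction us arbitrary: t) (auto simp: X[OF _ elim(2)] lift_torus_def)
    have "(\<Sum>n<N. path_prod (map (\<lambda>t. (t, ?F)) (real (Suc n) # ts)) 0 \<omega>) =
        (\<Sum>n<N. complex_of_real (observed_prod (restrict (\<lambda>t. f (X t \<omega>)) {0..}) (real (Suc n) # ts) 0))"
      if "ts \<in> ?I" for ts N
      by (intro sum.cong refl obs[symmetric]) (use that in auto)
    then show ?case
      using elim(1) unfolding typical_def by simp
  qed
qed

theorem corollary7:
  fixes M :: "'w measure"
    and v :: "real ^ 'n::finite"
    and X :: "real \<Rightarrow> 'w \<Rightarrow> 'n torus"
  assumes "torus_brownian_motion M v X"
    and "rationally_independent v"
  shows "reconstructible M X jordan_indicators"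
proof -
  from assms(1) obtain X0 B where bm: "standard_brownian_motion M B" and X0: "X0 \<in> M \<rightarrow>\<^sub>M borel"
    and indep: "prob_space.indep_set M
          (sets (vimage_algebra (space M) X0 borel))
          (sets (vimage_algebra (space M) (\<lambda>\<omega>. restrict (\<lambda>t. B t \<omega>) {0..}) (Pi\<^sub>M {0..} (\<lambda>_. borel))))"
    and X: "\<forall>t\<ge>0. \<forall>\<omega>\<in>space M. X t \<omega> = to_torus (X0 \<omega> + B t \<omega> + t *\<^sub>R v)"
    unfolding torus_brownian_motion_def by blast
  interpret drifted_brownian_motion M B X0 v
    using bm X0 indep by unfold_locales
  \<comment> \<open>The map depends on \<open>v\<close>, but neither on \<open>f\<close> nor on
    \<open>\<omega>\<close>; its value is arbitrary at paths typical for no member of the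
    family.\<close>
  let ?A = "\<lambda>y. SOME f. f \<in> jordan_indicators \<and> typical v f y"
  show ?thesis
    unfolding reconstructible_def
  proof (intro exI[of _ ?A] ballI)
    fix f :: "'n torus \<Rightarrow> real" assume f: "f \<in> jordan_indicators"
    have "AE \<omega> in M. typical v f (restrict (\<lambda>t. f (X t \<omega>)) {0..})"
      by (rule typical_observations[OF f]) (use X in \<open>simp add: pos_def\<close>)
    then show "AE \<omega> in M. \<exists>\<theta>. AE x in torus_lebesgue. ?A (restrict (\<lambda>t. f (X t \<omega>)) {0..}) x = f (x + \<theta>)"
    proof eventually_elim
      case (elim \<omega>)
      let ?y = "restrict (\<lambda>t. f (X t \<omega>)) {0..}"
      \<comment> \<open>The true \<open>f\<close> witnesses the choice, so the chosen function and
        \<open>f\<close> have the path \<open>?y\<close> as a common typical path.\<close>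
      have "?A ?y \<in> jordan_indicators \<and> typical v (?A ?y) ?y"
        by (rule someI[of _ f]) (use f elim in blast)
      then show ?case
        using typical_determines[OF assms(2) f _ elim] by blast
    qed
  qed
qed

end
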